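(* Consider the simplified game of baccara banque with parameter $\theta\in(0,1/2]$, and consider its correlated cooperative equilibrium and its independent cooperative equilibrium (see context). Then: (a) The two equilibria coincide for every $\theta$ in the open interval $\left(\frac{9588}{37663},\frac{55716}{128711}\right)\approx(0.254573,\,0.432877)$. For these $\theta$ (apart from the boundary points between adjacent subintervals on which Banker's strategy has a fixed form, where the solutions from both adjacent subintervals apply) the Players' strategy at the correlated cooperative equilibrium is $\boldsymbol p=(p_{00},p_{01},p_{10},p_{11})=\left(\frac{4}{121},\frac{18}{121},\frac{18}{121},\frac{81}{121}\right)$, that is, Players 1 and 2 play independently, drawing on 5 with probabilities $p_1=p_2=9/11$. (b) With two exceptions, the $\theta$ in this open interval are the only values of $\theta\in(0,1/2]$ at which the two equilibria coincide. The two exceptions, at which the equilibria also coincide, are $\theta=\frac{5621}{33696}\approx0.166815$ and $\theta\approx0.215651$, the latter being a root of $29851341-1952936938\,\theta+8414116560\,\theta^2$.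
   Context: Simplified game of baccara banque. Let $X_1,X_2,Y$ be i.i.d. on $\{0,\ldots,9\}$ with $P(\cdot=i)=q(i)=(16+9\delta_{i,0})/13^2$, where $\delta_{i,j}$ is the Kronecker delta (two-card totals of Player 1, Player 2, Banker), and let $X_1',X_2',Y'$ be i.i.d. on $\{0,\ldots,9\}$, independent of these, with $P(\cdot=k)=q'(k)=(1+3\delta_{k,0})/13$ (third-card values). $M(i)$ is the remainder of $i$ modulo $10$. Player $i$'s pure strategies are $u_i\in\{0,1\}$ ($0$ = stand on two-card total 5, $1$ = draw on 5); Player $i$ draws iff $X_i\le 4+u_i$. Put $K_i=X_i'$ if $X_i\le 4+u_i$, $K_i=10$ if $5+u_i\le X_i\le 7$ (stand), $K_i=11$ if $X_i\in\{8,9\}$ (natural); put $F_i=M(X_i+X_i')$ if $X_i\le 4+u_i$ and $F_i=X_i$ otherwise. Banker's information sets are the 1144 triples $(k_1,k_2,j)\in I:=[\{0,\ldots,11\}^2\setminus\{(11,11)\}]\times\{0,\ldots,7\}$; a Banker pure strategy is a subset $T\subset I$, the set on which he draws. If $Y\ge 8$ or both $X_1,X_2\ge 8$, set $G_i=\mathrm{sgn}(X_i-Y)$. Otherwise let $B=M(Y+Y')$ if $(K_1,K_2,Y)\in T$ and $B=Y$ if not, and set $G_i=1$ if $X_i\ge 8$ and $G_i=\mathrm{sgn}(F_i-B)$ if $X_i\le 7$. Here $\theta$ is the proportion of the total amount bet that is bet on Player 1's hand. The joint payoff to the Players is $a_{u_1,u_2,T}(\theta)=E[\theta G_1+(1-\theta)G_2]$;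 the payoff to Banker is $-a_{u_1,u_2,T}(\theta)$. The correlated cooperative equilibrium is the solution of the two-person zero-sum matrix game with payoffs $a_{u_1,u_2,T}(\theta)$ to the coalition of the two Players against Banker, where the coalition may use any mixture $\boldsymbol p=(p_{00},p_{01},p_{10},p_{11})$ of $(u_1,u_2)=(0,0),(0,1),(1,0),(1,1)$ and Banker any mixture of the subsets $T$; its value is $\overline v(\theta)=\max_{\boldsymbol p}\min_T\sum p_{u_1u_2}a_{u_1,u_2,T}(\theta)$. The independent cooperative equilibrium is the solution of the same game when the Players are constrained to act independently, i.e. the coalition is restricted to product mixtures $\boldsymbol p=((1-p_1)(1-p_2),(1-p_1)p_2,p_1(1-p_2),p_1p_2)$, $p_1,p_2\in[0,1]$, where $p_i$ is the probability that Player $i$ draws on 5; its lower value is $\underline v(\theta)=\max_{\boldsymbol p\text{ product}}\min_T\sum p_{u_1u_2}a_{u_1,u_2,T}(\theta)$ and its upper value equals $\overline v(\theta)$. The two equilibria are said to coincide at $\theta$ when $\underline v(\theta)=\overline v(\theta)$, equivalently when the maximum defining $\overline v(\theta)$ is attained at a product mixture.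
   Formalization: In (b) the two endpoints 9588/37663 and 55716/128711 of the open interval are added to the values of θ at which the two equilibria coincide; by continuity of both values in θ and part (a) they do coincide there, so (b) as worded is false at these two points. *)

theory Defs
  imports "HOL-Probability.Probability"
begin

section \<open>Cards\<close>

definition two_card_prob :: "nat \<Rightarrow> real" where
  "two_card_prob i = (if i \<le> 9 then (16 + 9 * of_bool (i = 0)) / 13\<^sup>2 else 0)"

definition third_card_prob :: "nat \<Rightarrow> real" where
  "third_card_prob k = (if k \<le> 9 then (1 + 3 * of_bool (k = 0)) / 13 else 0)"

definition two_card_total :: "nat pmf" where
  "two_card_total = embed_pmf two_card_prob"

definition third_card :: "nat pmf" where
  "third_card = embed_pmf third_card_prob"

lemma nn_integral_count_space_atMost_9:
  fixes f :: "nat \<Rightarrow> real"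
  assumes "\<And>x. f x \<ge> 0" "\<And>x. x > 9 \<Longrightarrow> f x = 0" "sum f {..9} = 1"
  shows "(\<integral>\<^sup>+x. ennreal (f x) \<partial>count_space UNIV) = 1"
proof -
  have "(\<integral>\<^sup>+x. ennreal (f x) \<partial>count_space UNIV) = (\<Sum>x\<in>{..9}. ennreal (f x))"
    by (rule nn_integral_count_space') (use assms(2) in \<open>auto simp: not_le\<close>)
  also have "\<dots> = ennreal (sum f {..9})"
    by (rule sum_ennreal) (use assms(1) in auto)
  finally show ?thesis using assms(3) by simp
qed

lemma pmf_two_card_total: "pmf two_card_total i = two_card_prob i"
  unfolding two_card_total_def
  by (rule pmf_embed_pmf, simp add: two_card_prob_def, rule nn_integral_count_space_atMost_9)
     (simp_all add: two_card_prob_def eval_nat_numeral)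

lemma pmf_third_card: "pmf third_card k = third_card_prob k"
  unfolding third_card_def
  by (rule pmf_embed_pmf, simp add: third_card_prob_def, rule nn_integral_count_space_atMost_9)
     (simp_all add: third_card_prob_def eval_nat_numeral)

text \<open>A deal is \<open>(X\<^sub>1, X\<^sub>2, Y, X\<^sub>1', X\<^sub>2', Y')\<close>.\<close>

type_synonym deal = "nat \<times> nat \<times> nat \<times> nat \<times> nat \<times> nat"

definition deal_pmf :: "deal pmf" where
  "deal_pmf = pair_pmf two_card_total (pair_pmf two_card_total (pair_pmf two_card_total
     (pair_pmf third_card (pair_pmf third_card third_card))))"

section \<open>One coup\<close>

text \<open>A Player's pure strategy is a truth value: \<open>False\<close> is 0 (stand on 5) and
  \<open>True\<close> is 1 (draw on 5).\<close>

definition player_draws :: "bool \<Rightarrow> nat \<Rightarrow> bool" where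
  "player_draws u x \<longleftrightarrow> x \<le> 4 + of_bool u"

definition signal :: "bool \<Rightarrow> nat \<Rightarrow> nat \<Rightarrow> nat" where
  "signal u x x' = (if player_draws u x then x' else if x \<le> 7 then 10 else 11)"

definition player_total :: "bool \<Rightarrow> nat \<Rightarrow> nat \<Rightarrow> nat" where
  "player_total u x x' = (if player_draws u x then (x + x') mod 10 else x)"

type_synonym info_set = "nat \<times> nat \<times> nat"

definition info_sets :: "info_set set" where
  "info_sets = {(k\<^sub>1, k\<^sub>2, j). k\<^sub>1 \<in> {0..11} \<and> k\<^sub>2 \<in> {0..11} \<and> (k\<^sub>1, k\<^sub>2) \<noteq> (11, 11) \<and> j \<in> {0..7}}"

definition banker_pure :: "info_set set set" where
  "banker_pure = Pow info_sets"

definition ends_at_once :: "nat \<Rightarrow> nat \<Rightarrow> nat \<Rightarrow> bool" where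
  "ends_at_once x\<^sub>1 x\<^sub>2 y \<longleftrightarrow> y \<ge> 8 \<or> (x\<^sub>1 \<ge> 8 \<and> x\<^sub>2 \<ge> 8)"

definition banker_total :: "bool \<times> bool \<Rightarrow> info_set set \<Rightarrow> deal \<Rightarrow> nat" where
  "banker_total = (\<lambda>(u\<^sub>1, u\<^sub>2) T (x\<^sub>1, x\<^sub>2, y, x\<^sub>1', x\<^sub>2', y').
     if (signal u\<^sub>1 x\<^sub>1 x\<^sub>1', signal u\<^sub>2 x\<^sub>2 x\<^sub>2', y) \<in> T then (y + y') mod 10 else y)"

definition gain\<^sub>1 :: "bool \<times> bool \<Rightarrow> info_set set \<Rightarrow> deal \<Rightarrow> real" where
  "gain\<^sub>1 = (\<lambda>(u\<^sub>1, u\<^sub>2) T (x\<^sub>1, x\<^sub>2, y, x\<^sub>1', x\<^sub>2', y').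
     if ends_at_once x\<^sub>1 x\<^sub>2 y then sgn (real x\<^sub>1 - real y)
     else if x\<^sub>1 \<ge> 8 then 1
     else sgn (real (player_total u\<^sub>1 x\<^sub>1 x\<^sub>1')
                 - real (banker_total (u\<^sub>1, u\<^sub>2) T (x\<^sub>1, x\<^sub>2, y, x\<^sub>1', x\<^sub>2', y'))))"

definition gain\<^sub>2 :: "bool \<times> bool \<Rightarrow> info_set set \<Rightarrow> deal \<Rightarrow> real" where
  "gain\<^sub>2 = (\<lambda>(u\<^sub>1, u\<^sub>2) T (x\<^sub>1, x\<^sub>2, y, x\<^sub>1', x\<^sub>2', y').
     if ends_at_once x\<^sub>1 x\<^sub>2 y then sgn (real x\<^sub>2 - real y)
     else if x\<^sub>2 \<ge> 8 then 1
     else sgn (real (player_total u\<^sub>2 x\<^sub>2 x\<^sub>2')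
                 - real (banker_total (u\<^sub>1, u\<^sub>2) T (x\<^sub>1, x\<^sub>2, y, x\<^sub>1', x\<^sub>2', y'))))"

definition payoff :: "real \<Rightarrow> bool \<times> bool \<Rightarrow> info_set set \<Rightarrow> real" where
  "payoff \<theta> u T =
     measure_pmf.expectation deal_pmf (\<lambda>\<omega>. \<theta> * gain\<^sub>1 u T \<omega> + (1 - \<theta>) * gain\<^sub>2 u T \<omega>)"

section \<open>Cooperative equilibria\<close>

text \<open>
  A mixture \<open>p = (p\<^sub>0\<^sub>0, p\<^sub>0\<^sub>1, p\<^sub>1\<^sub>0, p\<^sub>1\<^sub>1)\<close> of the coalition's four pure strategies is a probability
  mass function on \<open>bool \<times> bool\<close>; it needs no support condition, since each pair is admissible.
\<close>

definition mixed_payoff :: "real \<Rightarrow> (bool \<times> bool) pmf \<Rightarrow> info_set set pmf \<Rightarrow> real" where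
  "mixed_payoff \<theta> p \<beta> =
     measure_pmf.expectation (pair_pmf p \<beta>) (\<lambda>(u, T). payoff \<theta> u T)"

definition guaranteed :: "real \<Rightarrow> (bool \<times> bool) pmf \<Rightarrow> real" where
  "guaranteed \<theta> p = (MIN T\<in>banker_pure. measure_pmf.expectation p (\<lambda>u. payoff \<theta> u T))"

definition correlated_equilibrium ::
    "real \<Rightarrow> (bool \<times> bool) pmf \<Rightarrow> info_set set pmf \<Rightarrow> bool" where
  "correlated_equilibrium \<theta> p \<beta> \<longleftrightarrow>
     set_pmf \<beta> \<subseteq> banker_pure \<and>
     (\<forall>p'. mixed_payoff \<theta> p' \<beta> \<le> mixed_payoff \<theta> p \<beta>) \<and>
     (\<forall>\<beta>'. set_pmf \<beta>' \<subseteq> banker_pure \<longrightarrow> mixed_payoff \<theta> p \<beta> \<le> mixed_payoff \<theta> p \<beta>')"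

definition product_mixture :: "real \<Rightarrow> real \<Rightarrow> (bool \<times> bool) pmf" where
  "product_mixture p\<^sub>1 p\<^sub>2 = pair_pmf (bernoulli_pmf p\<^sub>1) (bernoulli_pmf p\<^sub>2)"

text \<open>
  Both suprema below are maxima: \<open>guaranteed\<close> is continuous in the mixture, and the mixtures, as
  well as the product mixtures, form a compact set.
\<close>

definition correlated_value :: "real \<Rightarrow> real" where
  "correlated_value \<theta> = (SUP p. guaranteed \<theta> p)"

definition independent_lower_value :: "real \<Rightarrow> real" where
  "independent_lower_value \<theta> =
     (SUP (p\<^sub>1, p\<^sub>2)\<in>{0..1} \<times> {0..1}. guaranteed \<theta> (product_mixture p\<^sub>1 p\<^sub>2))"

definition equilibria_coincide :: "real \<Rightarrow> bool" where
  "equilibria_coincide \<theta> \<longleftrightarrow> independent_lower_value \<theta> = correlated_value \<theta>"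

end

theory Submission
  imports Defs
begin

text \<open>
  Banker's decisions at different information sets do not interact: replacing standing by drawing
  at the set \<open>i\<close> changes the joint payoff by a fixed amount, whatever he does elsewhere
  (lemma \<open>payoff_eq\<close>). Against a mixture \<open>p\<close> his best reply therefore draws exactly where this
  change is negative, and the guaranteed payoff is
  \<open>l(\<theta>, p) + (\<Sum>i. min 0 (h\<^sub>i(\<theta>, p)))\<close>,
  where \<open>l\<close> and every \<open>h\<^sub>i\<close> are bilinear in \<open>(\<theta>, 1 - \<theta>)\<close> and \<open>p\<close> (lemma \<open>guaranteed_eq\<close>). For
  \<open>\<theta> \<le> 1/2\<close> the sign of \<open>h\<^sub>i\<close> depends on \<open>p\<close> or \<open>\<theta>\<close> for 147 of the 1144 sets only. The whole proof is
  about this concave piecewise linear function of \<open>p\<close>, called \<open>worth\<close> below. Replacing each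
  \<open>min 0 h\<^sub>i\<close> by \<open>w\<^sub>i h\<^sub>i\<close> with \<open>w\<^sub>i \<in> [0, 1]\<close>, that is, fixing a mixed strategy of Banker, turns it into an
  upper bound that is linear in \<open>p\<close>; these bounds are the \<open>responses\<close>.

  The plateau. Drawing on 5 with probability 9/11 makes Banker indifferent, whatever \<open>\<theta>\<close> is, when he
  holds 6 and both Players stand, or one stands and the other has a natural. At the mixture
  \<open>(4, 18, 18, 81)/121\<close> three of the functions \<open>h\<^sub>i\<close> vanish together, and they determine this mixture. On each interval on which the
  other signs at this mixture are constant, weights for the three can be computed that make the
  response constant in \<open>p\<close>. They lie strictly between 0 and 1 for all \<open>\<theta>\<close> of the closed interval of
  part (a), so the mixture is the only maximizer, and Banker's equilibrium strategy is a strategy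
  with these drawing probabilities (lemmas \<open>balanced_at_star_optimum\<close> and \<open>plateau\<close>).

  No coincidence. On an interval of \<open>\<theta>\<close> let the coalition's mixture move along a segment. The
  payoff it guarantees is bounded below by a quadratic polynomial in Bernstein form. The square of
  product mixtures is cut into a few rectangles; a response is bilinear in \<open>(p\<^sub>1, p\<^sub>2)\<close>, so on a
  rectangle it stays below the guaranteed payoff as soon as it does so at the four corners (lemma
  \<open>refutes\<close>). Twenty such intervals, found by linear programming and checked in integer arithmetic,
  cover everything outside the plateau except a point and a short interval. Where the gap between the
  two values closes, the interval is half open and its segment starts at the product optimum.

  The exceptions. At \<open>\<theta> = 5621/33696\<close> a response that is constant in \<open>p\<close> certifies a product
  mixture. Near \<open>0.215651\<close> the optimum is again determined by three kinks, now at a mixture that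
  moves with \<open>\<theta>\<close>; being a product is a quadratic condition on \<open>\<theta>\<close> (lemma \<open>coincide_second_iff\<close>).
\<close>

section \<open>The payoff as a sum over information sets\<close>

text \<open>
  All probabilities are kept as integers: two-card totals have denominator \<open>13\<^sup>2\<close> and third cards
  denominator 13, so a deal has denominator \<open>13\<^sup>9\<close>.
\<close>

definition pair_weight :: "nat \<Rightarrow> int" where
  "pair_weight x = 16 + 9 * of_bool (x = 0)"

definition card_weight :: "nat \<Rightarrow> int" where
  "card_weight z = 1 + 3 * of_bool (z = 0)"

definition draw_gain :: "nat \<Rightarrow> nat \<Rightarrow> int" where
  "draw_gain f j = (\<Sum>z\<le>9. card_weight z * (sgn (int f - int ((j + z) mod 10)) - sgn (int f - int j)))"

text \<open>
  The probability of the signal \<open>k\<close>, in units of \<open>1/13\<^sup>3\<close>, and the expected change that a draw of Banker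
  holding \<open>j\<close> makes on the hands with that signal, in units of \<open>1/13\<^sup>4\<close>. A natural wins whatever
  Banker does, hence the value 0 for the signal 11.
\<close>

definition signal_weight :: "bool \<Rightarrow> nat \<Rightarrow> int" where
  "signal_weight u k = (\<Sum>x\<le>9. \<Sum>z\<le>9. pair_weight x * card_weight z * of_bool (signal u x z = k))"

definition draw_effect :: "bool \<Rightarrow> nat \<Rightarrow> nat \<Rightarrow> int" where
  "draw_effect u k j = (\<Sum>x\<le>9. \<Sum>z\<le>9. pair_weight x * card_weight z * of_bool (signal u x z = k) *
     (if k = 11 then 0 else draw_gain (player_total u x z) j))"

text \<open>
  The result of a hand when Banker never draws. It does not depend on the other hand: if the coup
  does not end at once, a natural wins, as it would in the comparison of two-card totals.
\<close>

definition standing_outcome :: "bool \<Rightarrow> nat \<Rightarrow> nat \<Rightarrow> nat \<Rightarrow> int" where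
  "standing_outcome u x z y = (if y \<ge> 8 then sgn (int x - int y) else if x \<ge> 8 then 1
     else sgn (int (player_total u x z) - int y))"

definition standing_total :: "bool \<Rightarrow> int" where
  "standing_total u = (\<Sum>x\<le>9. \<Sum>z\<le>9. \<Sum>y\<le>9. pair_weight x * card_weight z * pair_weight y * standing_outcome u x z y)"

fun swing :: "real \<Rightarrow> bool \<times> bool \<Rightarrow> info_set \<Rightarrow> real" where
  "swing \<theta> (u\<^sub>1, u\<^sub>2) (k\<^sub>1, k\<^sub>2, j) = real_of_int (pair_weight j) *
     (\<theta> * real_of_int (draw_effect u\<^sub>1 k\<^sub>1 j * signal_weight u\<^sub>2 k\<^sub>2)
      + (1 - \<theta>) * real_of_int (signal_weight u\<^sub>1 k\<^sub>1 * draw_effect u\<^sub>2 k\<^sub>2 j))"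

fun standing_payoff :: "real \<Rightarrow> bool \<times> bool \<Rightarrow> real" where
  "standing_payoff \<theta> (u\<^sub>1, u\<^sub>2) = 13 ^ 4 * (\<theta> * real_of_int (standing_total u\<^sub>1) + (1 - \<theta>) * real_of_int (standing_total u\<^sub>2))"

lemma two_card_prob_le_9: "x \<le> 9 \<Longrightarrow> two_card_prob x = pair_weight x / 169"
  by (simp add: two_card_prob_def pair_weight_def)

lemma third_card_prob_le_9: "z \<le> 9 \<Longrightarrow> third_card_prob z = card_weight z / 13"
  by (simp add: third_card_prob_def card_weight_def)

lemma sum_pair_weight: "(\<Sum>x\<le>9. pair_weight x) = 169"
  by (simp add: pair_weight_def eval_nat_numeral)

lemma sum_card_weight: "(\<Sum>x\<le>9. card_weight x) = 13"
  by (simp add: card_weight_def eval_nat_numeral)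

abbreviation deal_weight :: "deal \<Rightarrow> real" where
  "deal_weight \<equiv> \<lambda>(x\<^sub>1, x\<^sub>2, y, z\<^sub>1, z\<^sub>2, z). of_int (pair_weight x\<^sub>1 * pair_weight x\<^sub>2 * pair_weight y *
        card_weight z\<^sub>1 * card_weight z\<^sub>2 * card_weight z)"

definition deals :: "deal set" where
  "deals = {..9} \<times> {..9} \<times> {..9} \<times> {..9} \<times> {..9} \<times> {..9}"

lemma expectation_deal:
  "measure_pmf.expectation deal_pmf f = (\<Sum>\<omega>\<in>deals. deal_weight \<omega> * f \<omega>) / 13 ^ 9"
proof -
  have "measure_pmf.expectation deal_pmf f = (\<Sum>\<omega>\<in>deals. pmf deal_pmf \<omega> *\<^sub>R f \<omega>)"
  proof (rule integral_measure_pmf)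
    show "finite deals" by (simp add: deals_def)
    fix \<omega> assume "\<omega> \<in> set_pmf deal_pmf"
    moreover have "x \<le> 9" if "x \<in> set_pmf two_card_total" for x
      using that by (auto simp: set_pmf_eq pmf_two_card_total two_card_prob_def split: if_splits)
    moreover have "z \<le> 9" if "z \<in> set_pmf third_card" for z
      using that by (auto simp: set_pmf_eq pmf_third_card third_card_prob_def split: if_splits)
    ultimately show "\<omega> \<in> deals" by (auto simp: deals_def deal_pmf_def)
  qed
  also have "\<dots> = (\<Sum>\<omega>\<in>deals. deal_weight \<omega> * f \<omega> / 13 ^ 9)"
    by (rule sum.cong)
       (auto simp: deals_def deal_pmf_def pmf_pair pmf_two_card_total pmf_third_card
          two_card_prob_le_9 third_card_prob_le_9)
  finally show ?thesis by (simp add: sum_divide_distrib)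
qed

lemma sum_deals:
  "(\<Sum>\<omega>\<in>deals. f \<omega>) = (\<Sum>x\<^sub>1\<le>9. \<Sum>x\<^sub>2\<le>9. \<Sum>y\<le>9. \<Sum>z\<^sub>1\<le>9. \<Sum>z\<^sub>2\<le>9. \<Sum>z\<le>9. f (x\<^sub>1, x\<^sub>2, y, z\<^sub>1, z\<^sub>2, z))"
  by (simp only: deals_def sum.cartesian_product')

fun swing_gain\<^sub>1 :: "bool \<times> bool \<Rightarrow> info_set \<Rightarrow> deal \<Rightarrow> int" where
  "swing_gain\<^sub>1 (u\<^sub>1, u\<^sub>2) (k\<^sub>1, k\<^sub>2, j) (x\<^sub>1, x\<^sub>2, y, z\<^sub>1, z\<^sub>2, z) =
     (if k\<^sub>1 = 11 then 0 else
       sgn (int (player_total u\<^sub>1 x\<^sub>1 z\<^sub>1) - int ((j + z) mod 10)) - sgn (int (player_total u\<^sub>1 x\<^sub>1 z\<^sub>1) - int j))"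
fun swing_gain\<^sub>2 :: "bool \<times> bool \<Rightarrow> info_set \<Rightarrow> deal \<Rightarrow> int" where
  "swing_gain\<^sub>2 (u\<^sub>1, u\<^sub>2) (k\<^sub>1, k\<^sub>2, j) (x\<^sub>1, x\<^sub>2, y, z\<^sub>1, z\<^sub>2, z) =
     (if k\<^sub>2 = 11 then 0 else
       sgn (int (player_total u\<^sub>2 x\<^sub>2 z\<^sub>2) - int ((j + z) mod 10)) - sgn (int (player_total u\<^sub>2 x\<^sub>2 z\<^sub>2) - int j))"
fun seen :: "bool \<times> bool \<Rightarrow> deal \<Rightarrow> info_set" where
  "seen (u\<^sub>1, u\<^sub>2) (x\<^sub>1, x\<^sub>2, y, z\<^sub>1, z\<^sub>2, z) = (signal u\<^sub>1 x\<^sub>1 z\<^sub>1, signal u\<^sub>2 x\<^sub>2 z\<^sub>2, y)"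

lemma finite_info_sets: "finite info_sets"
  by (rule finite_subset[of _ "{0..11} \<times> {0..11} \<times> {0..7}"]) (auto simp: info_sets_def)

lemma sgn_real_diff: "sgn (real a - real b) = of_int (sgn (int a - int b))"
  by (simp add: sgn_if)

lemma signal_eq_11: "z \<le> 9 \<Longrightarrow> signal u x z = 11 \<longleftrightarrow> x \<ge> 8"
  by (auto simp: signal_def player_draws_def)

lemma sum_selected:
  assumes "finite T"
  shows "(\<Sum>i\<in>T. of_bool (a = i) * g i) = (if a \<in> T then g a else (0::real))"
  using sum.delta'[OF assms, of a g] by (simp add: of_bool_def if_distrib[where f="\<lambda>x. x * _"] cong: if_cong)

text \<open>
  A pure strategy \<open>T\<close> is felt only through the one information set that Banker sees, so the gain is the
  gain against a standing Banker plus a sum over \<open>T\<close> with at most one nonzero term. Coups that end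
  at once need no separate treatment, since then what Banker sees is not in \<open>info_sets\<close>.
\<close>

lemma gains_eq:
  assumes T: "T \<subseteq> info_sets" and \<omega>: "\<omega> \<in> deals"
  shows "gain\<^sub>1 u T \<omega> = (case \<omega> of (x\<^sub>1, x\<^sub>2, y, z\<^sub>1, z\<^sub>2, z) \<Rightarrow> standing_outcome (fst u) x\<^sub>1 z\<^sub>1 y)
            + (\<Sum>i\<in>T. of_bool (seen u \<omega> = i) * real_of_int (swing_gain\<^sub>1 u i \<omega>))" (is ?th1)
    and "gain\<^sub>2 u T \<omega> = (case \<omega> of (x\<^sub>1, x\<^sub>2, y, z\<^sub>1, z\<^sub>2, z) \<Rightarrow> standing_outcome (snd u) x\<^sub>2 z\<^sub>2 y)
            + (\<Sum>i\<in>T. of_bool (seen u \<omega> = i) * real_of_int (swing_gain\<^sub>2 u i \<omega>))" (is ?th2)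
proof -
  obtain u\<^sub>1 u\<^sub>2 where u: "u = (u\<^sub>1, u\<^sub>2)" by force
  obtain x\<^sub>1 x\<^sub>2 y z\<^sub>1 z\<^sub>2 z where w: "\<omega> = (x\<^sub>1, x\<^sub>2, y, z\<^sub>1, z\<^sub>2, z)" by (cases \<omega>) auto
  have z: "z\<^sub>1 \<le> 9" "z\<^sub>2 \<le> 9" using \<omega> by (auto simp: deals_def w)
  have fin: "finite T" using T finite_info_sets finite_subset by blast
  have over: "seen u \<omega> \<notin> T" if "ends_at_once x\<^sub>1 x\<^sub>2 y"
    using that T z by (auto simp: u w ends_at_once_def info_sets_def signal_eq_11)
  note natural = signal_eq_11[OF z(1)] signal_eq_11[OF z(2)]
  show ?th1 ?th2
    unfolding sum_selected[OF fin] using over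
    by (auto simp: u w gain\<^sub>1_def gain\<^sub>2_def standing_outcome_def banker_total_def sgn_real_diff
        ends_at_once_def natural)
qed

text \<open>
  The six cards are independent: one hand and Banker's third card, the other hand, and Banker's
  two-card total contribute separate factors.
\<close>

lemma sum_deal_factors:
  fixes C :: "nat \<Rightarrow> real"
  shows "(\<Sum>x\<^sub>1\<le>9. \<Sum>x\<^sub>2\<le>9. \<Sum>y\<le>9. \<Sum>z\<^sub>1\<le>9. \<Sum>z\<^sub>2\<le>9. \<Sum>z\<le>9. A x\<^sub>1 z\<^sub>1 z * (B x\<^sub>2 z\<^sub>2 * C y))
     = (\<Sum>x\<^sub>1\<le>9. \<Sum>z\<^sub>1\<le>9. \<Sum>z\<le>(9::nat). A x\<^sub>1 z\<^sub>1 z) * ((\<Sum>x\<^sub>2\<le>9. \<Sum>z\<^sub>2\<le>9. B x\<^sub>2 z\<^sub>2) * (\<Sum>y\<le>9. C y))"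
    and "(\<Sum>x\<^sub>1\<le>9. \<Sum>x\<^sub>2\<le>9. \<Sum>y\<le>9. \<Sum>z\<^sub>1\<le>9. \<Sum>z\<^sub>2\<le>9. \<Sum>z\<le>9. A' x\<^sub>1 z\<^sub>1 * (B' x\<^sub>2 z\<^sub>2 z * C y))
     = (\<Sum>x\<^sub>1\<le>9. \<Sum>z\<^sub>1\<le>9. A' x\<^sub>1 z\<^sub>1) * ((\<Sum>x\<^sub>2\<le>9. \<Sum>z\<^sub>2\<le>9. \<Sum>z\<le>(9::nat). B' x\<^sub>2 z\<^sub>2 z) * (\<Sum>y\<le>9. C y))"
  by (simp_all only: sum_distrib_left[symmetric] sum_distrib_right[symmetric])

lemma sum_deals_swing:
  assumes "k\<^sub>1 \<le> 11" "j \<le> 7"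
  shows "(\<Sum>\<omega>\<in>deals. deal_weight \<omega> * (of_bool (seen (u\<^sub>1, u\<^sub>2) \<omega> = (k\<^sub>1, k\<^sub>2, j)) * real_of_int (swing_gain\<^sub>1 (u\<^sub>1, u\<^sub>2) (k\<^sub>1, k\<^sub>2, j) \<omega>)))
      = real_of_int (pair_weight j * draw_effect u\<^sub>1 k\<^sub>1 j * signal_weight u\<^sub>2 k\<^sub>2)" (is ?th1)
   and "(\<Sum>\<omega>\<in>deals. deal_weight \<omega> * (of_bool (seen (u\<^sub>1, u\<^sub>2) \<omega> = (k\<^sub>1, k\<^sub>2, j)) * real_of_int (swing_gain\<^sub>2 (u\<^sub>1, u\<^sub>2) (k\<^sub>1, k\<^sub>2, j) \<omega>)))
      = real_of_int (pair_weight j * signal_weight u\<^sub>1 k\<^sub>1 * draw_effect u\<^sub>2 k\<^sub>2 j)" (is ?th2)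
proof -
  define h where "h = (\<lambda>u k x z. pair_weight x * card_weight z * of_bool (signal u x z = k))"
  define g where "g = (\<lambda>u (k::nat) x z' z. if k = 11 then 0
     else sgn (int (player_total u x z') - int ((j + z) mod 10)) - sgn (int (player_total u x z') - int j))"
  have signal_weight: "real_of_int (signal_weight u k) = (\<Sum>x\<le>9. \<Sum>z\<le>9. real_of_int (h u k x z))" for u k
    by (simp add: signal_weight_def h_def)
  have draw_effect: "real_of_int (draw_effect u k j) = (\<Sum>x\<le>9. \<Sum>z'\<le>9. \<Sum>z\<le>9. real_of_int (h u k x z' * card_weight z * g u k x z' z))" for u k
    by (cases "k = 11") (simp_all add: draw_effect_def h_def g_def draw_gain_def sum_distrib_left mult.assoc)
  have banker: "(\<Sum>y\<le>9. real_of_int (pair_weight y * of_bool (y = j))) = real_of_int (pair_weight j)"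
    using assms sum.delta[of "{..9::nat}" j "\<lambda>y. real_of_int (pair_weight y)"]
    by (simp add: of_bool_def if_distrib[where f="\<lambda>x. _ * x"] if_distrib[where f=real_of_int] cong: if_cong)
  have "(\<Sum>\<omega>\<in>deals. deal_weight \<omega> * (of_bool (seen (u\<^sub>1, u\<^sub>2) \<omega> = (k\<^sub>1, k\<^sub>2, j)) * real_of_int (swing_gain\<^sub>1 (u\<^sub>1, u\<^sub>2) (k\<^sub>1, k\<^sub>2, j) \<omega>)))
    = (\<Sum>x\<^sub>1\<le>9. \<Sum>x\<^sub>2\<le>9. \<Sum>y\<le>9. \<Sum>z\<^sub>1\<le>9. \<Sum>z\<^sub>2\<le>9. \<Sum>z\<le>9.
         real_of_int (h u\<^sub>1 k\<^sub>1 x\<^sub>1 z\<^sub>1 * card_weight z * g u\<^sub>1 k\<^sub>1 x\<^sub>1 z\<^sub>1 z)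
         * (real_of_int (h u\<^sub>2 k\<^sub>2 x\<^sub>2 z\<^sub>2) * real_of_int (pair_weight y * of_bool (y = j))))"
    unfolding sum_deals by (intro sum.cong refl) (simp add: h_def g_def of_bool_def)
  then show ?th1 unfolding sum_deal_factors banker signal_weight[symmetric] draw_effect[symmetric] by (simp only: of_int_mult mult_ac)
  have "(\<Sum>\<omega>\<in>deals. deal_weight \<omega> * (of_bool (seen (u\<^sub>1, u\<^sub>2) \<omega> = (k\<^sub>1, k\<^sub>2, j)) * real_of_int (swing_gain\<^sub>2 (u\<^sub>1, u\<^sub>2) (k\<^sub>1, k\<^sub>2, j) \<omega>)))
    = (\<Sum>x\<^sub>1\<le>9. \<Sum>x\<^sub>2\<le>9. \<Sum>y\<le>9. \<Sum>z\<^sub>1\<le>9. \<Sum>z\<^sub>2\<le>9. \<Sum>z\<le>9.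
         real_of_int (h u\<^sub>1 k\<^sub>1 x\<^sub>1 z\<^sub>1)
         * (real_of_int (h u\<^sub>2 k\<^sub>2 x\<^sub>2 z\<^sub>2 * card_weight z * g u\<^sub>2 k\<^sub>2 x\<^sub>2 z\<^sub>2 z) * real_of_int (pair_weight y * of_bool (y = j))))"
    unfolding sum_deals by (intro sum.cong refl) (simp add: h_def g_def of_bool_def)
  then show ?th2 unfolding sum_deal_factors banker signal_weight[symmetric] draw_effect[symmetric] by (simp only: of_int_mult mult_ac)
qed

lemma sum_deals_standing:
  shows "(\<Sum>\<omega>\<in>deals. deal_weight \<omega> * (case \<omega> of (x\<^sub>1, x\<^sub>2, y, z\<^sub>1, z\<^sub>2, z) \<Rightarrow> real_of_int (standing_outcome u x\<^sub>1 z\<^sub>1 y)))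
      = 13 ^ 4 * real_of_int (standing_total u)" (is ?th1)
   and "(\<Sum>\<omega>\<in>deals. deal_weight \<omega> * (case \<omega> of (x\<^sub>1, x\<^sub>2, y, z\<^sub>1, z\<^sub>2, z) \<Rightarrow> real_of_int (standing_outcome u x\<^sub>2 z\<^sub>2 y)))
      = 13 ^ 4 * real_of_int (standing_total u)" (is ?th2)
proof -
  define h where "h = (\<lambda>x z y. real_of_int (pair_weight x * card_weight z * pair_weight y * standing_outcome u x z y))"
  define other where "other = (\<lambda>x z. real_of_int (pair_weight x * card_weight z))"
  have own: "(\<Sum>x\<le>9. \<Sum>y\<le>9. \<Sum>z\<le>9. h x z y) = real_of_int (standing_total u)"
    unfolding standing_total_def h_def of_int_sum by (intro sum.cong refl sum.swap)
  have total_weight: "(\<Sum>x\<le>9. \<Sum>z\<le>9. other x z) = 13 ^ 3"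
    by (simp add: other_def sum_pair_weight sum_card_weight flip: sum_distrib_left sum_distrib_right of_int_sum)
  have card: "(\<Sum>z\<le>9. real_of_int (card_weight z)) = 13"
    by (simp add: sum_card_weight flip: of_int_sum)
  have "(\<Sum>\<omega>\<in>deals. deal_weight \<omega> * (case \<omega> of (x\<^sub>1, x\<^sub>2, y, z\<^sub>1, z\<^sub>2, z) \<Rightarrow> real_of_int (standing_outcome u x\<^sub>1 z\<^sub>1 y)))
    = (\<Sum>x\<^sub>1\<le>9. \<Sum>x\<^sub>2\<le>9. \<Sum>y\<le>9. \<Sum>z\<^sub>1\<le>9. \<Sum>z\<^sub>2\<le>9. \<Sum>z\<le>9.
        h x\<^sub>1 z\<^sub>1 y * (other x\<^sub>2 z\<^sub>2 * real_of_int (card_weight z)))"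
    unfolding sum_deals by (intro sum.cong refl) (simp add: h_def other_def)
  also have "\<dots> = (\<Sum>x\<le>9. \<Sum>y\<le>9. \<Sum>z\<le>9. h x z y) * ((\<Sum>x\<le>9. \<Sum>z\<le>9. other x z) * (\<Sum>z\<le>9. real_of_int (card_weight z)))"
    by (simp only: sum_distrib_left[symmetric] sum_distrib_right[symmetric])
  finally show ?th1 unfolding own total_weight card by simp
  have "(\<Sum>\<omega>\<in>deals. deal_weight \<omega> * (case \<omega> of (x\<^sub>1, x\<^sub>2, y, z\<^sub>1, z\<^sub>2, z) \<Rightarrow> real_of_int (standing_outcome u x\<^sub>2 z\<^sub>2 y)))
    = (\<Sum>x\<^sub>1\<le>9. \<Sum>x\<^sub>2\<le>9. \<Sum>y\<le>9. \<Sum>z\<^sub>1\<le>9. \<Sum>z\<^sub>2\<le>9. \<Sum>z\<le>9.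
        other x\<^sub>1 z\<^sub>1 * (h x\<^sub>2 z\<^sub>2 y * real_of_int (card_weight z)))"
    unfolding sum_deals by (intro sum.cong refl) (simp add: h_def other_def)
  also have "\<dots> = (\<Sum>x\<le>9. \<Sum>z\<le>9. other x z) * ((\<Sum>x\<le>9. \<Sum>y\<le>9. \<Sum>z\<le>9. h x z y) * (\<Sum>z\<le>9. real_of_int (card_weight z)))"
    by (simp only: sum_distrib_left[symmetric] sum_distrib_right[symmetric])
  finally show ?th2 unfolding own total_weight card by simp
qed

lemma payoff_eq:
  assumes T: "T \<subseteq> info_sets"
  shows "payoff \<theta> u T = (standing_payoff \<theta> u + (\<Sum>i\<in>T. swing \<theta> u i)) / 13 ^ 9"
proof -
  obtain u\<^sub>1 u\<^sub>2 where u: "u = (u\<^sub>1, u\<^sub>2)" by force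
  define A where "A = (\<lambda>\<omega>::deal. case \<omega> of (x\<^sub>1, x\<^sub>2, y, z\<^sub>1, z\<^sub>2, z) \<Rightarrow> real_of_int (standing_outcome u\<^sub>1 x\<^sub>1 z\<^sub>1 y))"
  define B where "B = (\<lambda>\<omega>::deal. case \<omega> of (x\<^sub>1, x\<^sub>2, y, z\<^sub>1, z\<^sub>2, z) \<Rightarrow> real_of_int (standing_outcome u\<^sub>2 x\<^sub>2 z\<^sub>2 y))"
  define C where "C = (\<lambda>i \<omega>. of_bool (seen u \<omega> = i) * real_of_int (swing_gain\<^sub>1 u i \<omega>))"
  define D where "D = (\<lambda>i \<omega>. of_bool (seen u \<omega> = i) * real_of_int (swing_gain\<^sub>2 u i \<omega>))"
  have g: "\<theta> * gain\<^sub>1 u T \<omega> + (1 - \<theta>) * gain\<^sub>2 u T \<omega>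
      = \<theta> * A \<omega> + (1 - \<theta>) * B \<omega> + (\<Sum>i\<in>T. \<theta> * C i \<omega> + (1 - \<theta>) * D i \<omega>)" if "\<omega> \<in> deals" for \<omega>
    unfolding gains_eq[OF T that] A_def B_def C_def D_def u
    by (cases \<omega>) (simp add: sum.distrib distrib_left sum_distrib_left)
  define wt where "wt = deal_weight"
  have "13 ^ 9 * payoff \<theta> u T = (\<Sum>\<omega>\<in>deals. wt \<omega> *
      (\<theta> * A \<omega> + (1 - \<theta>) * B \<omega> + (\<Sum>i\<in>T. \<theta> * C i \<omega> + (1 - \<theta>) * D i \<omega>)))"
    unfolding payoff_def expectation_deal wt_def using g by simp
  also have "\<dots> = (\<Sum>\<omega>\<in>deals. \<theta> * (wt \<omega> * A \<omega>) + (1 - \<theta>) * (wt \<omega> * B \<omega>)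
      + (\<Sum>i\<in>T. \<theta> * (wt \<omega> * C i \<omega>) + (1 - \<theta>) * (wt \<omega> * D i \<omega>)))"
    by (intro sum.cong refl) (simp add: distrib_left sum_distrib_left mult_ac)
  also have "\<dots> = \<theta> * (\<Sum>\<omega>\<in>deals. wt \<omega> * A \<omega>) + (1 - \<theta>) * (\<Sum>\<omega>\<in>deals. wt \<omega> * B \<omega>)
     + (\<Sum>\<omega>\<in>deals. \<Sum>i\<in>T. \<theta> * (wt \<omega> * C i \<omega>) + (1 - \<theta>) * (wt \<omega> * D i \<omega>))"
    by (simp add: sum.distrib sum_distrib_left)
  also have "(\<Sum>\<omega>\<in>deals. \<Sum>i\<in>T. \<theta> * (wt \<omega> * C i \<omega>) + (1 - \<theta>) * (wt \<omega> * D i \<omega>))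
     = (\<Sum>i\<in>T. \<Sum>\<omega>\<in>deals. \<theta> * (wt \<omega> * C i \<omega>) + (1 - \<theta>) * (wt \<omega> * D i \<omega>))"
    by (rule sum.swap)
  also have "\<dots> = (\<Sum>i\<in>T. \<theta> * (\<Sum>\<omega>\<in>deals. wt \<omega> * C i \<omega>) + (1 - \<theta>) * (\<Sum>\<omega>\<in>deals. wt \<omega> * D i \<omega>))"
    by (simp add: sum.distrib sum_distrib_left)
  also have "\<dots> = (\<Sum>i\<in>T. swing \<theta> u i)"
  proof (rule sum.cong[OF refl])
    fix i assume "i \<in> T"
    obtain k\<^sub>1 k\<^sub>2 j where i: "i = (k\<^sub>1, k\<^sub>2, j)" by (cases i) auto
    with \<open>i \<in> T\<close> T have k: "k\<^sub>1 \<le> 11" "j \<le> 7" by (auto simp: info_sets_def)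
    show "\<theta> * (\<Sum>\<omega>\<in>deals. wt \<omega> * C i \<omega>) + (1 - \<theta>) * (\<Sum>\<omega>\<in>deals. wt \<omega> * D i \<omega>) = swing \<theta> u i"
      unfolding wt_def C_def D_def i u sum_deals_swing[OF k] by (simp add: algebra_simps)
  qed
  finally have "13 ^ 9 * payoff \<theta> u T = standing_payoff \<theta> u + (\<Sum>i\<in>T. swing \<theta> u i)"
    unfolding A_def B_def wt_def sum_deals_standing by (simp add: u algebra_simps)
  then show ?thesis by (simp add: field_simps)
qed

section \<open>Piecewise linear games\<close>

text \<open>
  A \<open>quad\<close> holds one integer for each of the pairs 00, 01, 10, 11; it serves as a linear function of
  mixtures (\<open>weigh\<close>) and as an unnormalized mixture (\<open>mix\<close>). A \<open>form\<close> is bilinear in a pair \<open>(s, t)\<close>, which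
  will be proportional to \<open>(\<theta>, 1 - \<theta>)\<close>, and a mixture. A \<open>game\<close> is a form with a list of kinks.
\<close>

type_synonym quad = "int \<times> int \<times> int \<times> int"
type_synonym form = "quad \<times> quad"
type_synonym game = "form \<times> form list"

fun weigh :: "quad \<Rightarrow> (bool \<times> bool \<Rightarrow> real) \<Rightarrow> real" where
  "weigh (a, b, c, d) p = of_int a * p (False, False) + of_int b * p (False, True)
     + of_int c * p (True, False) + of_int d * p (True, True)"

fun form_value :: "form \<Rightarrow> real \<Rightarrow> real \<Rightarrow> (bool \<times> bool \<Rightarrow> real) \<Rightarrow> real" where
  "form_value (c, c') s t p = s * weigh c p + t * weigh c' p"

fun worth :: "game \<Rightarrow> real \<Rightarrow> real \<Rightarrow> (bool \<times> bool \<Rightarrow> real) \<Rightarrow> real" where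
  "worth (l, hs) s t p = form_value l s t p + (\<Sum>h\<leftarrow>hs. min 0 (form_value h s t p))"

text \<open>Each weight is the probability with which Banker draws at one of the undecided information sets.\<close>

fun responses :: "game \<Rightarrow> real \<Rightarrow> real \<Rightarrow> ((bool \<times> bool \<Rightarrow> real) \<Rightarrow> real) set" where
  "responses (l, hs) s t = {f. \<exists>ws. length ws = length hs \<and> set ws \<subseteq> {0..1} \<and>
     f = (\<lambda>p. form_value l s t p + (\<Sum>(w, h)\<leftarrow>zip ws hs. w * form_value h s t p))}"

fun mix :: "quad \<Rightarrow> bool \<times> bool \<Rightarrow> real" where
  "mix (a, b, c, d) (u, v) = of_int (if u then if v then d else c else if v then b else a)"

fun dot :: "quad \<Rightarrow> quad \<Rightarrow> int" where
  "dot (a, b, c, d) (a', b', c', d') = a * a' + b * b' + c * c' + d * d'"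

fun add_quad :: "quad \<Rightarrow> quad \<Rightarrow> quad" where
  "add_quad (a, b, c, d) (a', b', c', d') = (a + a', b + b', c + c', d + d')"

fun scale_quad :: "int \<Rightarrow> quad \<Rightarrow> quad" where
  "scale_quad n (a, b, c, d) = (n * a, n * b, n * c, n * d)"

fun add_form :: "form \<Rightarrow> form \<Rightarrow> form" where
  "add_form (c, c') (d, d') = (add_quad c d, add_quad c' d')"

fun scale_form :: "int \<Rightarrow> form \<Rightarrow> form" where
  "scale_form n (c, c') = (scale_quad n c, scale_quad n c')"

fun slice :: "int \<times> int \<Rightarrow> form \<Rightarrow> quad" where
  "slice (s, t) (c, c') = add_quad (scale_quad s c) (scale_quad t c')"

lemma weigh_mix: "weigh c (mix q) = of_int (dot c q)"
  by (cases c; cases q) simp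

lemma weigh_linear:
  "weigh c (\<lambda>u. x * p u + y * q u) = x * weigh c p + y * weigh c q"
  "weigh c (\<lambda>u. x * p u) = x * weigh c p"
  "weigh (add_quad c d) p = weigh c p + weigh d p"
  "weigh (scale_quad n c) p = of_int n * weigh c p"
  by (cases c; cases d; simp add: algebra_simps)+

lemma form_value_linear:
  "form_value h s t (\<lambda>u. x * p u + y * q u) = x * form_value h s t p + y * form_value h s t q"
  "form_value h s t (\<lambda>u. x * p u) = x * form_value h s t p"
  "form_value (add_form h k) s t p = form_value h s t p + form_value k s t p"
  "form_value (scale_form n h) s t p = of_int n * form_value h s t p"
  by (cases h; cases k; simp add: weigh_linear algebra_simps)+

lemma weigh_slice: "weigh (slice (s, t) h) p = form_value h (of_int s) (of_int t) p"
  by (rule prod.exhaust[of h]) (simp add: weigh_linear del: weigh.simps)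

lemma worth_le_response:
  assumes "f \<in> responses G s t"
  shows "worth G s t p \<le> f p"
proof -
  obtain l hs where G: "G = (l, hs)" by (rule prod.exhaust)
  obtain ws where ws: "length ws = length hs" "set ws \<subseteq> {0..1}"
    and f: "f = (\<lambda>p. form_value l s t p + (\<Sum>(w, h)\<leftarrow>zip ws hs. w * form_value h s t p))"
    using assms by (auto simp: G)
  have "(\<Sum>h\<leftarrow>hs. min 0 (form_value h s t p)) \<le> (\<Sum>(w, h)\<leftarrow>zip ws hs. w * form_value h s t p)"
    using ws
  proof (induction ws hs rule: list_induct2)
    case (Cons w ws h hs)
    have "min 0 (form_value h s t p) \<le> w * form_value h s t p"
      using Cons.prems mult_right_mono_neg[of w 1 "form_value h s t p"]
      by (cases "form_value h s t p \<ge> 0") (auto simp: min_def mult_nonneg_nonneg)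
    with Cons show ?case by simp
  qed simp
  then show ?thesis by (simp add: G f)
qed

section \<open>Settling kinks of known sign\<close>

text \<open>
  A bilinear function that has one sign at the ends of a range of \<open>(s, t)\<close> and at the generators of a
  cone of mixtures has that sign throughout. Settling a game absorbs kinks that are always
  negative into the linear part and drops those that are always positive. A kink that vanishes at all
  samples is kept, because such kinks are the ones that determine an optimum.
\<close>

fun verdict :: "int list \<Rightarrow> int" where
  "verdict vs = (if list_all (\<lambda>v. v \<le> 0) vs then if list_all (\<lambda>v. v = 0) vs then 0 else - 1
     else if list_all (\<lambda>v. v \<ge> 0) vs then 1 else 0)"

type_synonym point = "int \<times> int"

definition samples :: "point \<Rightarrow> point \<Rightarrow> quad list \<Rightarrow> form \<Rightarrow> int list" where
  "samples a b P h = map (dot (slice a h)) P @ map (dot (slice b h)) P"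

fun place :: "int \<Rightarrow> form \<Rightarrow> game \<Rightarrow> game" where
  "place n h (l, hs) = (if n < 0 then (add_form h l, hs) else if n > 0 then (l, hs) else (l, h # hs))"

fun settle_list :: "point \<Rightarrow> point \<Rightarrow> quad list \<Rightarrow> form \<Rightarrow> form list \<Rightarrow> game" where
  "settle_list a b P l [] = (l, [])"
| "settle_list a b P l (h # hs) = place (verdict (samples a b P h)) h (settle_list a b P l hs)"

fun settle :: "point \<Rightarrow> point \<Rightarrow> quad list \<Rightarrow> game \<Rightarrow> game" where
  "settle a b P (l, hs) = settle_list a b P l hs"

text \<open>
  Fixing Banker's decision at the settled kinks is a restriction of his strategies. This holds without any
  hypothesis on the signs, so upper bounds obtained after settling are valid for all mixtures, not
  only for those in the cone.
\<close>

lemma responses_settle: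
  assumes "f \<in> responses (settle a b P G) s t"
  shows "f \<in> responses G s t"
proof -
  obtain l hs where G: "G = (l, hs)" by (rule prod.exhaust)
  have "f \<in> responses (settle_list a b P l hs) s t \<Longrightarrow> f \<in> responses (l, hs) s t"
  proof (induction hs arbitrary: f)
    case (Cons h hs)
    obtain l' hs' where r: "settle_list a b P l hs = (l', hs')" by (rule prod.exhaust)
    have extend: "(\<lambda>p. w * form_value h s t p + g p) \<in> responses (l, h # hs) s t"
      if g: "g \<in> responses (l', hs') s t" and w: "w \<in> {0..1}" for g w
    proof -
      obtain ws where "length ws = length hs" "set ws \<subseteq> {0..1}"
        "g = (\<lambda>p. form_value l s t p + (\<Sum>(w, h)\<leftarrow>zip ws hs. w * form_value h s t p))"
        using Cons.IH[of g] g r by auto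
      with w show ?thesis by (auto intro!: exI[of _ "w # ws"])
    qed
    define n where "n = verdict (samples a b P h)"
    have f: "f \<in> responses (place n h (l', hs')) s t"
      using Cons.prems by (simp add: r n_def)
    consider "n < 0" | "n > 0" | "n = 0" by linarith
    then show ?case
    proof cases
      case 1
      with f obtain ws where ws: "length ws = length hs'" "set ws \<subseteq> {0..1}"
        "f = (\<lambda>p. 1 * form_value h s t p + (form_value l' s t p + (\<Sum>(w, h)\<leftarrow>zip ws hs'. w * form_value h s t p)))"
        by (auto simp: form_value_linear add.assoc simp del: form_value.simps)
      then show ?thesis using extend[of _ 1] by auto
    next
      case 2
      with f extend[of f 0] show ?thesis by simp
    next
      case 3
      with f obtain w ws where ws: "length ws = length hs'" "set ws \<subseteq> {0..1}" "w \<in> {0..1}"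
        "f = (\<lambda>p. form_value l' s t p + (\<Sum>(w, h)\<leftarrow>zip (w # ws) (h # hs'). w * form_value h s t p))"
        by (auto simp: length_Suc_conv simp del: form_value.simps)
      define g where "g = (\<lambda>p. form_value l' s t p + (\<Sum>(w, h)\<leftarrow>zip ws hs'. w * form_value h s t p))"
      have "g \<in> responses (l', hs') s t" using ws by (auto simp: g_def simp del: form_value.simps)
      moreover have "f = (\<lambda>p. w * form_value h s t p + g p)"
        using ws by (auto simp: g_def simp del: form_value.simps)
      ultimately show ?thesis using extend[OF _ ws(3)] by simp
    qed
  qed simp
  with assms show ?thesis by (simp add: G)
qed

inductive_set conic_span :: "quad list \<Rightarrow> (bool \<times> bool \<Rightarrow> real) set" for P where
  cone_zero: "(\<lambda>_. 0) \<in> conic_span P"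
| cone_add: "q \<in> set P \<Longrightarrow> p \<in> conic_span P \<Longrightarrow> 0 \<le> x \<Longrightarrow> (\<lambda>u. x * mix q u + 1 * p u) \<in> conic_span P"

lemma weigh_cone:
  assumes "p \<in> conic_span P"
  shows "(\<And>q. q \<in> set P \<Longrightarrow> dot c q \<le> 0) \<Longrightarrow> weigh c p \<le> 0"
    and "(\<And>q. q \<in> set P \<Longrightarrow> dot c q \<ge> 0) \<Longrightarrow> weigh c p \<ge> 0"
proof -
  show "weigh c p \<le> 0" if "\<And>q. q \<in> set P \<Longrightarrow> dot c q \<le> 0"
    using assms
  proof induction
    case cone_zero show ?case by (cases c) simp
  next
    case (cone_add q p x)
    then have "x * of_int (dot c q) \<le> 0" using that[of q] by (simp add: mult_nonneg_nonpos)
    with cone_add show ?case unfolding weigh_linear weigh_mix by simp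
  qed
  show "weigh c p \<ge> 0" if "\<And>q. q \<in> set P \<Longrightarrow> dot c q \<ge> 0"
    using assms
  proof induction
    case cone_zero show ?case by (cases c) simp
  next
    case (cone_add q p x)
    then have "x * of_int (dot c q) \<ge> 0" using that[of q] by simp
    with cone_add show ?case unfolding weigh_linear weigh_mix by simp
  qed
qed

lemma form_value_combine:
  "form_value h (\<alpha> * of_int s + \<beta> * of_int s') (\<alpha> * of_int t + \<beta> * of_int t') p
     = \<alpha> * weigh (slice (s, t) h) p + \<beta> * weigh (slice (s', t') h) p"
  by (rule prod.exhaust[of h]) (simp add: weigh_linear algebra_simps del: weigh.simps)

lemma worth_settle:
  assumes p: "p \<in> conic_span P" and nonneg: "0 \<le> \<alpha>" "0 \<le> \<beta>"
    and st: "s = \<alpha> * of_int (fst a) + \<beta> * of_int (fst b)" "t = \<alpha> * of_int (snd a) + \<beta> * of_int (snd b)"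
  shows "worth (settle a b P G) s t p = worth G s t p"
proof -
  obtain l hs where G: "G = (l, hs)" by (rule prod.exhaust)
  have sgn: "(verdict (samples a b P h) < 0 \<longrightarrow> form_value h s t p \<le> 0) \<and> (verdict (samples a b P h) > 0 \<longrightarrow> form_value h s t p \<ge> 0)" for h
  proof (intro conjI impI)
    assume "verdict (samples a b P h) < 0"
    then have "weigh (slice a h) p \<le> 0" "weigh (slice b h) p \<le> 0"
      by (auto simp: samples_def list_all_iff intro!: weigh_cone[OF p] split: if_splits)
    then show "form_value h s t p \<le> 0"
      unfolding st form_value_combine using nonneg by (simp add: mult_nonneg_nonpos add_nonpos_nonpos)
  next
    assume "verdict (samples a b P h) > 0"
    then have "weigh (slice a h) p \<ge> 0" "weigh (slice b h) p \<ge> 0"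
      by (auto simp: samples_def list_all_iff intro!: weigh_cone[OF p] split: if_splits)
    then show "form_value h s t p \<ge> 0"
      unfolding st form_value_combine using nonneg by simp
  qed
  have "worth (settle_list a b P l hs) s t p = worth (l, hs) s t p"
  proof (induction hs)
    case (Cons h hs)
    obtain l' hs' where r: "settle_list a b P l hs = (l', hs')" by (rule prod.exhaust)
    have step: "worth (place n h (l', hs')) s t p = min 0 (form_value h s t p) + worth (l', hs') s t p"
      if "n < 0 \<longrightarrow> form_value h s t p \<le> 0" "n > 0 \<longrightarrow> form_value h s t p \<ge> 0" for n
      using that by (auto simp: form_value_linear simp del: form_value.simps)
    show ?case unfolding settle_list.simps r using step[OF conjunct1[OF sgn] conjunct2[OF sgn]] Cons r
      by (simp del: form_value.simps verdict.simps)
  qed simp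
  then show ?thesis by (simp add: G)
qed

definition pure_pairs :: "quad list" where
  "pure_pairs = [(1, 0, 0, 0), (0, 1, 0, 0), (0, 0, 1, 0), (0, 0, 0, 1)]"

lemma nonneg_in_conic_span:
  assumes "\<And>u. p u \<ge> 0"
  shows "p \<in> conic_span pure_pairs"
proof -
  have "(\<lambda>u. p (False, False) * mix (1, 0, 0, 0) u + 1 * (p (False, True) * mix (0, 1, 0, 0) u
      + 1 * (p (True, False) * mix (0, 0, 1, 0) u + 1 * (p (True, True) * mix (0, 0, 0, 1) u + 1 * 0)))) \<in> conic_span pure_pairs"
    by (intro cone_add cone_zero assms) (auto simp: pure_pairs_def)
  also have "(\<lambda>u. p (False, False) * mix (1, 0, 0, 0) u + 1 * (p (False, True) * mix (0, 1, 0, 0) u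
      + 1 * (p (True, False) * mix (0, 0, 1, 0) u + 1 * (p (True, True) * mix (0, 0, 0, 1) u + 1 * 0)))) = p"
  proof
    fix u :: "bool \<times> bool" show "p (False, False) * mix (1, 0, 0, 0) u + 1 * (p (False, True) * mix (0, 1, 0, 0) u
      + 1 * (p (True, False) * mix (0, 0, 1, 0) u + 1 * (p (True, True) * mix (0, 0, 0, 1) u + 1 * 0))) = p u"
      by (cases u) auto
  qed
  finally show ?thesis .
qed

section \<open>Separating a moving mixture from the product mixtures\<close>

text \<open>Change of coordinates that puts the ends \<open>a\<close> and \<open>b\<close> of a range of \<open>(s, t)\<close> at \<open>(1, 0)\<close> and \<open>(0, 1)\<close>.\<close>

fun rebase_form :: "point \<Rightarrow> point \<Rightarrow> form \<Rightarrow> form" where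
  "rebase_form a b h = (slice a h, slice b h)"

fun rebase :: "point \<Rightarrow> point \<Rightarrow> game \<Rightarrow> game" where
  "rebase a b (l, hs) = (rebase_form a b l, map (rebase_form a b) hs)"

lemma form_value_rebase:
  "form_value (rebase_form a b h) \<alpha> \<beta> p
    = form_value h (\<alpha> * of_int (fst a) + \<beta> * of_int (fst b)) (\<alpha> * of_int (snd a) + \<beta> * of_int (snd b)) p"
  by (cases a; cases b) (simp add: form_value_combine del: slice.simps weigh.simps form_value.simps add: form_value.simps[of "slice _ h"])

lemma worth_rebase:
  "worth (rebase a b G) \<alpha> \<beta> p
    = worth G (\<alpha> * of_int (fst a) + \<beta> * of_int (fst b)) (\<alpha> * of_int (snd a) + \<beta> * of_int (snd b)) p"
  by (cases G) (simp add: form_value_rebase o_def del: rebase_form.simps form_value.simps)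

type_synonym triple = "int \<times> int \<times> int"

text \<open>
  Along the segment from \<open>p\<close> to \<open>q\<close>, run through in step with the range of \<open>\<theta>\<close>, a form is a quadratic
  polynomial with these Bernstein coefficients (the middle one doubled). Since \<open>min 0\<close> is concave, taking
  minima coefficientwise gives a lower bound for the guaranteed payoff along the segment. Where the
  optimum moves smoothly, following it by a segment costs only a second-order error, so few ranges are enough.
\<close>

fun bernstein :: "quad \<Rightarrow> quad \<Rightarrow> form \<Rightarrow> triple" where
  "bernstein p q (c, c') = (dot c p, dot c q + dot c' p, dot c' q)"

fun add_triple :: "triple \<Rightarrow> triple \<Rightarrow> triple" where
  "add_triple (x, y, z) (x', y', z') = (x + x', y + y', z + z')"

fun min_triple :: "triple \<Rightarrow> triple" where
  "min_triple (x, y, z) = (min 0 x, min 0 y, min 0 z)"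

fun curve_bound_list :: "quad \<Rightarrow> quad \<Rightarrow> form \<Rightarrow> form list \<Rightarrow> triple" where
  "curve_bound_list p q l [] = bernstein p q l"
| "curve_bound_list p q l (h # hs) = add_triple (min_triple (bernstein p q h)) (curve_bound_list p q l hs)"

fun curve_bound :: "quad \<Rightarrow> quad \<Rightarrow> game \<Rightarrow> triple" where
  "curve_bound p q (l, hs) = curve_bound_list p q l hs"

fun quadratic :: "triple \<Rightarrow> real \<Rightarrow> real \<Rightarrow> real" where
  "quadratic (x, y, z) \<alpha> \<beta> = of_int x * \<alpha>\<^sup>2 + of_int y * (\<alpha> * \<beta>) + of_int z * \<beta>\<^sup>2"

lemma quadratic_add: "quadratic (add_triple x y) \<alpha> \<beta> = quadratic x \<alpha> \<beta> + quadratic y \<alpha> \<beta>"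
  by (cases x; cases y) (simp add: algebra_simps)

lemma quadratic_min:
  assumes "0 \<le> \<alpha>" "0 \<le> \<beta>"
  shows "quadratic (min_triple x) \<alpha> \<beta> \<le> min 0 (quadratic x \<alpha> \<beta>)"
proof -
  obtain x1 x2 x3 where x: "x = (x1, x2, x3)" by (cases x) auto
  have "of_int (min 0 n) * r \<le> of_int n * r" "of_int (min 0 n) * r \<le> 0" if "r \<ge> 0" for n :: int and r :: real
    using that by (auto intro!: mult_right_mono mult_nonpos_nonneg)
  note this[OF zero_le_power2[of \<alpha>]] this[OF mult_nonneg_nonneg[OF assms]] this[OF zero_le_power2[of \<beta>]]
  then show ?thesis by (simp only: x quadratic.simps min_triple.simps min.bounded_iff) (intro conjI add_mono add_nonpos_nonpos)
qed

lemma form_value_curve: "form_value h \<alpha> \<beta> (\<lambda>u. \<alpha> * mix p u + \<beta> * mix q u) = quadratic (bernstein p q h) \<alpha> \<beta>"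
proof -
  obtain c c' where h: "h = (c, c')" by (rule prod.exhaust)
  show ?thesis unfolding h form_value.simps weigh_linear weigh_mix
    by (simp add: algebra_simps power2_eq_square)
qed

lemma curve_bound:
  assumes "0 \<le> \<alpha>" "0 \<le> \<beta>"
  shows "quadratic (curve_bound p q G) \<alpha> \<beta> \<le> worth G \<alpha> \<beta> (\<lambda>u. \<alpha> * mix p u + \<beta> * mix q u)"
proof -
  obtain l hs where G: "G = (l, hs)" by (rule prod.exhaust)
  have "quadratic (curve_bound_list p q l hs) \<alpha> \<beta> \<le> worth (l, hs) \<alpha> \<beta> (\<lambda>u. \<alpha> * mix p u + \<beta> * mix q u)"
  proof (induction hs)
    case Nil then show ?case by (simp add: form_value_curve del: form_value.simps bernstein.simps)
  next
    case (Cons h hs)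
    then show ?case using quadratic_min[OF assms, of "bernstein p q h"]
      by (simp add: form_value_curve quadratic_add del: form_value.simps bernstein.simps min.bounded_iff)
  qed
  then show ?thesis by (simp add: G)
qed

fun product_at :: "real \<Rightarrow> real \<Rightarrow> bool \<times> bool \<Rightarrow> real" where
  "product_at x y (u, v) = (if u then x else 1 - x) * (if v then y else 1 - y)"

lemma form_value_product_affine:
  "form_value h s t (product_at x y) = (1 - x) * form_value h s t (product_at 0 y) + x * form_value h s t (product_at 1 y)"
  "form_value h s t (product_at x y) = (1 - y) * form_value h s t (product_at x 0) + y * form_value h s t (product_at x 1)"
proof -
  obtain a b c d a' b' c' d' where h: "h = ((a, b, c, d), (a', b', c', d'))" by (cases h) auto
  show "form_value h s t (product_at x y) = (1 - x) * form_value h s t (product_at 0 y) + x * form_value h s t (product_at 1 y)"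
    "form_value h s t (product_at x y) = (1 - y) * form_value h s t (product_at x 0) + y * form_value h s t (product_at x 1)"
    by (simp_all add: h algebra_simps)
qed

text \<open>On the product mixtures a form is bilinear in \<open>(p\<^sub>1, p\<^sub>2)\<close>, so a bound on a rectangle is a bound at its corners.\<close>

lemma affine_less_between:
  fixes x x0 x1 :: real
  assumes "\<And>x. f x = (1 - x) * c + x * d" "x0 \<le> x" "x \<le> x1" "f x0 < B" "f x1 < B"
  shows "f x < B"
proof (cases "d \<ge> c")
  case True
  then have "(x1 - x) * (d - c) \<ge> 0" using assms by simp
  with assms(1)[of x] assms(1)[of x1] assms(5) show ?thesis by (simp add: algebra_simps)
next
  case False
  then have "(x - x0) * (c - d) \<ge> 0" using assms by simp
  with assms(1)[of x] assms(1)[of x0] assms(4) show ?thesis by (simp add: algebra_simps)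
qed

lemma bilinear_less_on_rectangle:
  assumes "x0 \<le> x" "x \<le> x1" "y0 \<le> y" "y \<le> y1"
    and "form_value h s t (product_at x0 y0) < B" "form_value h s t (product_at x0 y1) < B"
      "form_value h s t (product_at x1 y0) < B" "form_value h s t (product_at x1 y1) < B"
  shows "form_value h s t (product_at x y) < B"
proof (rule affine_less_between[where f="\<lambda>x. form_value h s t (product_at x y)"])
  show "form_value h s t (product_at x0 y) < B"
    by (rule affine_less_between[where f="\<lambda>y. form_value h s t (product_at x0 y)"]) (use assms form_value_product_affine(2) in blast)+
  show "form_value h s t (product_at x1 y) < B"
    by (rule affine_less_between[where f="\<lambda>y. form_value h s t (product_at x1 y)"]) (use assms form_value_product_affine(2) in blast)+
qed (use assms form_value_product_affine(1) in blast)+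

text \<open>A response with rational weights \<open>w/W\<close>, multiplied by \<open>W\<close>.\<close>

fun respond_list :: "int list \<Rightarrow> form list \<Rightarrow> form \<Rightarrow> form" where
  "respond_list (w # ws) (h # hs) l =
     (if w = 0 then respond_list ws hs l else add_form (scale_form w h) (respond_list ws hs l))"
| "respond_list _ _ l = l"

lemma respond_list:
  assumes "length ws = length hs" "set ws \<subseteq> {0..W}" "W > 0"
  shows "(\<lambda>p. form_value (respond_list ws hs (scale_form W l)) s t p / of_int W) \<in> responses (l, hs) s t"
proof -
  have "form_value (respond_list ws hs (scale_form W l)) s t p
      = of_int W * (form_value l s t p + (\<Sum>(w, h)\<leftarrow>zip (map (\<lambda>w. of_int w / of_int W) ws) hs. w * form_value h s t p))" for p
    using assms(1) \<open>W > 0\<close>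
    by (induction ws hs rule: list_induct2) (simp_all add: form_value_linear field_simps del: form_value.simps)
  moreover have "of_int w / of_int W \<in> {0..1::real}" if "w \<in> set ws" for w
    using assms(2,3) that by auto
  ultimately show ?thesis using assms
    by (auto intro!: exI[of _ "map (\<lambda>w. of_int w / of_int W) ws"] simp del: form_value.simps)
qed

text \<open>
  A partition of the unit square of product mixtures by cuts \<open>p\<^sub>1 = c/m\<close> or \<open>p\<^sub>2 = c/n\<close>, with Banker's answer
  to each of the rectangles.
\<close>

datatype plan = Respond int "int list" | Cut1 int plan plan | Cut2 int plan plan

fun corner :: "int \<Rightarrow> int \<Rightarrow> int \<Rightarrow> int \<Rightarrow> quad" where
  "corner m n x y = ((m - x) * (n - y), (m - x) * y, x * (n - y), x * y)"

lemma mix_corner: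
  assumes "m > 0" "n > 0"
  shows "mix (corner m n x y) = (\<lambda>u. of_int (m * n) * product_at (of_int x / of_int m) (of_int y / of_int n) u)"
  using assms by (auto simp: fun_eq_iff field_simps)

text \<open>
  At a corner a response is affine in the position \<open>\<beta>\<close>, while the lower bound is quadratic; raising the
  degree of the former gives a comparison of three coefficients. Only the last inequality is strict, so
  that the bound may be attained at \<open>\<beta> = 0\<close>: there the gap closes for the ranges that start at a value
  of \<open>\<theta>\<close> at which the optimum is a product mixture.
\<close>

fun below :: "int \<Rightarrow> triple \<Rightarrow> int \<Rightarrow> form \<Rightarrow> quad \<Rightarrow> bool" where
  "below K (f0, f1, f2) M (c, c') q \<longleftrightarrow> M * dot c q \<le> K * f0 \<and> M * (dot c q + dot c' q) \<le> K * f1 \<and> M * dot c' q < K * f2"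

lemma below:
  assumes "below K F M h q" "0 \<le> \<alpha>" "0 < \<beta>" "\<alpha> + \<beta> = 1"
  shows "of_int M * form_value h \<alpha> \<beta> (mix q) < of_int K * quadratic F \<alpha> \<beta>"
proof -
  obtain f0 f1 f2 where F: "F = (f0, f1, f2)" by (cases F) auto
  obtain c c' where h: "h = (c, c')" by (rule prod.exhaust)
  define d d' where "d = dot c q" and "d' = dot c' q"
  have le: "of_int (M * d) \<le> (of_int (K * f0) :: real)" "of_int (M * (d + d')) \<le> (of_int (K * f1) :: real)"
    "of_int (M * d') < (of_int (K * f2) :: real)"
    using assms(1) by (auto simp only: F h below.simps d_def d'_def of_int_le_iff of_int_less_iff)
  have "of_int M * form_value h \<alpha> \<beta> (mix q) = (\<alpha> + \<beta>) * of_int M * (\<alpha> * of_int d + \<beta> * of_int d')"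
    unfolding h form_value.simps weigh_mix d_def d'_def using assms(4) by simp
  also have "\<dots> = \<alpha>\<^sup>2 * of_int (M * d) + (\<alpha> * \<beta>) * of_int (M * (d + d')) + \<beta>\<^sup>2 * of_int (M * d')"
    by (simp add: power2_eq_square algebra_simps)
  also have "\<dots> < \<alpha>\<^sup>2 * of_int (K * f0) + (\<alpha> * \<beta>) * of_int (K * f1) + \<beta>\<^sup>2 * of_int (K * f2)"
    using assms le by (intro add_le_less_mono add_mono mult_left_mono mult_strict_left_mono) auto
  also have "\<dots> = of_int K * quadratic F \<alpha> \<beta>" by (simp add: F algebra_simps)
  finally show ?thesis .
qed

fun respond :: "int \<Rightarrow> int list \<Rightarrow> game \<Rightarrow> form" where
  "respond W ws (l, hs) = respond_list ws hs (scale_form W l)"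

primrec refutes :: "int \<Rightarrow> int \<Rightarrow> int \<Rightarrow> triple \<Rightarrow> game \<Rightarrow> int \<Rightarrow> int \<Rightarrow> int \<Rightarrow> int \<Rightarrow> plan \<Rightarrow> bool" where
  "refutes m n M F G x0 x1 y0 y1 (Cut1 x L R) \<longleftrightarrow> refutes m n M F G x0 x y0 y1 L \<and> refutes m n M F G x x1 y0 y1 R"
| "refutes m n M F G x0 x1 y0 y1 (Cut2 y L R) \<longleftrightarrow> refutes m n M F G x0 x1 y0 y L \<and> refutes m n M F G x0 x1 y y1 R"
| "refutes m n M F G x0 x1 y0 y1 (Respond W ws) \<longleftrightarrow>
     W > 0 \<and> length ws = length (snd G) \<and> list_all (\<lambda>w. 0 \<le> w \<and> w \<le> W) ws \<and>
     list_all (below (W * (m * n)) F M (respond W ws G))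
       [corner m n x0 y0, corner m n x0 y1, corner m n x1 y0, corner m n x1 y1]"

lemma refutes:
  assumes "refutes m n M F G x0 x1 y0 y1 P"
    and mn: "m > 0" "n > 0" "M > 0" and ab: "0 \<le> \<alpha>" "0 < \<beta>" "\<alpha> + \<beta> = 1"
    and "of_int x0 / of_int m \<le> x" "x \<le> of_int x1 / of_int m" "of_int y0 / of_int n \<le> y" "y \<le> of_int y1 / of_int n"
  shows "of_int M * worth G \<alpha> \<beta> (product_at x y) < quadratic F \<alpha> \<beta>"
  using assms(1,8-)
proof (induction P arbitrary: x0 x1 y0 y1)
  case (Respond W ws)
  obtain l hs where G: "G = (l, hs)" by (rule prod.exhaust)
  define h where "h = respond_list ws hs (scale_form W l)"
  from Respond have W: "W > 0" "length ws = length hs" "set ws \<subseteq> {0..W}"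
    and b: "list_all (below (W * (m * n)) F M h) [corner m n x0 y0, corner m n x0 y1, corner m n x1 y0, corner m n x1 y1]"
    by (auto simp only: G refutes.simps respond.simps list_all_iff h_def atLeastAtMost_iff snd_conv)
  have less: "form_value h \<alpha> \<beta> (product_at (of_int i / of_int m) (of_int j / of_int n)) < of_int W * quadratic F \<alpha> \<beta> / of_int M"
    if "below (W * (m * n)) F M h (corner m n i j)" for i j
  proof -
    let ?A = "form_value h \<alpha> \<beta> (product_at (of_int i / of_int m) (of_int j / of_int n))"
    have "of_int (m * n) * (of_int M * ?A) < of_int (m * n) * (of_int W * quadratic F \<alpha> \<beta>)"
      using below[OF that ab] unfolding mix_corner[OF mn(1,2)] form_value_linear(2) of_int_mult by (simp only: mult_ac)
    then have "of_int M * ?A < of_int W * quadratic F \<alpha> \<beta>"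
      using mn by (simp only: mult_less_cancel_left_pos of_int_0_less_iff mult_pos_pos)
    with mn show ?thesis by (simp add: less_divide_eq mult.commute del: form_value.simps)
  qed
  have "form_value h \<alpha> \<beta> (product_at x y) < of_int W * quadratic F \<alpha> \<beta> / of_int M"
    by (rule bilinear_less_on_rectangle[OF Respond.prems(2-5)]) (use b in \<open>auto intro!: less simp del: below.simps\<close>)
  moreover have "worth G \<alpha> \<beta> (product_at x y) \<le> form_value h \<alpha> \<beta> (product_at x y) / of_int W"
    using worth_le_response[OF respond_list[OF W(2,3,1)]] unfolding G h_def .
  ultimately have "worth G \<alpha> \<beta> (product_at x y) < of_int W * quadratic F \<alpha> \<beta> / of_int M / of_int W"
    using W(1) by (meson divide_strict_right_mono of_int_0_less_iff order_le_less_trans)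
  then show ?case using mn W(1) by (simp add: less_divide_eq mult.commute del: worth.simps)
next
  case (Cut1 c L R)
  then show ?case by (cases "x \<le> of_int c / of_int m") auto
next
  case (Cut2 c L R)
  then show ?case by (cases "y \<le> of_int c / of_int n") auto
qed

section \<open>The game in integers\<close>

text \<open>
  For each signal the weights and the effects of a draw on \<open>j = 0, \<dots>, 7\<close>, first for standing and then
  for drawing on 5.
\<close>

type_synonym signal_row = "int \<times> int \<times> int list \<times> int list"

definition signal_rows :: "signal_row list" where
  "signal_rows = [(356, 420, [- 4484, - 2844, - 1564, - 284, 996, 1636, 1636, 1636], [- 5060, - 3420, - 2140, - 860, 420, 1700, 2340, 2340]),
   (89, 105, [- 1193, - 943, - 533, - 213, 107, 427, 587, 587], [- 1305, - 1055, - 645, - 325, - 5, 315, 635, 795]),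
   (89, 105, [- 1015, - 1015, - 765, - 355, - 35, 285, 605, 765], [- 1095, - 1095, - 845, - 435, - 115, 205, 525, 845]),
   (89, 105, [- 837, - 837, - 837, - 587, - 177, 143, 463, 783], [- 885, - 885, - 885, - 635, - 225, 95, 415, 735]),
   (89, 105, [- 659, - 659, - 659, - 659, - 409, 1, 321, 641], [- 675, - 675, - 675, - 675, - 425, - 15, 305, 625]),
   (89, 105, [- 481, - 481, - 481, - 481, - 481, - 231, 179, 499], [- 625, - 465, - 465, - 465, - 465, - 215, 195, 515]),
   (89, 105, [- 463, - 303, - 303, - 303, - 303, - 303, - 53, 357], [- 735, - 415, - 255, - 255, - 255, - 255, - 5, 405]),
   (89, 105, [- 605, - 285, - 125, - 125, - 125, - 125, - 125, 125], [- 845, - 525, - 205, - 45, - 45, - 45, - 45, 205]),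
   (89, 105, [- 747, - 427, - 107, 53, 53, 53, 53, 53], [- 955, - 635, - 315, 5, 165, 165, 165, 165]),
   (89, 105, [- 889, - 569, - 249, 71, 231, 231, 231, 231], [- 1065, - 745, - 425, - 105, 215, 375, 375, 375]),
   (624, 416, [- 4368, - 4368, - 4368, - 4368, - 4368, - 2288, 1872, 6032], [- 2496, - 2496, - 2496, - 2496, - 2496, - 2496, - 416, 3744]),
   (416, 416, [0, 0, 0, 0, 0, 0, 0, 0], [0, 0, 0, 0, 0, 0, 0, 0])]"

lemma sum_atMost_9_list: "(\<Sum>x\<le>9. f x) = (\<Sum>x\<leftarrow>[0..<10]. f x)" for f :: "nat \<Rightarrow> int"
  by (simp add: interv_sum_list_conv_sum_set_nat atLeast0LessThan lessThan_Suc_atMost[symmetric])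

text \<open>
  For given \<open>x\<close> the signal fixes the third card of a drawing hand, and otherwise does not involve it.
  This removes the sum over third cards and makes the table computable.
\<close>

fun branch :: "bool \<Rightarrow> nat \<Rightarrow> (nat \<Rightarrow> int) \<Rightarrow> nat \<Rightarrow> int" where
  "branch u k f x = (if player_draws u x then if k \<le> 9 then card_weight k * f ((x + k) mod 10) else 0
     else if k = (if x \<le> 7 then 10 else 11) then 13 * f x else 0)"

lemma sum_branch:
  "(\<Sum>x\<le>9. \<Sum>z\<le>9. pair_weight x * card_weight z * of_bool (signal u x z = k) * f (player_total u x z))
     = (\<Sum>x\<leftarrow>[0..<10]. pair_weight x * branch u k f x)"
  unfolding sum_atMost_9_list[symmetric]
proof (rule sum.cong[OF refl])
  fix x
  have "(\<Sum>z\<le>9. card_weight z * of_bool (z = k) * f ((x + z) mod 10))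
      = (if k \<le> 9 then card_weight k * f ((x + k) mod 10) else 0)"
    using sum.delta[of "{..9}" k "\<lambda>z. card_weight z * f ((x + z) mod 10)"]
    by (simp add: of_bool_def if_distrib[where f="\<lambda>x. _ * x"] if_distrib[where f="\<lambda>x. x * _"] cong: if_cong)
  then show "(\<Sum>z\<le>9. pair_weight x * card_weight z * of_bool (signal u x z = k) * f (player_total u x z))
      = pair_weight x * branch u k f x"
    using sum_card_weight
    by (auto simp: signal_def player_total_def mult.assoc simp flip: sum_distrib_left sum_distrib_right)
qed

definition signal_row :: "nat \<Rightarrow> signal_row" where
  "signal_row k = (signal_weight False k, signal_weight True k, map (draw_effect False k) [0..<8], map (draw_effect True k) [0..<8])"

lemma signal_weight_eq [code]: "signal_weight u k = (\<Sum>x\<leftarrow>[0..<10]. pair_weight x * branch u k (\<lambda>_. 1) x)"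
  using sum_branch[of u k "\<lambda>_. 1"] by (simp add: signal_weight_def)

lemma draw_effect_eq [code]: "draw_effect u k j = (if k = 11 then 0 else \<Sum>x\<leftarrow>[0..<10]. pair_weight x * branch u k (\<lambda>f. draw_gain f j) x)"
  using sum_branch[of u k "\<lambda>f. draw_gain f j"] by (simp add: draw_effect_def)

lemma draw_gain_eq [code]: "draw_gain f j = (\<Sum>z\<leftarrow>[0..<10]. card_weight z * (sgn (int f - int ((j + z) mod 10)) - sgn (int f - int j)))"
  by (simp only: draw_gain_def sum_atMost_9_list)

lemma standing_total_eq [code]:
  "standing_total u = (\<Sum>x\<leftarrow>[0..<10]. \<Sum>z\<leftarrow>[0..<10]. \<Sum>y\<leftarrow>[0..<10].
     pair_weight x * card_weight z * pair_weight y * standing_outcome u x z y)"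
  by (simp only: standing_total_def sum_atMost_9_list)

lemma signal_rows: "map signal_row [0..<12] = signal_rows"
  by code_simp

fun info_form :: "nat \<times> nat \<times> nat \<Rightarrow> form" where
  "info_form (k\<^sub>1, k\<^sub>2, j) =
    ((pair_weight j * draw_effect False k\<^sub>1 j * signal_weight False k\<^sub>2, pair_weight j * draw_effect False k\<^sub>1 j * signal_weight True k\<^sub>2,
      pair_weight j * draw_effect True k\<^sub>1 j * signal_weight False k\<^sub>2, pair_weight j * draw_effect True k\<^sub>1 j * signal_weight True k\<^sub>2),
     (pair_weight j * signal_weight False k\<^sub>1 * draw_effect False k\<^sub>2 j, pair_weight j * signal_weight False k\<^sub>1 * draw_effect True k\<^sub>2 j,
      pair_weight j * signal_weight True k\<^sub>1 * draw_effect False k\<^sub>2 j, pair_weight j * signal_weight True k\<^sub>1 * draw_effect True k\<^sub>2 j))"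

definition signal_pairs :: "(nat \<times> nat) list" where
  "signal_pairs = filter (\<lambda>k. k \<noteq> (11, 11)) (List.product [0..<12] [0..<12])"

definition info_list :: "(nat \<times> nat \<times> nat) list" where
  "info_list = concat (map (\<lambda>(k\<^sub>1, k\<^sub>2). map (\<lambda>j. (k\<^sub>1, k\<^sub>2, j)) [0..<8]) signal_pairs)"

definition standing_form :: form where
  "standing_form = (let a = 13 ^ 4 * standing_total False; b = 13 ^ 4 * standing_total True in ((a, a, b, b), (a, b, a, b)))"

definition full_game :: game where
  "full_game = (standing_form, map info_form info_list)"

fun row_forms :: "int list \<Rightarrow> signal_row \<Rightarrow> signal_row \<Rightarrow> form list" where
  "row_forms (w # ws) (r, r', e # es, e' # es') (q, q', f # fs, f' # fs') =
     ((w * e * q, w * e * q', w * e' * q, w * e' * q'), (w * r * f, w * r * f', w * r' * f, w * r' * f'))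
     # row_forms ws (r, r', es, es') (q, q', fs, fs')"
| "row_forms _ _ _ = []"

lemma row_forms: "map (\<lambda>j. info_form (k\<^sub>1, k\<^sub>2, j)) [0..<8] = row_forms (map pair_weight [0..<8]) (signal_row k\<^sub>1) (signal_row k\<^sub>2)"
  by (simp add: signal_row_def upt_conv_Cons)

definition table_game :: game where
  "table_game = (standing_form, concat (map (\<lambda>(k\<^sub>1, k\<^sub>2). row_forms (map pair_weight [0..<8]) (signal_rows ! k\<^sub>1) (signal_rows ! k\<^sub>2)) signal_pairs))"

lemma full_game_eq_table_game: "full_game = table_game"
proof -
  have "map info_form info_list = concat (map (map info_form \<circ> (\<lambda>(k\<^sub>1, k\<^sub>2). map (\<lambda>j. (k\<^sub>1, k\<^sub>2, j)) [0..<8])) signal_pairs)"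
    by (simp add: info_list_def map_concat)
  also have "\<dots> = concat (map (\<lambda>(k\<^sub>1, k\<^sub>2). row_forms (map pair_weight [0..<8]) (signal_rows ! k\<^sub>1) (signal_rows ! k\<^sub>2)) signal_pairs)"
  proof (intro arg_cong[where f=concat] map_cong refl)
    fix k assume "k \<in> set signal_pairs"
    then obtain k\<^sub>1 k\<^sub>2 where k: "k = (k\<^sub>1, k\<^sub>2)" "k\<^sub>1 < 12" "k\<^sub>2 < 12" by (auto simp: signal_pairs_def)
    have "signal_rows ! i = signal_row i" if "i < 12" for i
      using arg_cong[OF signal_rows, of "\<lambda>rs. rs ! i"] that by simp
    with k show "(map info_form \<circ> (\<lambda>(k\<^sub>1, k\<^sub>2). map (\<lambda>j. (k\<^sub>1, k\<^sub>2, j)) [0..<8])) k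
        = (case k of (k\<^sub>1, k\<^sub>2) \<Rightarrow> row_forms (map pair_weight [0..<8]) (signal_rows ! k\<^sub>1) (signal_rows ! k\<^sub>2))"
      by (simp add: row_forms[symmetric] o_def del: info_form.simps)
  qed
  finally show ?thesis by (simp add: full_game_def table_game_def)
qed

text \<open>
  What remains when every information set whose sign is the same for all \<open>\<theta> \<le> 1/2\<close> and all mixtures has been
  settled: the samples are the pairs \<open>(\<theta>, 1 - \<theta>) = (0, 1)\<close> and \<open>(s, t) = (1, 1)\<close>, the latter being
  \<open>\<theta> = 1/2\<close> up to scale.
\<close>

definition core_game :: game where
  "core_game = (((-7700272,7907280,-6949824,6413120),(-129815376,-96563680,-124767824,-91524320)),
  [((1418304,1673280,598080,705600),(609472,-28480,719040,-33600)),
 ((1418304,1673280,598080,705600),(-199360,-655040,-235200,-772800)),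
 ((1418304,1673280,598080,705600),(-1008192,-1281600,-1189440,-1512000)),
 ((2329664,2748480,2420800,2856000),(5696,-85440,6720,-100800)),
 ((2329664,2748480,2420800,2856000),(-1315776,-1224640,-1552320,-1444800)),
 ((1418304,1673280,598080,705600),(-1725888,-1452480,-2036160,-1713600)),
 ((2329664,2748480,2420800,2856000),(-1725888,-1452480,-2036160,-1713600)),
 ((2329664,2748480,3332160,3931200),(-301888,-28480,-356160,-33600)),
 ((1418304,1673280,598080,705600),(-712000,-256320,-840000,-302400)),
 ((2329664,2748480,2420800,2856000),(-712000,-256320,-840000,-302400)),
 ((2329664,2748480,3332160,3931200),(-712000,-256320,-840000,-302400)),
 ((-404416,-477120,-1224640,-1444800),(301888,28480,356160,33600)),
 ((-404416,-477120,-1224640,-1444800),(404416,-598080,477120,-705600)),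
 ((16333824,10889216,16972800,11315200),(-13032448,-14217216,-15375360,-16773120)),
 ((16333824,10889216,23362560,15575040),(10662912,-2369536,12579840,-2795520)),
 ((152368,179760,-7120,-8400),(152368,-7120,179760,-8400)),
 ((152368,179760,-7120,-8400),(-49840,-163760,-58800,-193200)),
 ((608048,717360,448560,529200),(1424,-21360,1680,-25200)),
 ((608048,717360,448560,529200),(-328944,-306160,-388080,-361200)),
 ((608048,717360,448560,529200),(-431472,-363120,-509040,-428400)),
 ((835888,986160,904240,1066800),(-75472,-7120,-89040,-8400)),
 ((152368,179760,-7120,-8400),(-178000,-64080,-210000,-75600)),
 ((608048,717360,448560,529200),(-178000,-64080,-210000,-75600)),
 ((835888,986160,904240,1066800),(-178000,-64080,-210000,-75600)),
 ((-303312,-357840,-462800,-546000),(75472,7120,89040,8400)),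
 ((-303312,-357840,-462800,-546000),(101104,-149520,119280,-176400)),
 ((4263168,2842112,3144960,2096640),(-3258112,-3554304,-3843840,-4193280)),
 ((5860608,3907072,6339840,4226560),(2665728,-592384,3144960,-698880)),
 ((712192,712192,-33280,-33280),(0,0,0,0)),
 ((-199360,-235200,-655040,-772800),(1418304,598080,1673280,705600)),
 ((-49840,-58800,-163760,-193200),(152368,-7120,179760,-8400)),
 ((405840,478800,291920,344400),(1424,-21360,1680,-25200)),
 ((405840,478800,291920,344400),(-328944,-306160,-388080,-361200)),
 ((405840,478800,291920,344400),(-431472,-363120,-509040,-428400)),
 ((861520,1016400,747600,882000),(-75472,-7120,-89040,-8400)),
 ((405840,478800,291920,344400),(-178000,-64080,-210000,-75600)),
 ((861520,1016400,747600,882000),(-178000,-64080,-210000,-75600)),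
 ((-505520,-596400,-619440,-730800),(75472,7120,89040,8400)),
 ((-49840,-58800,-163760,-193200),(75472,234960,89040,277200)),
 ((-505520,-596400,-619440,-730800),(101104,-149520,119280,-176400)),
 ((6040320,4026880,5241600,3494400),(2665728,-592384,3144960,-698880)),
 ((-1008192,-1189440,-1281600,-1512000),(1418304,598080,1673280,705600)),
 ((-252048,-297360,-320400,-378000),(152368,-7120,179760,-8400)),
 ((203632,240240,135280,159600),(1424,-21360,1680,-25200)),
 ((659312,777840,590960,697200),(-75472,-7120,-89040,-8400)),
 ((203632,240240,135280,159600),(-178000,-64080,-210000,-75600)),
 ((659312,777840,590960,697200),(-178000,-64080,-210000,-75600)),
 ((-835888,-986160,-904240,-1066800),(75472,7120,89040,8400)),
 ((-252048,-297360,-320400,-378000),(75472,234960,89040,277200)),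
 ((-835888,-986160,-904240,-1066800),(101104,-149520,119280,-176400)),
 ((-252048,-297360,-320400,-378000),(328944,306160,388080,361200)),
 ((4622592,3081728,4143360,2762240),(2665728,-592384,3144960,-698880)),
 ((-2329664,-2748480,-2420800,-2856000),(1418304,598080,1673280,705600)),
 ((-582416,-687120,-605200,-714000),(152368,-7120,179760,-8400)),
 ((1424,1680,-21360,-25200),(1424,-21360,1680,-25200)),
 ((457104,539280,434320,512400),(-75472,-7120,-89040,-8400)),
 ((457104,539280,434320,512400),(-178000,-64080,-210000,-75600)),
 ((-938416,-1107120,-961200,-1134000),(75472,7120,89040,8400)),
 ((-582416,-687120,-605200,-714000),(75472,234960,89040,277200)),
 ((-938416,-1107120,-961200,-1134000),(101104,-149520,119280,-176400)),
 ((-582416,-687120,-605200,-714000),(328944,306160,388080,361200)),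
 ((3204864,2136576,3045120,2030080),(2665728,-592384,3144960,-698880)),
 ((6656,6656,-99840,-99840),(0,0,0,0)),
 ((-2739776,-3232320,-2648640,-3124800),(1418304,598080,1673280,705600)),
 ((-684944,-808080,-662160,-781200),(152368,-7120,179760,-8400)),
 ((-328944,-388080,-306160,-361200),(405840,291920,478800,344400)),
 ((-328944,-388080,-306160,-361200),(203632,135280,240240,159600)),
 ((-328944,-388080,-306160,-361200),(1424,-21360,1680,-25200)),
 ((254896,300720,277680,327600),(-75472,-7120,-89040,-8400)),
 ((254896,300720,277680,327600),(-178000,-64080,-210000,-75600)),
 ((-684944,-808080,-662160,-781200),(75472,7120,89040,8400)),
 ((-684944,-808080,-662160,-781200),(75472,234960,89040,277200)),
 ((-328944,-388080,-306160,-361200),(75472,234960,89040,277200)),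
 ((-684944,-808080,-662160,-781200),(101104,-149520,119280,-176400)),
 ((-684944,-808080,-662160,-781200),(328944,306160,388080,361200)),
 ((1787136,1191424,1946880,1297920),(2665728,-592384,3144960,-698880)),
 ((-1725888,-2036160,-1452480,-1713600),(1418304,598080,1673280,705600)),
 ((-431472,-509040,-363120,-428400),(152368,-7120,179760,-8400)),
 ((-431472,-509040,-363120,-428400),(608048,448560,717360,529200)),
 ((-431472,-509040,-363120,-428400),(405840,291920,478800,344400)),
 ((-431472,-509040,-363120,-428400),(203632,135280,240240,159600)),
 ((-431472,-509040,-363120,-428400),(1424,-21360,1680,-25200)),
 ((-431472,-509040,-363120,-428400),(75472,7120,89040,8400)),
 ((-431472,-509040,-363120,-428400),(75472,234960,89040,277200)),
 ((-431472,-509040,-363120,-428400),(75472,234960,89040,277200)),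
 ((-431472,-509040,-363120,-428400),(101104,-149520,119280,-176400)),
 ((-431472,-509040,-363120,-428400),(328944,306160,388080,361200)),
 ((-431472,-509040,-363120,-428400),(328944,534000,388080,630000)),
 ((-529152,-352768,-49920,-33280),(2665728,-592384,3144960,-698880)),
 ((-712000,-840000,-256320,-302400),(1418304,598080,1673280,705600)),
 ((-178000,-210000,-64080,-75600),(152368,-7120,179760,-8400)),
 ((-178000,-210000,-64080,-75600),(203632,135280,240240,159600)),
 ((-178000,-210000,-64080,-75600),(1424,-21360,1680,-25200)),
 ((-178000,-210000,-64080,-75600),(75472,7120,89040,8400)),
 ((-178000,-210000,-64080,-75600),(75472,234960,89040,277200)),
 ((-178000,-210000,-64080,-75600),(75472,234960,89040,277200)),
 ((-178000,-210000,-64080,-75600),(75472,234960,89040,277200)),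
 ((-178000,-210000,-64080,-75600),(101104,-149520,119280,-176400)),
 ((-1248000,-832000,-449280,-299520),(2665728,-592384,3144960,-698880)),
 ((75472,89040,234960,277200),(152368,-7120,179760,-8400)),
 ((75472,89040,234960,277200),(-49840,-163760,-58800,-193200)),
 ((75472,89040,234960,277200),(1424,-21360,1680,-25200)),
 ((75472,89040,234960,277200),(-75472,-7120,-89040,-8400)),
 ((75472,89040,7120,8400),(-178000,-64080,-210000,-75600)),
 ((75472,89040,234960,277200),(-178000,-64080,-210000,-75600)),
 ((75472,89040,234960,277200),(-178000,-64080,-210000,-75600)),
 ((75472,89040,234960,277200),(-178000,-64080,-210000,-75600)),
 ((75472,89040,7120,8400),(101104,-149520,119280,-176400)),
 ((529152,352768,1647360,1098240),(2665728,-592384,3144960,-698880)),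
 ((328944,388080,306160,361200),(152368,-7120,179760,-8400)),
 ((328944,388080,306160,361200),(-49840,-163760,-58800,-193200)),
 ((328944,388080,306160,361200),(-252048,-320400,-297360,-378000)),
 ((328944,388080,534000,630000),(1424,-21360,1680,-25200)),
 ((328944,388080,534000,630000),(-328944,-306160,-388080,-361200)),
 ((328944,388080,306160,361200),(-431472,-363120,-509040,-428400)),
 ((328944,388080,534000,630000),(-431472,-363120,-509040,-428400)),
 ((328944,388080,534000,630000),(-75472,-7120,-89040,-8400)),
 ((101104,119280,-149520,-176400),(-178000,-64080,-210000,-75600)),
 ((328944,388080,306160,361200),(-178000,-64080,-210000,-75600)),
 ((328944,388080,534000,630000),(-178000,-64080,-210000,-75600)),
 ((328944,388080,534000,630000),(-178000,-64080,-210000,-75600)),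
 ((101104,119280,-149520,-176400),(75472,7120,89040,8400)),
 ((101104,119280,-149520,-176400),(101104,-149520,119280,-176400)),
 ((2306304,1537536,3744000,2496000),(2665728,-592384,3144960,-698880)),
 ((472576,472576,-698880,-698880),(0,0,0,0)),
 ((-24880128,-29352960,-14217216,-16773120),(9944064,4193280,6629376,2795520)),
 ((-13032448,-15375360,-14217216,-16773120),(16333824,16972800,10889216,11315200)),
 ((-6220032,-7338240,-3554304,-4193280),(1068288,-49920,712192,-33280)),
 ((-3258112,-3843840,-3554304,-4193280),(4263168,3144960,2842112,2096640)),
 ((-3258112,-3843840,-3554304,-4193280),(2845440,2046720,1896960,1364480)),
 ((-3258112,-3843840,-3554304,-4193280),(1427712,948480,951808,632320)),
 ((-3258112,-3843840,-3554304,-4193280),(9984,-149760,6656,-99840)),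
 ((2665728,3144960,-592384,-698880),(-529152,-49920,-352768,-33280)),
 ((2665728,3144960,-592384,-698880),(-1248000,-449280,-832000,-299520)),
 ((-6220032,-7338240,-3554304,-4193280),(529152,49920,352768,33280)),
 ((-6220032,-7338240,-3554304,-4193280),(529152,1647360,352768,1098240)),
 ((-3258112,-3843840,-3554304,-4193280),(529152,1647360,352768,1098240)),
 ((2665728,3144960,-592384,-698880),(529152,1647360,352768,1098240)),
 ((-6220032,-7338240,-3554304,-4193280),(708864,-1048320,472576,-698880)),
 ((-6220032,-7338240,-3554304,-4193280),(2306304,2146560,1537536,1431040)),
 ((-3258112,-3843840,-3554304,-4193280),(2306304,3744000,1537536,2496000)),
 ((18690048,12460032,-4153344,-2768896),(18690048,-4153344,12460032,-2768896)),
 ((12460032,12460032,-2768896,-2768896),(0,0,0,0)),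
 ((0,0,0,0),(712192,-33280,712192,-33280)),
 ((0,0,0,0),(6656,-99840,6656,-99840)),
 ((0,0,0,0),(472576,-698880,472576,-698880)),
 ((0,0,0,0),(12460032,-2768896,12460032,-2768896))])"

lemma settle_full_game: "settle (0, 1) (1, 1) pure_pairs full_game = core_game"
  unfolding full_game_eq_table_game by code_simp

section \<open>The guaranteed payoff\<close>

lemma expectation_bool_pair:
  fixes g :: "bool \<times> bool \<Rightarrow> real"
  shows "measure_pmf.expectation p g = pmf p (False, False) * g (False, False) + pmf p (False, True) * g (False, True)
     + pmf p (True, False) * g (True, False) + pmf p (True, True) * g (True, True)"
proof -
  have "measure_pmf.expectation p g = (\<Sum>u\<in>UNIV. pmf p u *\<^sub>R g u)"
    by (rule integral_measure_pmf) auto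
  also have "\<dots> = (\<Sum>u\<in>UNIV \<times> UNIV. pmf p u * g u)" by simp
  also have "\<dots> = pmf p (False, False) * g (False, False) + pmf p (False, True) * g (False, True)
     + pmf p (True, False) * g (True, False) + pmf p (True, True) * g (True, True)"
    unfolding sum.cartesian_product' by (simp add: UNIV_bool)
  finally show ?thesis .
qed

lemma value_info_form:
  "form_value (info_form i) \<theta> (1 - \<theta>) p = p (False, False) * swing \<theta> (False, False) i + p (False, True) * swing \<theta> (False, True) i
     + p (True, False) * swing \<theta> (True, False) i + p (True, True) * swing \<theta> (True, True) i"
  by (cases i) (simp add: algebra_simps)

lemma value_standing_form:
  "form_value standing_form \<theta> (1 - \<theta>) p = p (False, False) * standing_payoff \<theta> (False, False) + p (False, True) * standing_payoff \<theta> (False, True)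
     + p (True, False) * standing_payoff \<theta> (True, False) + p (True, True) * standing_payoff \<theta> (True, True)"
  by (simp add: standing_form_def Let_def algebra_simps)

lemma info_list_product: "info_list = map (\<lambda>((k\<^sub>1, k\<^sub>2), j). (k\<^sub>1, k\<^sub>2, j)) (List.product signal_pairs [0..<8])"
  by (simp add: info_list_def product_concat_map map_concat o_def split_def)

lemma distinct_info_list: "distinct info_list"
  by (auto simp: info_list_product signal_pairs_def distinct_map distinct_product inj_on_def)

lemma set_info_list: "set info_list = info_sets"
  by (force simp: info_list_product signal_pairs_def info_sets_def)

lemma sum_info_sets: "(\<Sum>i\<in>info_sets. g i) = (\<Sum>i\<leftarrow>info_list. g i)" for g :: "info_set \<Rightarrow> real"
  by (simp add: sum_list_distinct_conv_sum_set distinct_info_list set_info_list)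

text \<open>The minimum over all subsets is attained by the set of indices with negative terms.\<close>

lemma Min_Pow_sum:
  fixes g :: "'a \<Rightarrow> real"
  assumes "finite A"
  shows "(MIN T\<in>Pow A. c + (\<Sum>i\<in>T. g i)) = c + (\<Sum>i\<in>A. min 0 (g i))"
proof (rule Min_eqI)
  show "finite ((\<lambda>T. c + sum g T) ` Pow A)" using assms by simp
next
  fix y assume "y \<in> (\<lambda>T. c + sum g T) ` Pow A"
  then obtain T where T: "T \<subseteq> A" "y = c + sum g T" by auto
  have "(\<Sum>i\<in>A. min 0 (g i)) \<le> (\<Sum>i\<in>T. min 0 (g i))"
    using sum_mono2[of A T "\<lambda>i. - min 0 (g i)"] assms T by (simp add: sum_negf)
  also have "\<dots> \<le> sum g T" by (rule sum_mono) simp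
  finally show "c + (\<Sum>i\<in>A. min 0 (g i)) \<le> y" using T by simp
next
  have "(\<Sum>i\<in>A. min 0 (g i)) = sum g {i \<in> A. g i < 0}"
    using assms by (simp add: sum.inter_filter min_def if_distrib not_less[symmetric] cong: if_cong)
      (auto intro!: sum.cong)
  then show "c + (\<Sum>i\<in>A. min 0 (g i)) \<in> (\<lambda>T. c + sum g T) ` Pow A" by (auto intro!: image_eqI[of _ _ "{i \<in> A. g i < 0}"])
qed

lemma expectation_payoff:
  assumes "T \<in> banker_pure"
  shows "measure_pmf.expectation p (\<lambda>u. payoff \<theta> u T)
    = (form_value standing_form \<theta> (1 - \<theta>) (pmf p) + (\<Sum>i\<in>T. form_value (info_form i) \<theta> (1 - \<theta>) (pmf p))) / 13 ^ 9"
proof -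
  have T: "T \<subseteq> info_sets" using assms by (simp add: banker_pure_def)
  show ?thesis unfolding expectation_bool_pair payoff_eq[OF T] value_standing_form value_info_form
    by (simp only: sum.distrib sum_distrib_left[symmetric]) (simp add: distrib_left add_divide_distrib del: standing_payoff.simps)
qed

lemma guaranteed_eq: "guaranteed \<theta> p = worth full_game \<theta> (1 - \<theta>) (pmf p) / 13 ^ 9"
proof -
  have "guaranteed \<theta> p = (MIN T\<in>Pow info_sets. form_value standing_form \<theta> (1 - \<theta>) (pmf p) / 13 ^ 9
       + (\<Sum>i\<in>T. form_value (info_form i) \<theta> (1 - \<theta>) (pmf p) / 13 ^ 9))"
    unfolding guaranteed_def
    by (rule arg_cong[where f=Min], rule image_cong)
       (simp_all add: banker_pure_def[symmetric] expectation_payoff add_divide_distrib sum_divide_distrib del: form_value.simps info_form.simps)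
  also have "\<dots> = form_value standing_form \<theta> (1 - \<theta>) (pmf p) / 13 ^ 9 + (\<Sum>i\<in>info_sets. min 0 (form_value (info_form i) \<theta> (1 - \<theta>) (pmf p) / 13 ^ 9))"
    by (rule Min_Pow_sum[OF finite_info_sets])
  also have "(\<Sum>i\<in>info_sets. min 0 (form_value (info_form i) \<theta> (1 - \<theta>) (pmf p) / 13 ^ 9))
      = (\<Sum>i\<in>info_sets. min 0 (form_value (info_form i) \<theta> (1 - \<theta>) (pmf p))) / 13 ^ 9"
    unfolding sum_divide_distrib by (rule sum.cong) (simp_all add: min_def del: form_value.simps info_form.simps)
  finally show ?thesis
    by (simp add: full_game_def sum_info_sets o_def add_divide_distrib del: form_value.simps info_form.simps)
qed

lemma worth_scale:
  assumes "0 \<le> k"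
  shows "worth G (k * s) (k * t) p = k * worth G s t p" "worth G s t (\<lambda>u. k * p u) = k * worth G s t p"
proof -
  obtain l hs where G: "G = (l, hs)" by (rule prod.exhaust)
  have st: "form_value h (k * s) (k * t) p = k * form_value h s t p" for h
    by (rule prod.exhaust[of h]) (simp add: algebra_simps)
  have m: "min 0 (k * x) = k * min 0 x" for x :: real
    using assms by (simp add: min_def zero_le_mult_iff)
  show "worth G (k * s) (k * t) p = k * worth G s t p" "worth G s t (\<lambda>u. k * p u) = k * worth G s t p"
    unfolding G worth.simps st form_value_linear(2) m by (simp_all add: sum_list_const_mult distrib_left del: form_value.simps)
qed

lemma worth_full_game:
  assumes "0 \<le> \<theta>" "\<theta> \<le> 1/2" "\<And>u. p u \<ge> 0"
  shows "worth full_game \<theta> (1 - \<theta>) p = worth core_game \<theta> (1 - \<theta>) p"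
  unfolding settle_full_game[symmetric]
  by (rule worth_settle[symmetric, where \<alpha>="1 - 2 * \<theta>" and \<beta>=\<theta>]) (use assms in \<open>auto intro: nonneg_in_conic_span\<close>)

lemma weigh_pmf_bounded: "\<exists>B. \<forall>p. \<bar>weigh c (pmf p)\<bar> \<le> B"
proof -
  obtain x y z w where c: "c = (x, y, z, w)" by (cases c) auto
  have *: "\<bar>of_int n * pmf p u\<bar> \<le> \<bar>real_of_int n\<bar>" for n p and u :: "bool \<times> bool"
    using mult_left_mono[OF pmf_le_1[of p u], of "\<bar>real_of_int n\<bar>"] by (simp add: abs_mult)
  have "\<bar>weigh c (pmf p)\<bar> \<le> \<bar>of_int x\<bar> + \<bar>of_int y\<bar> + \<bar>of_int z\<bar> + \<bar>of_int w\<bar>" for p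
    unfolding c weigh.simps by (intro order.trans[OF abs_triangle_ineq] add_mono *)
  then show ?thesis by blast
qed

lemma worth_bounded: "\<exists>B. \<forall>p. worth G s t (pmf p) \<le> B"
proof -
  obtain l hs where G: "G = (l, hs)" by (rule prod.exhaust)
  obtain c c' where l: "l = (c, c')" by (rule prod.exhaust)
  obtain B B' where B: "\<bar>weigh c (pmf p)\<bar> \<le> B" "\<bar>weigh c' (pmf p)\<bar> \<le> B'" for p
    using weigh_pmf_bounded[of c] weigh_pmf_bounded[of c'] by blast
  have "worth G s t (pmf p) \<le> \<bar>s\<bar> * B + \<bar>t\<bar> * B'" for p
  proof -
    have "(\<Sum>h\<leftarrow>hs. min 0 (form_value h s t (pmf p))) \<le> 0" by (rule sum_list_nonpos) auto
    then have "worth G s t (pmf p) \<le> \<bar>s * weigh c (pmf p)\<bar> + \<bar>t * weigh c' (pmf p)\<bar>" by (simp add: G l)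
    also have "\<dots> \<le> \<bar>s\<bar> * B + \<bar>t\<bar> * B'"
      unfolding abs_mult using B by (intro add_mono mult_left_mono) auto
    finally show ?thesis .
  qed
  then show ?thesis by blast
qed

lemma bdd_above_guaranteed: "bdd_above (range (guaranteed \<theta>))"
proof -
  obtain B where "worth full_game \<theta> (1 - \<theta>) (pmf p) \<le> B" for p using worth_bounded by blast
  then show ?thesis
    by (intro bdd_aboveI[of _ "B / 13 ^ 9"]) (auto simp: guaranteed_eq divide_right_mono)
qed

lemma pmf_product_mixture:
  assumes "x \<in> {0..1}" "y \<in> {0..1}"
  shows "pmf (product_mixture x y) = product_at x y"
  using assms by (auto simp: fun_eq_iff product_mixture_def pmf_pair)

lemma pmf_exists:
  assumes "\<And>u. p u \<ge> 0" "p (False, False) + p (False, True) + p (True, False) + p (True, True) = (1::real)"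
  shows "\<exists>P. pmf P = p"
proof -
  have "sum p (UNIV \<times> UNIV) = 1"
    unfolding sum.cartesian_product' using assms(2) by (simp add: UNIV_bool algebra_simps)
  then have "(\<integral>\<^sup>+u. ennreal (p u) \<partial>count_space UNIV) = 1"
    using assms(1) by (subst nn_integral_count_space_finite) (auto simp: sum_ennreal)
  with assms(1) show ?thesis by (intro exI[of _ "embed_pmf p"] ext pmf_embed_pmf) auto
qed

text \<open>
  Continuity on the compact square makes the lower value of the independent game a maximum. Hence a
  strict inequality for each product mixture separates the two values.
\<close>

lemma continuous_on_guaranteed_product:
  "continuous_on ({0..1} \<times> {0..1}) (\<lambda>(x, y). guaranteed \<theta> (product_mixture x y))"
proof -
  obtain l hs where G: "full_game = (l, hs)" by (rule prod.exhaust)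
  have c: "continuous_on S (\<lambda>z. form_value h \<theta> (1 - \<theta>) (product_at (fst z) (snd z)))" for h S
  proof -
    obtain a b c d a' b' c' d' where h: "h = ((a, b, c, d), (a', b', c', d'))" by (cases h) auto
    show ?thesis unfolding h by (simp, intro continuous_intros)
  qed
  have s: "continuous_on S (\<lambda>z. \<Sum>h\<leftarrow>hs. min 0 (form_value h \<theta> (1 - \<theta>) (product_at (fst z) (snd z))))" for S
    by (induction hs) (auto simp del: form_value.simps intro!: continuous_intros continuous_on_min c)
  have "continuous_on ({0..1} \<times> {0..1}) (\<lambda>z. worth full_game \<theta> (1 - \<theta>) (product_at (fst z) (snd z)) / 13 ^ 9)"
    unfolding G worth.simps by (intro continuous_intros c s) simp
  then show ?thesis
    by (rule continuous_on_eq) (auto simp: guaranteed_eq pmf_product_mixture)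
qed

lemma independent_lower_value_attained:
  "\<exists>x\<in>{0..1}. \<exists>y\<in>{0..1}. independent_lower_value \<theta> = guaranteed \<theta> (product_mixture x y)"
proof -
  let ?f = "\<lambda>(x, y). guaranteed \<theta> (product_mixture x y)"
  have "compact ({0..1} \<times> {0..1} :: (real \<times> real) set)" by (intro compact_Times compact_Icc)
  then obtain z where z: "z \<in> {0..1} \<times> {0..1}" "\<And>z'. z' \<in> {0..1} \<times> {0..1} \<Longrightarrow> ?f z' \<le> ?f z"
    using continuous_attains_sup[OF _ _ continuous_on_guaranteed_product[of \<theta>]] by (metis atLeastAtMost_iff empty_iff mem_Times_iff order_refl zero_le_one fst_conv snd_conv)
  have "independent_lower_value \<theta> = ?f z"
    unfolding independent_lower_value_def using z by (intro cSup_eq_maximum) auto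
  moreover obtain x y where "z = (x, y)" by (rule prod.exhaust)
  ultimately show ?thesis using z(1) by (intro bexI[of _ x] bexI[of _ y]) auto
qed

lemma independent_le_correlated: "independent_lower_value \<theta> \<le> correlated_value \<theta>"
proof -
  obtain x y where "independent_lower_value \<theta> = guaranteed \<theta> (product_mixture x y)"
    using independent_lower_value_attained by blast
  then show ?thesis
    unfolding correlated_value_def by (auto intro: cSUP_upper bdd_above_guaranteed)
qed

lemma product_at_nonneg: "x \<in> {0..1} \<Longrightarrow> y \<in> {0..1} \<Longrightarrow> 0 \<le> product_at x y u"
  by (cases u) auto

lemma not_coincide:
  assumes "0 \<le> \<theta>" "\<theta> \<le> 1/2"
    and p: "\<And>u. p u \<ge> 0" "p (False, False) + p (False, True) + p (True, False) + p (True, True) = 1"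
    and less: "\<And>x y. x \<in> {0..1} \<Longrightarrow> y \<in> {0..1} \<Longrightarrow> worth core_game \<theta> (1 - \<theta>) (product_at x y) < worth core_game \<theta> (1 - \<theta>) p"
  shows "\<not> equilibria_coincide \<theta>"
proof -
  obtain P where P: "pmf P = p" using pmf_exists[OF p] by blast
  obtain x y where xy: "x \<in> {0..1}" "y \<in> {0..1}" "independent_lower_value \<theta> = guaranteed \<theta> (product_mixture x y)"
    using independent_lower_value_attained by blast
  have "guaranteed \<theta> (product_mixture x y) < guaranteed \<theta> P"
    using less[OF xy(1,2)] p(1) xy(1,2)
    by (simp add: guaranteed_eq P pmf_product_mixture worth_full_game[OF assms(1,2)] product_at_nonneg divide_strict_right_mono)
  also have "\<dots> \<le> correlated_value \<theta>"
    unfolding correlated_value_def by (rule cSUP_upper[OF UNIV_I bdd_above_guaranteed])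
  finally show ?thesis using xy(3) by (simp add: equilibria_coincide_def)
qed

lemma coincide:
  assumes "0 \<le> \<theta>" "\<theta> \<le> 1/2" and xy: "x \<in> {0..1}" "y \<in> {0..1}"
    and le: "\<And>p. worth core_game \<theta> (1 - \<theta>) (pmf p) \<le> worth core_game \<theta> (1 - \<theta>) (product_at x y)"
  shows "equilibria_coincide \<theta>"
proof -
  have max: "guaranteed \<theta> p \<le> guaranteed \<theta> (product_mixture x y)" for p
    using le[of p] by (simp add: guaranteed_eq worth_full_game[OF assms(1,2)] pmf_product_mixture[OF xy, symmetric] divide_right_mono)
  have "correlated_value \<theta> \<le> guaranteed \<theta> (product_mixture x y)"
    unfolding correlated_value_def by (rule cSUP_least) (auto intro: max)
  also have "\<dots> \<le> independent_lower_value \<theta>"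
    unfolding independent_lower_value_def
    by (rule cSUP_upper2[of _ _ "(x, y)"]) (use xy max in \<open>auto intro!: bdd_aboveI[of _ "guaranteed \<theta> (product_mixture x y)"]\<close>)
  finally show ?thesis using independent_le_correlated[of \<theta>] by (simp add: equilibria_coincide_def)
qed


section \<open>Equilibria\<close>

lemma finite_banker_pure: "finite banker_pure"
  by (simp add: banker_pure_def finite_info_sets)

lemma mixed_payoff_eq:
  assumes "set_pmf \<beta> \<subseteq> banker_pure"
  shows "mixed_payoff \<theta> p \<beta> = (\<Sum>T\<in>banker_pure. pmf \<beta> T * measure_pmf.expectation p (\<lambda>u. payoff \<theta> u T))"
proof -
  have "mixed_payoff \<theta> p \<beta> = (\<Sum>z\<in>UNIV \<times> banker_pure. pmf (pair_pmf p \<beta>) z *\<^sub>R (case z of (u, T) \<Rightarrow> payoff \<theta> u T))"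
    unfolding mixed_payoff_def
    by (rule integral_measure_pmf) (use assms finite_banker_pure in \<open>auto simp: set_pair_pmf\<close>)
  also have "\<dots> = (\<Sum>u\<in>UNIV. \<Sum>T\<in>banker_pure. pmf p u * pmf \<beta> T * payoff \<theta> u T)"
    unfolding sum.cartesian_product' by (simp add: pmf_pair)
  also have "\<dots> = (\<Sum>T\<in>banker_pure. \<Sum>u\<in>UNIV. pmf p u * pmf \<beta> T * payoff \<theta> u T)"
    by (rule sum.swap)
  also have "\<dots> = (\<Sum>T\<in>banker_pure. pmf \<beta> T * measure_pmf.expectation p (\<lambda>u. payoff \<theta> u T))"
  proof (rule sum.cong[OF refl])
    fix T
    have "measure_pmf.expectation p (\<lambda>u. payoff \<theta> u T) = (\<Sum>u\<in>UNIV. pmf p u *\<^sub>R payoff \<theta> u T)"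
      by (rule integral_measure_pmf) auto
    then show "(\<Sum>u\<in>UNIV. pmf p u * pmf \<beta> T * payoff \<theta> u T) = pmf \<beta> T * measure_pmf.expectation p (\<lambda>u. payoff \<theta> u T)"
      by (simp add: sum_distrib_left mult_ac)
  qed
  finally show ?thesis .
qed

lemma sum_pmf_banker: "set_pmf \<beta> \<subseteq> banker_pure \<Longrightarrow> (\<Sum>T\<in>banker_pure. pmf \<beta> T) = 1"
  by (rule sum_pmf_eq_1[OF finite_banker_pure])

lemma guaranteed_le_mixed_payoff:
  assumes "set_pmf \<beta> \<subseteq> banker_pure"
  shows "guaranteed \<theta> p \<le> mixed_payoff \<theta> p \<beta>"
proof -
  have "guaranteed \<theta> p = (\<Sum>T\<in>banker_pure. pmf \<beta> T * guaranteed \<theta> p)"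
    using sum_pmf_banker[OF assms] by (simp add: sum_distrib_right[symmetric])
  also have "\<dots> \<le> mixed_payoff \<theta> p \<beta>"
    unfolding mixed_payoff_eq[OF assms] guaranteed_def
    by (intro sum_mono mult_left_mono Min_le) (auto simp: finite_banker_pure)
  finally show ?thesis .
qed

lemma guaranteed_attained: "\<exists>T\<in>banker_pure. guaranteed \<theta> p = mixed_payoff \<theta> p (return_pmf T)"
proof -
  have "guaranteed \<theta> p \<in> (\<lambda>T. measure_pmf.expectation p (\<lambda>u. payoff \<theta> u T)) ` banker_pure"
    unfolding guaranteed_def by (rule Min_in) (auto simp: banker_pure_def finite_info_sets)
  then obtain T where T: "T \<in> banker_pure" "guaranteed \<theta> p = measure_pmf.expectation p (\<lambda>u. payoff \<theta> u T)" by auto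
  have "mixed_payoff \<theta> p (return_pmf T) = measure_pmf.expectation p (\<lambda>u. payoff \<theta> u T)"
    by (simp add: mixed_payoff_def pair_return_pmf2)
  with T show ?thesis by (intro bexI[of _ T]) auto
qed

lemma correlated_equilibrium_maximizes:
  assumes "correlated_equilibrium \<theta> p \<beta>"
  shows "guaranteed \<theta> p' \<le> guaranteed \<theta> p"
proof -
  have b: "set_pmf \<beta> \<subseteq> banker_pure" using assms by (simp add: correlated_equilibrium_def)
  obtain T where T: "T \<in> banker_pure" "guaranteed \<theta> p = mixed_payoff \<theta> p (return_pmf T)"
    using guaranteed_attained by blast
  have "guaranteed \<theta> p' \<le> mixed_payoff \<theta> p' \<beta>" by (rule guaranteed_le_mixed_payoff[OF b])
  also have "\<dots> \<le> mixed_payoff \<theta> p \<beta>" using assms by (simp add: correlated_equilibrium_def)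
  also have "\<dots> \<le> mixed_payoff \<theta> p (return_pmf T)" using assms T(1) by (simp add: correlated_equilibrium_def)
  finally show ?thesis using T(2) by simp
qed

text \<open>
  The payoff of a mixed strategy of Banker depends only on its drawing probabilities at the single information
  sets, and every choice of them is realized by independent coin tosses.
\<close>

lemma banker_with_marginals:
  assumes s: "\<And>i. s i \<in> {0..1}"
  shows "\<exists>\<beta>. set_pmf \<beta> \<subseteq> banker_pure \<and>
     (\<forall>\<theta> p. mixed_payoff \<theta> p \<beta> = (form_value standing_form \<theta> (1 - \<theta>) (pmf p)
         + (\<Sum>i\<in>info_sets. s i * form_value (info_form i) \<theta> (1 - \<theta>) (pmf p))) / 13 ^ 9)"
proof -
  define D where "D = Pi_pmf info_sets False (\<lambda>i. bernoulli_pmf (s i))"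
  define \<beta> where "\<beta> = map_pmf (\<lambda>f. {i \<in> info_sets. f i}) D"
  have b: "set_pmf \<beta> \<subseteq> banker_pure" by (auto simp: \<beta>_def banker_pure_def)
  have marginal: "(\<Sum>T\<in>banker_pure. pmf \<beta> T * of_bool (i \<in> T)) = s i" if "i \<in> info_sets" for i
  proof -
    have "(\<Sum>T\<in>banker_pure. pmf \<beta> T * of_bool (i \<in> T)) = measure_pmf.expectation \<beta> (\<lambda>T. of_bool (i \<in> T))"
      by (subst integral_measure_pmf[OF finite_banker_pure]) (use b in auto)
    also have "\<dots> = measure_pmf.expectation (map_pmf (\<lambda>f. f i) D) (\<lambda>x. of_bool x)"
      using that by (simp add: \<beta>_def)
    also have "map_pmf (\<lambda>f. f i) D = bernoulli_pmf (s i)"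
      using that finite_info_sets by (simp add: D_def Pi_pmf_component)
    also have "measure_pmf.expectation (bernoulli_pmf (s i)) (\<lambda>x. of_bool x) = s i"
      using s[of i] by (subst integral_bernoulli_pmf) auto
    finally show ?thesis .
  qed
  have "mixed_payoff \<theta> p \<beta> = (form_value standing_form \<theta> (1 - \<theta>) (pmf p)
         + (\<Sum>i\<in>info_sets. s i * form_value (info_form i) \<theta> (1 - \<theta>) (pmf p))) / 13 ^ 9" for \<theta> p
  proof -
    define A where "A = form_value standing_form \<theta> (1 - \<theta>) (pmf p)"
    define g where "g = (\<lambda>i. form_value (info_form i) \<theta> (1 - \<theta>) (pmf p))"
    have "mixed_payoff \<theta> p \<beta> = (\<Sum>T\<in>banker_pure. pmf \<beta> T * ((A + (\<Sum>i\<in>T. g i)) / 13 ^ 9))"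
      unfolding mixed_payoff_eq[OF b] A_def g_def by (intro sum.cong refl) (simp only: expectation_payoff)
    also have "\<dots> = (\<Sum>T\<in>banker_pure. (pmf \<beta> T * A + (\<Sum>i\<in>info_sets. pmf \<beta> T * of_bool (i \<in> T) * g i)) / 13 ^ 9)"
    proof (intro sum.cong refl)
      fix T assume "T \<in> banker_pure"
      then have "(\<Sum>i\<in>info_sets. of_bool (i \<in> T) * g i) = (\<Sum>i\<in>T. g i)"
        by (intro sum.mono_neutral_cong_right) (auto simp: banker_pure_def finite_info_sets)
      then show "pmf \<beta> T * ((A + (\<Sum>i\<in>T. g i)) / 13 ^ 9)
          = (pmf \<beta> T * A + (\<Sum>i\<in>info_sets. pmf \<beta> T * of_bool (i \<in> T) * g i)) / 13 ^ 9"
        by (simp add: distrib_left mult.assoc flip: sum_distrib_left)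
    qed
    also have "\<dots> = ((\<Sum>T\<in>banker_pure. pmf \<beta> T) * A + (\<Sum>i\<in>info_sets. (\<Sum>T\<in>banker_pure. pmf \<beta> T * of_bool (i \<in> T)) * g i)) / 13 ^ 9"
      unfolding sum_divide_distrib[symmetric] sum.distrib sum_distrib_right
      by (subst sum.swap) simp
    also have "\<dots> = (A + (\<Sum>i\<in>info_sets. s i * g i)) / 13 ^ 9"
      by (simp add: sum_pmf_banker[OF b] marginal)
    finally show ?thesis by (simp only: A_def g_def)
  qed
  with b show ?thesis by blast
qed

lemma banker_plays_response:
  assumes "f \<in> responses full_game \<theta> (1 - \<theta>)"
  shows "\<exists>\<beta>. set_pmf \<beta> \<subseteq> banker_pure \<and> (\<forall>p. mixed_payoff \<theta> p \<beta> = f (pmf p) / 13 ^ 9)"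
proof -
  obtain ws where ws: "length ws = length info_list" "set ws \<subseteq> {0..1}"
    and f: "f = (\<lambda>p. form_value standing_form \<theta> (1 - \<theta>) p + (\<Sum>(w, h)\<leftarrow>zip ws (map info_form info_list). w * form_value h \<theta> (1 - \<theta>) p))"
    using assms by (auto simp: full_game_def simp del: form_value.simps)
  define s where "s = (\<lambda>i. case map_of (zip info_list ws) i of None \<Rightarrow> 0 | Some w \<Rightarrow> w)"
  have "s i \<in> {0..1}" for i
    using ws(2) by (auto simp: s_def split: option.splits dest!: map_of_SomeD set_zip_rightD)
  then obtain \<beta> where \<beta>: "set_pmf \<beta> \<subseteq> banker_pure"
    "\<And>p. mixed_payoff \<theta> p \<beta> = (form_value standing_form \<theta> (1 - \<theta>) (pmf p) + (\<Sum>i\<in>info_sets. s i * form_value (info_form i) \<theta> (1 - \<theta>) (pmf p))) / 13 ^ 9"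
    using banker_with_marginals[of s] by blast
  have "map s info_list = ws"
    using ws(1) distinct_info_list by (intro nth_equalityI) (auto simp: s_def map_of_zip_nth)
  moreover have "zip (map s xs) (map info_form xs) = map (\<lambda>i. (s i, info_form i)) xs" for xs
    by (induction xs) auto
  ultimately have "zip ws (map info_form info_list) = map (\<lambda>i. (s i, info_form i)) info_list" by metis
  with \<beta> show ?thesis by (intro exI[of _ \<beta>]) (simp add: f sum_info_sets o_def del: form_value.simps)
qed

lemma equilibrium_exists:
  assumes "f \<in> responses full_game \<theta> (1 - \<theta>)"
    and "\<And>p. f (pmf p) \<le> c" "c \<le> worth full_game \<theta> (1 - \<theta>) (pmf P)"
  shows "\<exists>\<beta>. correlated_equilibrium \<theta> P \<beta>"
proof -
  obtain \<beta> where \<beta>: "set_pmf \<beta> \<subseteq> banker_pure" "\<And>p. mixed_payoff \<theta> p \<beta> = f (pmf p) / 13 ^ 9"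
    using banker_plays_response[OF assms(1)] by blast
  have fP: "f (pmf P) = c"
    using worth_le_response[OF assms(1), of "pmf P"] assms(2)[of P] assms(3) by simp
  have "mixed_payoff \<theta> P \<beta> \<le> mixed_payoff \<theta> P \<beta>'" if "set_pmf \<beta>' \<subseteq> banker_pure" for \<beta>'
  proof -
    have "mixed_payoff \<theta> P \<beta> \<le> guaranteed \<theta> P"
      using assms(3) by (simp add: \<beta>(2) fP guaranteed_eq divide_right_mono)
    also have "\<dots> \<le> mixed_payoff \<theta> P \<beta>'" by (rule guaranteed_le_mixed_payoff[OF that])
    finally show ?thesis .
  qed
  then have "correlated_equilibrium \<theta> P \<beta>"
    unfolding correlated_equilibrium_def using \<beta>(1) assms(2) by (auto simp: \<beta>(2) fP intro!: divide_right_mono)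
  then show ?thesis by blast
qed

section \<open>Ranges of the parameter without coincidence\<close>

lemma between_combination:
  fixes s t s' t' :: int and \<theta> :: real
  defines "fa \<equiv> of_int s / of_int (s + t) :: real" and "fb \<equiv> of_int s' / of_int (s' + t')"
  assumes "s + t > 0" "s' + t' > 0" "fa < fb" "fa \<le> \<theta>" "\<theta> \<le> fb"
  obtains \<alpha> \<beta> where "0 \<le> \<alpha>" "0 \<le> \<beta>" "\<theta> = \<alpha> * of_int s + \<beta> * of_int s'"
    "1 - \<theta> = \<alpha> * of_int t + \<beta> * of_int t'"
proof -
  define Da Db where "Da = real_of_int (s + t)" and "Db = real_of_int (s' + t')"
  have D: "Da > 0" "Db > 0" using assms by (simp_all add: Da_def Db_def)
  define x where "x = (\<theta> - fa) / (fb - fa)"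
  have x: "0 \<le> x" "x \<le> 1" "\<theta> = (1 - x) * fa + x * fb"
  proof -
    have "x * (fb - fa) = \<theta> - fa" using assms(5) by (simp add: x_def)
    then show "\<theta> = (1 - x) * fa + x * fb" by (simp add: algebra_simps)
  qed (use assms(5-7) in \<open>simp_all add: x_def divide_le_eq\<close>)
  have f: "of_int s = Da * fa" "of_int s' = Db * fb"
    "of_int t = Da * (1 - fa)" "of_int t' = Db * (1 - fb)"
    using D by (simp_all add: fa_def fb_def Da_def Db_def field_simps)
  have cancel: "z / Da * (Da * y) = z * y" "z / Db * (Db * y) = z * y" for z y
    using D by simp_all
  show thesis
  proof (rule that[of "(1 - x) / Da" "x / Db"])
    show "\<theta> = (1 - x) / Da * of_int s + x / Db * of_int s'"
      unfolding f cancel by (rule x(3))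
    show "1 - \<theta> = (1 - x) / Da * of_int t + x / Db * of_int t'"
      unfolding f cancel x(3) by (simp add: algebra_simps)
  qed (use x D in auto)
qed

fun mass :: "quad \<Rightarrow> int" where
  "mass (a, b, c, d) = a + b + c + d"

fun nonneg_quad :: "quad \<Rightarrow> bool" where
  "nonneg_quad (a, b, c, d) \<longleftrightarrow> 0 \<le> a \<and> 0 \<le> b \<and> 0 \<le> c \<and> 0 \<le> d"

text \<open>The settled game is an argument of its own, so that it is normalized once before it is used several times.\<close>

fun separates_in :: "quad \<Rightarrow> quad \<Rightarrow> int \<Rightarrow> int \<Rightarrow> plan \<Rightarrow> game \<Rightarrow> bool" where
  "separates_in p q m n P G = refutes m n (mass p) (curve_bound p q G) G 0 m 0 n P"

fun separates :: "point \<Rightarrow> point \<Rightarrow> quad \<Rightarrow> quad \<Rightarrow> int \<Rightarrow> int \<Rightarrow> plan \<Rightarrow> bool" where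
  "separates (s, t) (s', t') p q m n P \<longleftrightarrow>
     0 < s + t \<and> s + t = s' + t' \<and> nonneg_quad p \<and> nonneg_quad q \<and> 0 < mass p \<and> mass p = mass q \<and> 0 < m \<and> 0 < n \<and>
     separates_in p q m n P (settle (1, 0) (0, 1) pure_pairs (rebase (s, t) (s', t') core_game))"

lemma nonneg_mix: "nonneg_quad q \<Longrightarrow> 0 \<le> mix q u"
  by (cases q; cases u) auto

lemma sum_mix: "mix q (False, False) + mix q (False, True) + mix q (True, False) + mix q (True, True) = of_int (mass q)"
  by (cases q) simp

lemma separates_not_coincide:
  assumes S: "separates (s, t) (s', t') p q m n P"
    and \<tau>: "0 < \<tau>" "\<tau> \<le> 1" and \<theta>: "\<theta> * of_int (s + t) = (1 - \<tau>) * of_int s + \<tau> * of_int s'" "0 \<le> \<theta>" "\<theta> \<le> 1/2"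
  shows "\<not> equilibria_coincide \<theta>"
proof (rule not_coincide[OF \<theta>(2,3)])
  define D where "D = real_of_int (s + t)"
  define M where "M = real_of_int (mass p)"
  define c where "c = (\<lambda>u. (1 - \<tau>) * mix p u + \<tau> * mix q u)"
  define G where "G = settle (1, 0) (0, 1) pure_pairs (rebase (s, t) (s', t') core_game)"
  have wf: "nonneg_quad p" "nonneg_quad q" "mass p = mass q" "s + t = s' + t'" and pos: "D > 0" "M > 0" "m > 0" "n > 0" "mass p > 0"
    and r: "refutes m n (mass p) (curve_bound p q G) G 0 m 0 n P"
    using S by (auto simp: D_def M_def G_def)
  show "0 \<le> c u / M" for u
    using nonneg_mix[OF wf(1), of u] nonneg_mix[OF wf(2), of u] \<tau> pos by (simp add: c_def)
  have "c (False, False) + c (False, True) + c (True, False) + c (True, True)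
      = (1 - \<tau>) * (mix p (False, False) + mix p (False, True) + mix p (True, False) + mix p (True, True))
        + \<tau> * (mix q (False, False) + mix q (False, True) + mix q (True, False) + mix q (True, True))"
    by (simp add: c_def algebra_simps)
  also have "\<dots> = M" unfolding sum_mix wf(3)[symmetric] M_def by (simp add: algebra_simps)
  finally show "c (False, False) / M + c (False, True) / M + c (True, False) / M + c (True, True) / M = 1"
    using pos by (simp flip: add_divide_distrib)
  have t: "real_of_int t' = D - of_int s'" "real_of_int t = D - of_int s"
    using arg_cong[OF wf(4), of real_of_int] by (simp_all add: D_def)
  have D: "D * \<theta> = (1 - \<tau>) * of_int s + \<tau> * of_int s'"
    using \<theta>(1) unfolding D_def by (simp only: mult.commute)
  then have D': "D * (1 - \<theta>) = (1 - \<tau>) * of_int t + \<tau> * of_int t'"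
    unfolding t by (simp add: algebra_simps)
  have G: "worth G (1 - \<tau>) \<tau> p' = D * worth core_game \<theta> (1 - \<theta>) p'" if "\<And>u. 0 \<le> p' u" for p'
  proof -
    have "worth G (1 - \<tau>) \<tau> p' = worth (rebase (s, t) (s', t') core_game) (1 - \<tau>) \<tau> p'"
      unfolding G_def by (rule worth_settle[where \<alpha>="1 - \<tau>" and \<beta>=\<tau>]) (use that \<tau> in \<open>auto intro: nonneg_in_conic_span\<close>)
    also have "\<dots> = worth core_game (D * \<theta>) (D * (1 - \<theta>)) p'" unfolding worth_rebase D D' by simp
    finally show ?thesis using pos by (simp add: worth_scale)
  qed
  fix x y :: real assume xy: "x \<in> {0..1}" "y \<in> {0..1}"
  have "M * worth G (1 - \<tau>) \<tau> (product_at x y) < quadratic (curve_bound p q G) (1 - \<tau>) \<tau>"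
    unfolding M_def by (rule refutes[OF r pos(3,4,5)]) (use \<tau> xy pos in auto)
  also have "\<dots> \<le> worth G (1 - \<tau>) \<tau> c" unfolding c_def by (rule curve_bound) (use \<tau> in auto)
  finally have "M * (D * worth core_game \<theta> (1 - \<theta>) (product_at x y)) < D * worth core_game \<theta> (1 - \<theta>) c"
    using G[of "product_at x y"] G[of c] xy product_at_nonneg \<open>\<And>u. 0 \<le> c u / M\<close> pos by (simp add: zero_le_divide_iff)
  then have "D * (M * worth core_game \<theta> (1 - \<theta>) (product_at x y)) < D * worth core_game \<theta> (1 - \<theta>) c"
    by (simp only: mult.left_commute)
  then have "M * worth core_game \<theta> (1 - \<theta>) (product_at x y) < worth core_game \<theta> (1 - \<theta>) c"
    using pos by (simp only: mult_less_cancel_left_pos)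
  moreover have "worth core_game \<theta> (1 - \<theta>) (\<lambda>u. c u / M) = worth core_game \<theta> (1 - \<theta>) c / M"
    using worth_scale(2)[of "1 / M" core_game \<theta> "1 - \<theta>" c] pos by simp
  ultimately show "worth core_game \<theta> (1 - \<theta>) (product_at x y) < worth core_game \<theta> (1 - \<theta>) (\<lambda>u. c u / M)"
    using pos by (simp add: less_divide_eq mult.commute)
qed

lemma separates_between:
  assumes S: "separates (s, t) (s', t') p q m n P"
    and ab: "a = of_int s / of_int (s + t)" "b = of_int s' / of_int (s + t)" "a \<noteq> b"
    and "a < \<theta> \<and> \<theta> \<le> b \<or> b \<le> \<theta> \<and> \<theta> < a" "0 \<le> \<theta>" "\<theta> \<le> 1/2"
  shows "\<not> equilibria_coincide \<theta>"
proof -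
  define D where "D = real_of_int (s + t)"
  have D: "D > 0" using S by (auto simp: D_def)
  define \<tau> where "\<tau> = (\<theta> - a) / (b - a)"
  have \<tau>: "0 < \<tau>" "\<tau> \<le> 1"
    using assms(4,5) by (auto simp: \<tau>_def divide_le_eq zero_less_divide_iff)
  have "\<tau> * (b - a) = \<theta> - a" using assms(4) by (simp add: \<tau>_def)
  then have \<theta>: "\<theta> = (1 - \<tau>) * a + \<tau> * b" by (simp add: algebra_simps)
  have "of_int s = D * a" "of_int s' = D * b" using D unfolding D_def ab by simp_all
  then have "\<theta> * D = (1 - \<tau>) * of_int s + \<tau> * of_int s'" by (simp add: \<theta> algebra_simps)
  then show ?thesis
    unfolding D_def using \<tau> assms(6,7) by (intro separates_not_coincide[OF S])
qed

text \<open>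
  The certificates. The first two pairs are the ends of the range of \<open>(\<theta>, 1 - \<theta>)\<close> up to scale, and the two
  quads are the ends of the segment of mixtures, which approximate the optimal mixtures there. The denominators
  of the cuts follow; a cut at \<open>9/11\<close> follows a kink that involves one Player only. The list of a
  response gives Banker's drawing probabilities at those kinks that are undecided on the range. Ranges 1, 8,
  9, 15 and 16 start at the values \<open>0\<close>, \<open>5621/33696\<close>, \<open>9588/37663\<close> and \<open>55716/128711\<close>, where the gap
  is zero; ranges 8 and 15 run downwards.
\<close>

lemma gap_1: "separates (0, 1000) (19, 981) (20, 90, 0, 0) (18, 91, 1, 0) 110 110
  (Cut2 90
    (Respond 1 [0,1,1,1,0,0,1,1,0,1,0,0,0,1,1,0,1,0,0,1,1,0,1,0,0,1,1,0,1,0,0,0,1,0,1,0,0,1,0,1,1,0,1,1,1,0,1,1,0,0,1,1,1,0,0,0,1,1,0,1,0,0,0,1,1,0])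
    (Respond 70 [0,70,70,70,0,0,70,70,0,70,0,0,0,70,70,0,70,0,0,70,70,0,70,0,0,70,70,0,70,0,0,0,70,0,70,70,0,70,0,70,70,0,70,70,70,0,70,70,70,0,70,70,70,47,0,0,70,70,0,70,0,0,0,70,70,70]))"
  by code_simp

lemma gap_2: "separates (19, 981) (28, 972) (181, 910, 9, 0) (158, 909, 33, 0) 110 110
  (Cut2 91
    (Respond 1 [0,1,1,0,1,0,0,1,0,0,1,0,0,0,1,0,0,1,0,0,1,1,1,1,0,0,1,1,1,1,0,0,0,1,0,1,0,0,0,1,1,0,1,1,1,0,1,1,1,0,1,1,1,0,0,1,1,1,1,0,0,0,1,1,1])
    (Respond 7 [0,7,7,0,7,0,0,7,0,0,7,0,0,0,7,0,0,7,0,0,7,3,7,7,0,0,7,7,7,7,0,0,0,7,7,7,7,0,0,7,7,0,7,7,7,0,7,7,7,0,7,7,7,1,0,7,7,7,7,0,0,0,7,7,7]))"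
  by code_simp

lemma gap_3: "separates (28, 972) (45, 955) (158, 909, 33, 0) (135, 914, 51, 0) 110 110
  (Cut2 90
    (Respond 1 [0,0,0,0,1,0,0,0,0,0,1,0,0,0,1,0,0,1,0,0,1,0,1,1,0,1,1,1,1,1,0,0,1,1,1,1,0,0,0,1,1,0,0,1,1,0,1,1,1,0,1,1,1,0,0,1,1,1,1,0,0,0,1,1,0])
    (Respond 1 [0,0,0,0,1,0,0,0,0,0,1,0,0,0,1,0,1,1,0,0,1,0,1,1,0,1,1,0,1,1,0,0,1,1,1,1,1,0,0,1,1,0,0,1,1,0,1,1,1,1,1,1,1,0,0,1,1,1,1,0,0,0,1,1,1]))"
  by code_simp

lemma gap_4: "separates (9, 191) (16, 184) (14, 91, 5, 0) (9, 93, 8, 0) 110 110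
  (Cut2 93
    (Respond 10 [0,0,10,0,10,0,0,0,0,10,10,10,0,0,0,0,0,10,10,10,0,0,10,0,10,10,10,0,10,10,0,10,10,0,10,10,10,10,10,2,10,10,10,10,0,0,10,10,0,10,10,10,10,0,0,0,10,0,0,10,1,10,0,10,0,0,0,10,10,10])
    (Respond 3 [0,0,3,0,3,0,0,0,0,3,3,3,0,0,0,0,0,3,3,3,0,3,3,0,3,3,3,0,3,3,0,3,3,0,3,3,0,3,3,2,3,3,3,3,0,0,3,3,0,3,3,3,3,0,0,0,3,0,0,3,0,3,0,3,0,0,0,3,3,3]))"
  by code_simp

lemma gap_5: "separates (8, 92) (13, 87) (27, 278, 25, 0) (10, 283, 37, 0) 110 110
  (Cut2 95
    (Cut2 90
    (Respond 1 [1,0,1,1,1,1,0,0,0,1,0,1,1,0,0,0,0,1,0,1,1,0,1,0,0,1,1,1,0,1,1,0,1,1,0,1,0,1,1,0,1,0,1,0,1,1,1,1,0,1,1,1,1,1,1,0,0,1,1,0,1,0,0,0,1,0,1,1,0,0,1,0,0,0,1,1,0])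
    (Respond 5 [5,0,5,3,5,5,0,0,0,5,0,5,5,0,0,0,0,5,0,5,5,0,5,0,0,5,5,5,0,5,5,0,5,5,0,5,0,5,5,0,5,0,5,0,5,5,5,5,5,4,5,5,5,5,5,5,0,5,5,0,5,0,0,0,5,0,5,5,0,0,5,0,0,0,5,5,5]))
    (Respond 2 [2,0,2,1,2,2,0,0,0,2,0,2,2,0,0,0,0,2,0,2,2,0,2,0,0,0,2,2,0,2,2,0,2,2,0,2,0,2,2,0,2,0,2,2,2,2,2,2,2,2,2,2,2,2,2,2,0,2,2,0,2,0,0,0,2,0,2,2,0,0,2,0,0,0,2,2,2]))"
  by code_simp

lemma gap_6: "separates (26, 174) (31, 169) (3, 94, 13, 0) (0, 58, 19, 33) 110 110
  (Cut2 94
    (Respond 6 [6,6,0,0,6,6,0,0,0,0,6,6,0,0,6,6,0,6,0,6,0,0,0,0,6,6,0,0,0,0,6,6,0,0,6,0,6,6,0,0,6,6,6,6,6,6,0,0,6,2,6,0,6,6,6,0,6,0,0,1,6,0,0,6,0,0,0,0,0,6,6,6])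
    (Respond 6 [6,6,0,0,6,6,0,0,0,0,6,6,0,0,6,6,0,6,0,6,0,0,0,0,6,6,0,0,0,0,6,6,0,0,6,0,6,6,0,0,6,6,6,6,6,6,0,0,6,5,6,0,6,0,0,0,6,0,0,1,6,0,0,6,0,0,0,0,0,6,6,6]))"
  by code_simp

lemma gap_7: "separates (31, 169) (32, 168) (0, 58, 19, 33) (1, 42, 19, 48) 110 110
  (Cut2 91
    (Respond 50 [50,50,0,0,50,50,0,0,0,0,50,50,0,0,50,0,50,0,50,0,0,50,50,0,0,0,0,50,0,50,0,0,0,50,50,0,0,50,50,50,50,50,50,0,0,50,0,50,0,50,32,32,0,50,0,50,27,50,0,0,50,0,0,0,0,0,50,50,50])
    (Respond 7 [7,7,0,0,7,7,0,0,0,0,7,7,0,4,7,0,7,0,7,0,0,7,7,0,0,0,0,7,0,7,0,0,0,7,7,0,0,7,7,7,7,7,7,0,0,7,0,7,0,7,0,0,0,7,0,6,4,7,0,0,7,0,0,0,0,0,7,7,7]))"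
  by code_simp

lemma gap_8: "separates (140525, 701875) (134784, 707616) (1566, 7047, 3272, 14724) (155, 10271, 4632, 11551) 2419 11
  (Cut2 9
    (Cut1 1636
    (Respond 3 [3,3,0,0,3,3,0,0,0,0,3,3,0,3,3,0,3,0,3,0,0,3,3,0,0,0,0,3,0,3,0,0,0,3,3,0,0,3,3,0,3,3,3,0,0,3,0,3,0,3,0,0,0,3,0,3,2,3,0,0,3,0,0,0,0,0,3,3,0])
    (Respond 1 [1,1,0,0,1,1,0,0,0,0,1,1,0,1,1,0,1,0,1,0,0,1,1,0,0,0,0,1,0,1,0,0,0,1,1,0,0,1,1,0,1,1,1,0,0,1,0,1,0,1,0,0,0,1,0,1,0,1,0,1,1,0,0,0,0,0,1,1,0]))
    (Cut1 1636
    (Respond 3 [3,3,0,0,3,3,0,0,0,0,3,3,0,3,3,0,3,0,3,0,0,3,3,0,0,0,0,3,0,3,0,0,0,3,3,0,0,3,3,0,3,3,3,0,0,3,0,3,0,3,0,0,0,3,0,3,2,3,0,0,3,0,0,0,0,0,3,3,3])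
    (Respond 5 [5,5,0,0,5,5,0,0,0,0,5,5,0,5,5,0,5,0,5,0,0,5,5,0,0,0,0,5,0,5,0,0,0,5,5,0,0,5,5,0,5,5,5,0,0,5,0,5,0,5,0,0,0,5,0,5,3,5,0,0,5,0,0,0,0,0,5,5,5])))"
  by code_simp

lemma gap_9: "separates (5621, 28075) (5997, 27699) (1566, 7047, 3272, 14724) (4838, 4643, 0, 17128) 2419 11
  (Cut2 9
    (Cut1 1636
    (Respond 1 [1,1,0,0,1,1,0,0,0,0,1,1,0,1,1,0,1,0,0,1,1,0,0,0,0,1,0,1,0,1,0,0,1,1,0,0,1,1,0,1,1,1,0,0,1,0,1,0,1,0,0,0,1,0,1,1,1,0,0,1,0,0,0,0,0,1,1,0])
    (Respond 3 [3,3,0,0,3,3,0,0,0,0,3,3,0,3,3,0,3,0,0,3,3,0,0,0,0,3,0,3,0,3,0,0,3,3,0,0,3,3,0,3,3,3,0,0,3,0,3,0,3,0,0,0,3,0,3,3,3,0,2,3,0,0,0,0,0,3,3,0]))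
    (Cut1 1636
    (Respond 1 [1,1,0,0,1,1,0,0,0,0,1,1,0,1,1,0,1,0,0,1,1,0,0,0,0,1,0,1,0,1,0,0,1,1,0,0,1,1,0,1,1,1,0,0,1,0,1,0,1,0,0,0,1,0,1,1,1,0,0,1,0,0,0,0,0,1,1,1])
    (Respond 3 [3,3,0,0,3,3,0,0,0,0,3,3,0,3,3,0,3,0,0,3,3,0,0,0,0,3,0,3,0,3,0,0,3,3,0,0,3,3,0,3,3,3,0,0,3,0,3,0,3,0,0,0,3,0,3,3,3,0,2,3,0,0,0,0,0,3,3,3])))"
  by code_simp

lemma gap_10: "separates (7, 33) (8, 32) (20, 20, 0, 70) (20, 17, 0, 73) 110 110
  (Cut1 77
    (Respond 400 [400,400,0,0,400,400,0,0,0,0,400,400,0,400,264,0,400,0,0,0,400,400,0,0,0,400,0,400,0,400,0,0,0,400,400,0,0,400,400,400,400,400,400,0,0,400,0,400,0,400,0,0,0,400,0,400,400,400,0,400,400,0,0,0,0,400,400,335])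
    (Respond 15 [15,15,0,0,15,15,0,0,0,0,15,15,0,15,15,0,15,0,0,0,15,15,0,0,0,15,0,15,0,15,0,0,0,15,15,0,0,15,15,15,15,15,15,0,0,15,0,15,0,15,0,0,0,15,0,15,15,15,11,15,15,0,0,0,0,15,15,13]))"
  by code_simp

lemma gap_11: "separates (400, 1600) (431, 1569) (200, 169, 0, 731) (61, 252, 139, 648) 110 110
  (Cut1 78
    (Respond 1000 [1000,1000,0,0,1000,1000,0,0,1000,0,1000,0,0,1000,1000,0,0,0,1000,1000,0,0,0,1000,0,1000,0,1000,0,0,0,1000,0,0,0,1000,1000,1000,1000,1000,1000,1000,0,1000,1000,1000,1000,0,1000,613,0,0,1000,1000,0,1000,1000,1000,0,1000,1000,0,0,0,0,1000,1000,832])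
    (Cut2 90
    (Respond 12 [12,12,0,0,12,12,0,0,12,0,12,0,0,12,12,0,0,0,12,12,0,0,0,12,0,12,0,12,0,0,0,12,0,0,0,12,12,12,12,12,12,12,0,12,12,12,12,0,12,0,0,0,12,12,0,12,12,12,11,12,12,0,0,0,0,12,12,0])
    (Respond 15 [15,15,0,0,15,15,0,0,15,0,15,0,0,15,15,0,0,0,15,15,0,0,0,15,0,15,0,15,0,0,0,15,0,0,0,15,15,15,15,15,15,15,0,15,15,15,15,0,15,0,0,0,15,15,0,15,15,15,14,15,15,0,0,0,0,15,15,13])))"
  by code_simp

lemma gap_12: "separates (1079, 3921) (1090, 3910) (523, 2579, 1477, 6421) (83, 2870, 1917, 6130) 110 110
  (Cut1 79
    (Respond 1000 [1000,1000,0,0,1000,1000,0,0,1000,0,1000,0,0,1000,1000,0,0,0,1000,1000,0,0,0,1000,1000,0,1000,0,0,0,1000,0,0,0,1000,1000,1000,1000,1000,1000,1000,0,1000,1000,1000,1000,0,1000,0,0,0,1000,1000,0,1000,1000,1000,1000,1000,0,0,0,0,1000,1000,782])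
    (Cut1 90
    (Cut2 90
    (Respond 15 [15,15,0,0,15,15,0,0,15,0,15,0,0,15,15,0,0,0,15,15,0,0,0,15,14,0,15,0,0,0,15,0,0,0,15,15,15,15,15,15,15,0,15,15,15,15,0,15,0,0,0,15,15,0,15,15,15,15,15,2,0,0,0,15,15,0])
    (Respond 15 [15,15,0,0,15,15,0,0,15,0,15,0,0,15,15,0,0,0,15,15,0,0,0,15,14,0,15,0,0,0,15,0,0,0,15,15,15,15,15,15,15,0,15,15,15,15,0,15,0,0,0,15,15,0,15,15,15,15,15,2,0,0,0,15,15,12]))
    (Respond 7 [7,7,0,0,7,7,0,0,7,0,7,0,0,7,7,0,0,0,7,7,0,0,0,7,0,0,7,0,0,0,7,0,0,0,7,7,7,7,7,7,7,0,7,7,7,7,0,7,0,0,0,7,7,0,7,7,7,7,7,7,3,0,0,7,7,3])))"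
  by code_simp

lemma gap_13: "separates (109, 391) (114, 386) (1, 29, 19, 61) (1, 28, 19, 62) 110 110
  (Cut1 80
    (Respond 100 [100,100,0,0,100,100,0,0,100,0,100,0,0,100,100,0,0,0,100,100,0,0,0,100,100,0,100,0,0,0,0,100,0,0,0,100,100,100,100,100,100,100,0,100,100,100,100,0,100,0,0,0,100,100,0,100,100,100,47,100,100,0,0,0,0,100,100,81])
    (Respond 400 [400,400,0,0,400,400,0,0,400,0,400,0,0,400,400,0,0,0,400,400,0,0,0,400,400,0,400,0,0,0,0,400,0,0,0,400,400,400,400,400,400,400,0,400,400,400,400,0,400,0,0,0,400,400,0,400,400,400,400,400,400,0,3,0,0,400,400,327]))"
  by code_simp

lemma gap_14: "separates (228, 772) (235, 765) (1, 28, 19, 62) (1, 28, 19, 62) 110 110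
  (Cut1 80
    (Respond 70 [70,70,0,0,70,70,0,0,70,0,70,0,70,70,0,0,0,70,70,0,0,0,70,70,0,70,17,0,0,0,70,0,0,0,70,70,70,70,70,70,70,0,70,70,70,70,0,70,0,0,0,70,70,0,70,70,70,44,70,70,0,0,0,0,70,70,57])
    (Respond 200 [200,200,0,0,200,200,0,0,200,0,200,0,200,200,0,0,0,200,200,0,0,0,200,200,0,200,87,0,0,0,200,0,0,0,200,200,200,200,200,200,200,0,200,200,200,200,0,200,0,0,0,200,200,0,200,200,200,200,200,200,0,3,0,0,200,200,162]))"
  by code_simp

lemma gap_15: "separates (1917600, 5615000) (1770161, 5762439) (40, 180, 180, 810) (9, 306, 211, 684) 121 121
  (Cut1 90
    (Respond 150 [150,150,0,150,150,0,150,0,150,0,150,0,150,150,0,0,150,150,0,0,0,150,150,0,0,150,0,0,0,150,0,0,0,150,150,150,150,150,150,150,0,150,150,150,150,0,150,0,0,0,150,150,0,150,150,0,150,123,150,150,0,0,0,0,150,150,112])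
    (Cut2 99
    (Cut1 99
    (Respond 1 [1,1,0,1,1,0,1,0,1,0,1,0,1,1,0,0,1,1,0,0,0,1,1,0,0,1,0,0,0,1,0,0,0,1,1,1,1,1,1,1,0,1,1,1,1,0,1,0,0,0,1,1,0,1,1,0,1,1,1,1,0,0,0,0,1,1,0])
    (Respond 1 [1,1,0,1,1,0,1,0,1,0,1,0,1,1,0,0,1,1,0,0,0,1,1,0,0,1,0,0,0,1,0,0,0,1,1,1,1,1,1,1,0,1,1,1,1,0,1,0,0,0,1,1,0,1,1,0,1,1,1,1,0,0,1,0,1,1,0]))
    (Cut1 99
    (Respond 1 [1,1,0,1,1,0,1,0,1,0,1,0,1,1,0,0,1,1,0,0,0,1,1,0,0,1,0,0,0,1,0,0,0,1,1,1,1,1,1,1,0,1,1,1,1,0,1,0,0,0,1,1,0,1,1,0,1,1,1,1,0,0,0,0,1,1,1])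
    (Respond 1 [1,1,0,1,1,0,1,0,1,0,1,0,1,1,0,0,1,1,0,0,0,1,1,0,0,1,0,0,0,1,0,0,0,1,1,1,1,1,1,1,0,1,1,1,1,0,1,0,0,0,1,1,0,1,1,0,1,1,1,1,0,1,1,0,1,1,1]))))"
  by code_simp

lemma gap_16: "separates (55716, 72995) (55850, 72861) (400, 1800, 1800, 8100) (331, 1959, 1869, 7941) 121 121
  (Cut1 90
    (Respond 4 [0,4,0,0,4,0,4,0,0,4,4,0,4,4,4,0,4,0,4,4,4,0,4,4,4,0,0,0,4,0,4,0,4,0,0,0,4,4,0,0,4,0,0,0,4,0,4,0,4,4,4,4,4,0,4,4,0,4,0,4,0,0,0,4,4,1])
    (Cut2 99
    (Cut1 99
    (Respond 400 [400,400,0,0,400,0,400,0,400,400,400,0,400,400,400,0,400,0,400,400,400,0,400,400,400,0,0,0,400,0,400,0,400,0,0,0,400,400,0,0,400,0,0,0,400,0,400,0,0,400,400,400,400,161,400,400,400,400,0,400,0,0,0,400,400,0])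
    (Respond 1 [1,1,0,0,1,0,1,0,1,1,1,0,1,1,1,0,1,0,1,1,1,0,1,1,1,0,0,0,1,0,1,0,1,0,0,0,1,1,0,0,1,0,0,0,1,0,1,0,0,1,1,1,1,1,1,1,1,1,0,1,0,1,0,1,1,0]))
    (Cut1 99
    (Respond 1000 [1000,1000,0,0,1000,0,1000,0,1000,1000,1000,0,1000,1000,1000,0,1000,0,1000,1000,1000,0,1000,1000,1000,0,0,0,1000,0,1000,0,1000,0,0,0,1000,1000,0,0,1000,0,0,0,1000,0,1000,0,0,1000,1000,1000,1000,404,1000,1000,1000,1000,0,1000,0,0,0,1000,1000,208])
    (Respond 1 [1,1,0,0,1,0,1,0,1,1,1,0,1,1,1,0,1,0,1,1,1,0,1,1,1,0,0,0,1,0,1,0,1,0,0,0,1,1,0,0,1,0,0,0,1,0,1,0,0,1,1,1,1,1,1,1,1,1,0,1,1,1,0,1,1,1]))))"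
  by code_simp

lemma gap_17: "separates (433, 567) (437, 563) (36, 165, 164, 735) (11, 221, 189, 679) 110 110
  (Cut1 90
    (Cut2 90
    (Cut1 88
    (Respond 2 [0,2,0,0,2,0,2,0,2,2,2,0,2,2,2,0,2,0,2,2,2,0,2,2,2,0,0,0,2,0,2,0,2,0,0,0,2,2,0,0,2,0,0,0,2,0,2,0,0,2,2,2,2,1,2,2,2,2,0,2,0,0,0,2,2,0])
    (Respond 100 [47,100,0,0,100,0,100,0,100,100,100,0,100,100,100,0,100,0,100,100,100,0,100,100,100,0,0,0,100,0,100,0,100,0,0,0,100,100,0,0,100,0,0,0,100,0,100,0,0,100,100,100,100,47,100,100,100,100,0,100,0,0,0,100,100,0]))
    (Cut1 87
    (Respond 2 [0,2,0,0,2,0,2,0,2,2,2,0,2,2,2,0,2,0,2,2,2,0,2,2,2,0,0,0,2,0,2,0,2,0,0,0,2,2,0,0,2,0,0,0,2,0,2,0,0,2,2,2,2,1,2,2,2,2,0,2,0,0,0,2,2,1])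
    (Respond 100 [47,100,0,0,100,0,100,0,100,100,100,0,100,100,100,0,100,0,100,100,100,0,100,100,100,0,0,0,100,0,100,0,100,0,0,0,100,100,0,0,100,0,0,0,100,0,100,0,0,100,100,100,100,47,100,100,100,100,0,100,0,0,0,100,100,47])))
    (Respond 1000 [1000,1000,0,0,1000,0,1000,0,1000,1000,1000,0,1000,1000,1000,0,1000,0,1000,1000,1000,0,1000,1000,1000,0,0,0,1000,0,1000,0,1000,0,0,0,1000,1000,0,0,1000,0,0,0,1000,0,1000,0,0,1000,1000,1000,1000,1000,1000,1000,1000,1000,0,1000,69,0,0,1000,1000,69]))"
  by code_simp

lemma gap_18: "separates (437, 563) (448, 552) (11, 221, 189, 679) (0, 246, 200, 654) 110 110
  (Cut1 90
    (Cut2 90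
    (Respond 1 [0,1,0,0,1,1,0,1,0,0,1,1,0,1,1,1,0,1,0,1,1,1,0,1,1,0,0,0,1,0,1,0,1,0,0,0,1,1,0,0,1,0,0,0,1,0,1,0,0,1,1,1,1,1,1,1,0,1,0,1,0,0,0,1,1,0])
    (Respond 1 [0,1,0,0,1,1,0,1,0,0,1,1,0,1,1,1,0,1,0,1,1,1,0,1,1,0,0,0,1,0,1,0,1,0,0,0,1,1,0,0,1,0,0,0,1,0,1,0,0,1,1,1,1,1,1,1,0,1,0,1,0,0,0,1,1,1]))
    (Respond 15 [0,15,0,0,15,15,0,15,0,15,15,15,0,15,15,15,0,15,0,15,15,15,0,15,15,0,0,0,15,0,15,0,15,0,0,0,15,15,0,0,15,0,0,0,15,0,15,0,0,15,15,15,15,15,15,15,15,15,0,15,1,0,0,15,15,1]))"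
  by code_simp

lemma gap_19: "separates (224, 276) (235, 265) (0, 25, 20, 65) (0, 23, 21, 66) 110 110
  (Cut1 87
    (Cut2 90
    (Respond 1 [0,1,1,0,0,1,1,0,1,0,0,1,1,0,1,1,1,0,1,0,1,1,0,1,0,1,1,0,1,0,1,0,1,0,0,0,1,1,0,0,1,0,0,0,1,0,1,0,0,1,1,1,1,1,1,1,0,1,0,1,0,0,0,1,1,0])
    (Respond 1 [0,1,1,0,0,1,1,0,1,0,0,1,1,0,1,1,1,0,1,0,1,1,0,1,0,1,1,0,1,0,1,0,1,0,0,0,1,1,0,0,1,0,0,0,1,0,1,0,0,1,1,1,1,1,1,1,0,1,0,1,0,0,0,1,1,1]))
    (Cut2 90
    (Respond 1 [0,1,1,0,0,1,1,0,1,0,0,1,1,0,1,1,1,0,1,0,1,1,0,1,0,1,1,0,1,0,1,0,1,0,0,0,1,1,0,0,1,0,0,0,1,0,1,0,0,1,1,1,1,1,1,1,1,1,0,1,0,0,0,1,1,0])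
    (Respond 5 [0,5,5,0,0,5,5,0,5,0,0,5,5,0,5,5,5,0,5,0,5,5,0,5,0,5,5,0,5,0,5,0,5,0,0,0,5,5,0,0,5,0,0,0,5,0,5,0,0,5,5,5,5,5,5,5,5,5,0,5,0,0,0,5,5,1])))"
  by code_simp

lemma gap_20: "separates (47, 53) (50, 50) (0, 23, 21, 66) (0, 22, 22, 66) 110 110
  (Cut1 87
    (Cut2 87
    (Respond 2 [0,2,2,0,2,2,0,2,0,2,2,0,0,2,2,2,0,2,0,0,2,2,0,2,0,2,2,0,1,0,2,0,2,0,0,0,2,2,0,0,2,0,0,0,2,0,2,0,2,0,2,2,2,2,2,2,1,2,0,2,0,0,0,2,2,0])
    (Respond 15 [0,15,15,0,15,15,0,15,0,15,15,0,0,15,15,15,0,15,0,0,15,15,0,15,0,15,15,0,15,0,15,0,15,0,0,0,15,15,0,0,15,0,0,0,15,0,15,0,15,0,15,15,15,15,15,15,7,15,0,15,0,0,0,15,15,1]))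
    (Cut2 87
    (Respond 8 [0,8,8,0,8,8,0,8,0,8,8,0,0,8,8,8,0,8,0,0,8,8,0,8,0,8,8,0,7,0,8,0,8,0,0,0,8,8,0,0,8,0,0,0,8,0,7,0,8,0,8,8,8,8,8,8,8,8,0,8,0,0,0,8,8,0])
    (Respond 10 [0,10,10,0,10,10,0,10,0,10,10,0,0,10,10,10,0,10,0,0,10,10,0,10,0,10,10,0,10,0,10,0,10,0,0,0,10,10,0,0,10,0,0,0,10,0,10,0,10,0,10,10,10,10,10,10,10,10,0,10,0,0,0,10,10,1])))"
  by code_simp



section \<open>Optima certified by a balanced response\<close>

lemma response_attains: "\<exists>f\<in>responses G s t. f p = worth G s t p"
proof -
  obtain l hs where G: "G = (l, hs)" by (rule prod.exhaust)
  define ws where "ws = map (\<lambda>h. of_bool (form_value h s t p < 0) :: real) hs"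
  have "(\<Sum>(w, h)\<leftarrow>zip ws hs. w * form_value h s t p) = (\<Sum>h\<leftarrow>hs. min 0 (form_value h s t p))"
    unfolding ws_def by (induction hs) (auto simp del: form_value.simps)
  moreover have "length ws = length hs" "set ws \<subseteq> {0..1}" by (auto simp: ws_def)
  ultimately show ?thesis
    by (intro bexI[of _ "\<lambda>p. form_value l s t p + (\<Sum>(w, h)\<leftarrow>zip ws hs. w * form_value h s t p)"]) (auto simp: G simp del: form_value.simps)
qed

lemma worth_le_worth_settle: "worth G s t p \<le> worth (settle a b P G) s t p"
  using response_attains[of "settle a b P G" s t p] worth_le_response[OF responses_settle] by metis

definition total_weight :: "(bool \<times> bool \<Rightarrow> real) \<Rightarrow> real" where
  "total_weight p = p (False, False) + p (False, True) + p (True, False) + p (True, True)"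

lemma total_weight_pmf: "total_weight (pmf p) = 1"
  using expectation_bool_pair[of p "\<lambda>_. 1"] by (simp add: total_weight_def)

lemma total_weight_product_at: "total_weight (product_at x y) = 1"
  by (simp add: total_weight_def algebra_simps)

text \<open>
  A response that is constant in \<open>p\<close> bounds the value. If its weights are strictly between 0 and 1, a mixture
  reaches the bound only where all three kinks vanish, for otherwise \<open>min 0 h < w h\<close> for one of them.
\<close>

lemma three_kinks_optimum:
  assumes le: "\<And>p. worth G s t p \<le> worth (l, [h1, h2, h3]) s t p"
    and w: "w1 \<in> {0..1}" "w2 \<in> {0..1}" "w3 \<in> {0..1::real}"
    and const: "\<And>p. total_weight p = 1 \<Longrightarrow> form_value l s t p + (w1 * form_value h1 s t p + w2 * form_value h2 s t p + w3 * form_value h3 s t p) = c"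
  shows "total_weight p = 1 \<Longrightarrow> worth G s t p \<le> c"
    and "total_weight p = 1 \<Longrightarrow> worth G s t p = c \<Longrightarrow> w1 \<in> {0<..<1} \<Longrightarrow> w2 \<in> {0<..<1} \<Longrightarrow> w3 \<in> {0<..<1} \<Longrightarrow>
       form_value h1 s t p = 0 \<and> form_value h2 s t p = 0 \<and> form_value h3 s t p = 0"
proof -
  have slack: "min 0 x \<le> w * x" if "w \<in> {0..1}" for w x :: real
    using that mult_right_mono_neg[of w 1 x] by (cases "x \<ge> 0") (auto simp: min_def)
  have strict: "min 0 x < w * x" if "w \<in> {0<..<1}" "x \<noteq> 0" for w x :: real
    using that mult_strict_right_mono_neg[of w 1 x] by (cases "x > 0") (auto simp: min_def)
  have split: "worth (l, [h1, h2, h3]) s t p = form_value l s t p + (min 0 (form_value h1 s t p) + min 0 (form_value h2 s t p) + min 0 (form_value h3 s t p))"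
    by (simp del: form_value.simps)
  show "worth G s t p \<le> c" if "total_weight p = 1"
    using le[of p] const[OF that] slack[OF w(1), of "form_value h1 s t p"] slack[OF w(2), of "form_value h2 s t p"] slack[OF w(3), of "form_value h3 s t p"]
    unfolding split by linarith
  assume that: "total_weight p = 1" "worth G s t p = c" and w': "w1 \<in> {0<..<1}" "w2 \<in> {0<..<1}" "w3 \<in> {0<..<1}"
  show "form_value h1 s t p = 0 \<and> form_value h2 s t p = 0 \<and> form_value h3 s t p = 0"
    using le[of p] const[OF that(1)] that(2) slack[OF w(1), of "form_value h1 s t p"] slack[OF w(2), of "form_value h2 s t p"] slack[OF w(3), of "form_value h3 s t p"]
      strict[OF w'(1), of "form_value h1 s t p"] strict[OF w'(2), of "form_value h2 s t p"] strict[OF w'(3), of "form_value h3 s t p"]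
    unfolding split by linarith
qed

section \<open>The plateau\<close>

fun linear_pos :: "point \<Rightarrow> point \<Rightarrow> int \<times> int \<Rightarrow> bool" where
  "linear_pos (s, t) (s', t') (x, y) \<longleftrightarrow> 0 < x * s + y * t \<and> 0 < x * s' + y * t'"

text \<open>The three numbers are the Bernstein coefficients of the quadratic form on the range.\<close>

fun quadratic_pos :: "point \<Rightarrow> point \<Rightarrow> triple \<Rightarrow> bool" where
  "quadratic_pos (s, t) (s', t') (x, y, z) \<longleftrightarrow>
     0 < x * s * s + y * s * t + z * t * t \<and> 0 < x * s' * s' + y * s' * t' + z * t' * t' \<and>
     0 \<le> 2 * x * s * s' + y * (s * t' + t * s') + 2 * z * t * t'"

lemma linear_pos:
  fixes \<alpha> \<beta> s t :: real
  assumes "linear_pos a b (x, y)" "0 \<le> \<alpha>" "0 \<le> \<beta>" "0 < \<alpha> + \<beta>"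
    and "s = \<alpha> * of_int (fst a) + \<beta> * of_int (fst b)" "t = \<alpha> * of_int (snd a) + \<beta> * of_int (snd b)"
  shows "0 < of_int x * s + of_int y * t"
proof -
  obtain a1 a2 b1 b2 where ab: "a = (a1, a2)" "b = (b1, b2)" by (metis prod.exhaust)
  define A B where "A = real_of_int (x * a1 + y * a2)" and "B = real_of_int (x * b1 + y * b2)"
  have "0 < A" "0 < B" using assms(1) unfolding A_def B_def ab of_int_0_less_iff by simp_all
  then have "0 < \<alpha> * A + \<beta> * B" using assms(2-4)
    by (metis add_0 add_nonneg_pos add_pos_nonneg less_eq_real_def mult_nonneg_nonneg mult_pos_pos)
  also have "\<dots> = of_int x * s + of_int y * t"
    unfolding assms(5,6) A_def B_def ab by (simp add: algebra_simps)
  finally show ?thesis .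
qed

lemma quadratic_pos:
  fixes \<alpha> \<beta> s t :: real
  assumes "quadratic_pos a b (x, y, z)" "0 \<le> \<alpha>" "0 \<le> \<beta>" "0 < \<alpha> + \<beta>"
    and "s = \<alpha> * of_int (fst a) + \<beta> * of_int (fst b)" "t = \<alpha> * of_int (snd a) + \<beta> * of_int (snd b)"
  shows "0 < of_int x * s\<^sup>2 + of_int y * (s * t) + of_int z * t\<^sup>2"
proof -
  obtain a1 a2 b1 b2 where ab: "a = (a1, a2)" "b = (b1, b2)" by (metis prod.exhaust)
  define A where "A = real_of_int (x * a1 * a1 + y * a1 * a2 + z * a2 * a2)"
  define B where "B = real_of_int (x * b1 * b1 + y * b1 * b2 + z * b2 * b2)"
  define C where "C = real_of_int (2 * x * a1 * b1 + y * (a1 * b2 + a2 * b1) + 2 * z * a2 * b2)"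
  have pos: "0 < A" "0 < B" "0 \<le> C"
    using assms(1) unfolding A_def B_def C_def ab of_int_0_less_iff of_int_0_le_iff by simp_all
  have "\<alpha> > 0 \<or> \<beta> > 0" using assms(2-4) by linarith
  then have "0 < \<alpha>\<^sup>2 * A + \<beta>\<^sup>2 * B"
    using pos(1,2) by (auto intro: add_pos_nonneg add_nonneg_pos)
  then have "0 < \<alpha>\<^sup>2 * A + \<beta>\<^sup>2 * B + \<alpha> * \<beta> * C" using pos(3) assms(2,3) by (simp add: add_pos_nonneg)
  also have "\<dots> = of_int x * s\<^sup>2 + of_int y * (s * t) + of_int z * t\<^sup>2"
    unfolding assms(5,6) A_def B_def C_def ab by (simp add: power2_eq_square algebra_simps)
  finally show ?thesis .
qed

definition star_mix :: quad where "star_mix = (4, 18, 18, 81)"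

definition kink_unit :: int where "kink_unit = 692224"

text \<open>
  The information sets \<open>(10, 10, 6)\<close>, \<open>(10, 11, 6)\<close> and \<open>(11, 10, 6)\<close>. The latter two involve one
  Player only, because the bet on a natural is already won: they vanish where that Player draws on 5 with
  probability 9/11. Given this, the first one fixes the correlation.
\<close>

definition star_kinks :: "form list" where
  "star_kinks = [((27 * kink_unit, 18 * kink_unit, - 6 * kink_unit, - 4 * kink_unit), (27 * kink_unit, - 6 * kink_unit, 18 * kink_unit, - 4 * kink_unit)),
     ((18 * kink_unit, 18 * kink_unit, - 4 * kink_unit, - 4 * kink_unit), (0, 0, 0, 0)),
     ((0, 0, 0, 0), (18 * kink_unit, - 4 * kink_unit, 18 * kink_unit, - 4 * kink_unit))]"

text \<open>
  Let \<open>I\<close> be the interaction \<open>l\<^sub>0\<^sub>0 - l\<^sub>0\<^sub>1 - l\<^sub>1\<^sub>0 + l\<^sub>1\<^sub>1\<close> of the linear part and \<open>X\<close>, \<open>Y\<close> its increments in the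
  first and in the second strategy; all three are linear in \<open>(\<theta>, 1 - \<theta>)\<close>, with coefficients \<open>i, i'\<close>,
  \<open>x, x'\<close> and \<open>y, y'\<close>. Only the first kink has an interaction, so its weight must cancel \<open>I\<close>; the other two
  weights then cancel what is left of \<open>X\<close> and \<open>Y\<close>. Each of the three weights is a quotient of a linear or
  quadratic form by a positive one, and the conditions say that all of them are strictly between 0 and 1.
\<close>

fun balances :: "point \<Rightarrow> point \<Rightarrow> int \<Rightarrow> int \<Rightarrow> int \<Rightarrow> int \<Rightarrow> int \<Rightarrow> int \<Rightarrow> bool" where
  "balances a b i i' x x' y y' \<longleftrightarrow>
     linear_pos a b (- i, - i') \<and> linear_pos a b (11 * kink_unit + i, 11 * kink_unit + i') \<and>
     quadratic_pos a b (11 * x + 33 * i, 11 * x + 11 * x' + 9 * i + 33 * i', 11 * x' + 9 * i') \<and>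
     quadratic_pos a b (242 * kink_unit - (11 * x + 33 * i), 242 * kink_unit - (11 * x + 11 * x' + 9 * i + 33 * i'), - (11 * x' + 9 * i')) \<and>
     quadratic_pos a b (11 * y + 9 * i, 11 * y + 11 * y' + 33 * i + 9 * i', 11 * y' + 33 * i') \<and>
     quadratic_pos a b (- (11 * y + 9 * i), 242 * kink_unit - (11 * y + 11 * y' + 33 * i + 9 * i'), 242 * kink_unit - (11 * y' + 33 * i'))"

fun balanced_at_star :: "point \<Rightarrow> point \<Rightarrow> game \<Rightarrow> bool" where
  "balanced_at_star a b (((l1, l2, l3, l4), (l1', l2', l3', l4')), hs) \<longleftrightarrow> hs = star_kinks \<and>
     balances a b (l1 - l2 - l3 + l4) (l1' - l2' - l3' + l4') (l3 - l1) (l3' - l1') (l2 - l1) (l2' - l1')"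

fun steps_balanced :: "game \<Rightarrow> point list \<Rightarrow> bool" where
  "steps_balanced G ((s, t) # (s', t') # ps) \<longleftrightarrow> 0 < s + t \<and> 0 < s' + t' \<and> s * (s' + t') < s' * (s + t) \<and>
     balanced_at_star (s, t) (s', t') (settle (s, t) (s', t') [star_mix] G) \<and> steps_balanced G ((s', t') # ps)"
| "steps_balanced G ps \<longleftrightarrow> True"

lemma steps_balanced_between:
  fixes \<theta> :: real
  assumes "steps_balanced G ((s, t) # ps)" "ps \<noteq> []" "of_int s / of_int (s + t) \<le> \<theta>"
    "\<theta> \<le> of_int (fst (last ps)) / of_int (fst (last ps) + snd (last ps))"
  obtains a b \<alpha> \<beta> where "balanced_at_star a b (settle a b [star_mix] G)" "0 \<le> \<alpha>" "0 \<le> \<beta>"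
    "\<theta> = \<alpha> * of_int (fst a) + \<beta> * of_int (fst b)" "1 - \<theta> = \<alpha> * of_int (snd a) + \<beta> * of_int (snd b)"
  using assms
proof (induction ps arbitrary: s t thesis)
  case (Cons q ps)
  obtain s' t' where q: "q = (s', t')" by (rule prod.exhaust)
  have st: "0 < s + t" "0 < s' + t'" "s * (s' + t') < s' * (s + t)"
      "balanced_at_star (s, t) (s', t') (settle (s, t) (s', t') [star_mix] G)" "steps_balanced G ((s', t') # ps)"
    using Cons.prems(2) by (auto simp: q)
  show ?case
  proof (cases "\<theta> \<le> of_int s' / of_int (s' + t')")
    case True
    have "of_int (s * (s' + t')) < (of_int (s' * (s + t)) :: real)" using st(3) by (simp only: of_int_less_iff)
    then have "of_int s / of_int (s + t) < (of_int s' / of_int (s' + t') :: real)"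
      using st(1,2) by (simp add: divide_less_eq less_divide_eq field_simps)
    from between_combination[OF st(1,2) this Cons.prems(4) True] obtain \<alpha> \<beta> where
      "0 \<le> \<alpha>" "0 \<le> \<beta>" "\<theta> = \<alpha> * of_int s + \<beta> * of_int s'" "1 - \<theta> = \<alpha> * of_int t + \<beta> * of_int t'" .
    then show ?thesis using Cons.prems(1)[OF st(4)] by simp
  next
    case False
    then have "ps \<noteq> []" using Cons.prems(5) by (auto simp: q)
    then show ?thesis using Cons.IH[OF Cons.prems(1) st(5)] False Cons.prems(5) by auto
  qed
qed simp

text \<open>
  The kinks left are those whose value at \<open>(4, 18, 18, 81)/121\<close> changes sign on the interval, and the three that
  are zero there for all \<open>\<theta>\<close>. The former do so at one value of \<open>\<theta>\<close> each; between two consecutive such values,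
  the points of \<open>steps_balanced\<close>, the form of Banker's strategy is fixed.
\<close>

definition near_game :: game where
  "near_game = settle (9588, 28075) (55716, 72995) [star_mix] core_game"

lemma steps_balanced: "steps_balanced near_game
  [(9588, 28075), (1591, 4643), (1141, 2901), (5796, 14599), (655, 1591), (655, 1443), (65, 141),
   (2397, 5147), (1141, 2397), (481, 967),
   (2397, 4643), (1591, 2901), (655, 1141), (44268, 72995), (37, 61), (799, 1279), (2901, 4643), (46044, 72995), (141, 217),
   (1591, 2397), (1591, 2379), (1105, 1591), (967, 1279), (55716, 72995)]"
  by code_simp

lemma balanced_at_star_optimum:
  assumes B: "balanced_at_star a b (l, hs)" and ab: "0 \<le> \<alpha>" "0 \<le> \<beta>"
    and \<theta>: "\<theta> = \<alpha> * of_int (fst a) + \<beta> * of_int (fst b)" "1 - \<theta> = \<alpha> * of_int (snd a) + \<beta> * of_int (snd b)"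
    and "0 < \<theta>" "\<theta> < 1"
  shows "\<exists>w1\<in>{0<..<1}. \<exists>w2\<in>{0<..<1}. \<exists>w3\<in>{0<..<1}. \<exists>c. \<forall>p. total_weight p = 1 \<longrightarrow>
     form_value l \<theta> (1 - \<theta>) p + (w1 * form_value (star_kinks ! 0) \<theta> (1 - \<theta>) p + w2 * form_value (star_kinks ! 1) \<theta> (1 - \<theta>) p
        + w3 * form_value (star_kinks ! 2) \<theta> (1 - \<theta>) p) = c"
proof -
  obtain l1 l2 l3 l4 l1' l2' l3' l4' where l: "l = ((l1, l2, l3, l4), (l1', l2', l3', l4'))" by (cases l) auto
  define t where "t = 1 - \<theta>"
  have t: "0 < t" "\<theta> + t = 1" using assms by (simp_all add: t_def)
  define K where "K = real_of_int kink_unit"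
  have K: "K > 0" by (simp add: K_def kink_unit_def)
  have "\<alpha> \<noteq> 0 \<or> \<beta> \<noteq> 0" using \<theta>(1) \<open>0 < \<theta>\<close> by auto
  then have ab': "0 < \<alpha> + \<beta>" using ab by linarith
  define i i' x x' y y' where "i = l1 - l2 - l3 + l4" and "i' = l1' - l2' - l3' + l4'"
    and "x = l3 - l1" and "x' = l3' - l1'" and "y = l2 - l1" and "y' = l2' - l1'"
  have B: "balances a b i i' x x' y y'"
    using B by (simp add: l i_def i'_def x_def x'_def y_def y'_def)
  define I X Y where "I = of_int i * \<theta> + of_int i' * t" and "X = of_int x * \<theta> + of_int x' * t"
    and "Y = of_int y * \<theta> + of_int y' * t"
  define E1 E2 where "E1 = 11 * X + I * (33 * \<theta> + 9 * t)" and "E2 = 11 * Y + I * (9 * \<theta> + 33 * t)"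
  note lin = linear_pos[OF _ ab ab' \<theta>(1) \<theta>(2)[folded t_def]]
  note quad = quadratic_pos[OF _ ab ab' \<theta>(1) \<theta>(2)[folded t_def]]
  have I: "I < 0" "0 < 11 * K + I"
  proof -
    show "I < 0" using lin[of "- i" "- i'"] B by (simp add: I_def)
    have "0 < 11 * K * (\<theta> + t) + I" using lin[of "11 * kink_unit + i" "11 * kink_unit + i'"] B
      by (simp add: I_def K_def algebra_simps)
    then show "0 < 11 * K + I" unfolding t by simp
  qed
  have "0 < 11 * X * (\<theta> + t) + I * (33 * \<theta> + 9 * t)"
      "0 < 242 * K * \<theta> * (\<theta> + t) - (11 * X * (\<theta> + t) + I * (33 * \<theta> + 9 * t))"
    using quad[of "11 * x + 33 * i" "11 * x + 11 * x' + 9 * i + 33 * i'" "11 * x' + 9 * i'"]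
      quad[of "242 * kink_unit - (11 * x + 33 * i)" "242 * kink_unit - (11 * x + 11 * x' + 9 * i + 33 * i')" "- (11 * x' + 9 * i')"] B
    by (simp_all add: I_def X_def K_def power2_eq_square algebra_simps)
  then have E1: "0 < E1" "0 < 242 * K * \<theta> - E1" unfolding t E1_def by simp_all
  have "0 < 11 * Y * (\<theta> + t) + I * (9 * \<theta> + 33 * t)"
      "0 < 242 * K * t * (\<theta> + t) - (11 * Y * (\<theta> + t) + I * (9 * \<theta> + 33 * t))"
    using quad[of "11 * y + 9 * i" "11 * y + 11 * y' + 33 * i + 9 * i'" "11 * y' + 33 * i'"]
      quad[of "- (11 * y + 9 * i)" "242 * kink_unit - (11 * y + 11 * y' + 33 * i + 9 * i')" "242 * kink_unit - (11 * y' + 33 * i')"] B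
    by (simp_all add: I_def Y_def K_def power2_eq_square algebra_simps)
  then have E2: "0 < E2" "0 < 242 * K * t - E2" unfolding t E2_def by simp_all
  define w1 w2 w3 where "w1 = - I / (11 * K)" and "w2 = E1 / (242 * K * \<theta>)" and "w3 = E2 / (242 * K * t)"
  have w: "w1 \<in> {0<..<1}" "w2 \<in> {0<..<1}" "w3 \<in> {0<..<1}"
  proof -
    have frac: "n / d \<in> {0<..<1}" if "0 < n" "n < d" for n d :: real
      using that by simp
    show "w1 \<in> {0<..<1}" "w2 \<in> {0<..<1}" "w3 \<in> {0<..<1}"
      unfolding w1_def w2_def w3_def by (rule frac; use I E1 E2 in linarith)+
  qed
  have W: "w1 * K = - I / 11" "w2 * K * \<theta> = E1 / 242" "w3 * K * t = E2 / 242"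
    using K t \<open>0 < \<theta>\<close> by (simp_all add: w1_def w2_def w3_def)
  define L where "L = (\<lambda>n n'. of_int n * \<theta> + of_int n' * t)"
  have C: "L l2 l2' = L l1 l1' + Y" "L l3 l3' = L l1 l1' + X" "L l4 l4' = L l1 l1' + X + Y + I"
    by (simp_all add: L_def X_def Y_def I_def i_def i'_def x_def x'_def y_def y'_def algebra_simps)
  define c where "c = L l1 l1' + 27 * (w1 * K) + 18 * (w2 * K * \<theta>) + 18 * (w3 * K * t)"
  have t': "t = 1 - \<theta>" using t by simp
  have coeff: "L l1 l1' + (27 * \<theta> + 27 * t) * (w1 * K) + 18 * (w2 * K * \<theta>) + 18 * (w3 * K * t) = c"
    "L l2 l2' + (18 * \<theta> - 6 * t) * (w1 * K) + 18 * (w2 * K * \<theta>) - 4 * (w3 * K * t) = c"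
    "L l3 l3' + (- 6 * \<theta> + 18 * t) * (w1 * K) - 4 * (w2 * K * \<theta>) + 18 * (w3 * K * t) = c"
    "L l4 l4' + (- 4 * \<theta> - 4 * t) * (w1 * K) - 4 * (w2 * K * \<theta>) - 4 * (w3 * K * t) = c"
    unfolding c_def C W E1_def E2_def unfolding t' by (simp_all add: field_simps)
  have "form_value l \<theta> (1 - \<theta>) p + (w1 * form_value (star_kinks ! 0) \<theta> (1 - \<theta>) p + w2 * form_value (star_kinks ! 1) \<theta> (1 - \<theta>) p
        + w3 * form_value (star_kinks ! 2) \<theta> (1 - \<theta>) p) = c" if "total_weight p = 1" for p
  proof -
    have "form_value l \<theta> (1 - \<theta>) p + (w1 * form_value (star_kinks ! 0) \<theta> (1 - \<theta>) p + w2 * form_value (star_kinks ! 1) \<theta> (1 - \<theta>) p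
        + w3 * form_value (star_kinks ! 2) \<theta> (1 - \<theta>) p)
      = (L l1 l1' + (27 * \<theta> + 27 * t) * (w1 * K) + 18 * (w2 * K * \<theta>) + 18 * (w3 * K * t)) * p (False, False)
      + (L l2 l2' + (18 * \<theta> - 6 * t) * (w1 * K) + 18 * (w2 * K * \<theta>) - 4 * (w3 * K * t)) * p (False, True)
      + (L l3 l3' + (- 6 * \<theta> + 18 * t) * (w1 * K) - 4 * (w2 * K * \<theta>) + 18 * (w3 * K * t)) * p (True, False)
      + (L l4 l4' + (- 4 * \<theta> - 4 * t) * (w1 * K) - 4 * (w2 * K * \<theta>) - 4 * (w3 * K * t)) * p (True, True)"
      unfolding l star_kinks_def t_def[symmetric] by (simp add: L_def K_def algebra_simps)
    also have "\<dots> = c * total_weight p" unfolding coeff total_weight_def by (simp only: distrib_left)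
    finally show ?thesis using that by simp
  qed
  then show ?thesis using w by blast
qed

lemma star_kinks_zero_iff:
  assumes "total_weight p = 1" "0 < \<theta>" "\<theta> < 1"
  shows "(\<forall>h\<in>set star_kinks. form_value h \<theta> (1 - \<theta>) p = 0) \<longleftrightarrow> p = product_at (9/11) (9/11)"
proof
  assume z: "\<forall>h\<in>set star_kinks. form_value h \<theta> (1 - \<theta>) p = 0"
  define a b c d where "a = p (False, False)" and "b = p (False, True)" and "c = p (True, False)" and "d = p (True, True)"
  have "\<theta> * (18 * a + 18 * b - 4 * c - 4 * d) = 0" "(1 - \<theta>) * (18 * a - 4 * b + 18 * c - 4 * d) = 0"
    and third: "27 * a + (18 * \<theta> - 6 * (1 - \<theta>)) * b + (18 * (1 - \<theta>) - 6 * \<theta>) * c - 4 * d = 0"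
    using z by (simp_all add: star_kinks_def kink_unit_def a_def b_def c_def d_def algebra_simps)
  then have *: "18 * a + 18 * b - 4 * c - 4 * d = 0" "18 * a - 4 * b + 18 * c - 4 * d = 0" using assms by auto
  have tot: "a + b + c + d = 1" using assms(1) by (simp add: total_weight_def a_def b_def c_def d_def)
  have bc: "b = 9/11 - d" "c = 9/11 - d" "a = d - 7/11" using * tot by auto
  have d: "d = 81/121" using third unfolding bc by (simp add: algebra_simps)
  show "p = product_at (9/11) (9/11)"
  proof
    fix u show "p u = product_at (9/11) (9/11) u"
      using bc d by (cases u) (auto simp: a_def b_def c_def d_def)
  qed
next
  assume "p = product_at (9/11) (9/11)"
  then show "\<forall>h\<in>set star_kinks. form_value h \<theta> (1 - \<theta>) p = 0"
    by (simp add: star_kinks_def)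
qed

lemma star_in_span: "product_at (9/11) (9/11) \<in> conic_span [star_mix]"
proof -
  have "(\<lambda>u. 1 / 121 * mix star_mix u + 1 * 0) \<in> conic_span [star_mix]" by (intro cone_add cone_zero) auto
  also have "(\<lambda>u. 1 / 121 * mix star_mix u + 1 * 0) = product_at (9/11) (9/11)"
    by (auto simp: fun_eq_iff star_mix_def)
  finally show ?thesis .
qed

lemma plateau:
  assumes "9588 / 37663 \<le> \<theta>" "\<theta> \<le> 55716 / 128711"
  obtains f c where "f \<in> responses core_game \<theta> (1 - \<theta>)" "\<And>p. total_weight p = 1 \<Longrightarrow> f p = c"
    "worth core_game \<theta> (1 - \<theta>) (product_at (9/11) (9/11)) = c"
    "\<And>p. total_weight p = 1 \<Longrightarrow> worth core_game \<theta> (1 - \<theta>) p = c \<Longrightarrow> p = product_at (9/11) (9/11)"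
proof -
  have \<theta>: "0 < \<theta>" "\<theta> < 1" using assms by simp_all
  define P where "P = product_at (9/11) (9/11)"
  obtain \<alpha> \<beta> where near: "0 \<le> \<alpha>" "0 \<le> \<beta>" "\<theta> = \<alpha> * of_int 9588 + \<beta> * of_int 55716" "1 - \<theta> = \<alpha> * of_int 28075 + \<beta> * of_int 72995"
    by (rule between_combination[of 9588 28075 55716 72995 \<theta>]) (use assms in auto)
  obtain a b \<alpha>' \<beta>' where step: "balanced_at_star a b (settle a b [star_mix] near_game)" "0 \<le> \<alpha>'" "0 \<le> \<beta>'"
    "\<theta> = \<alpha>' * of_int (fst a) + \<beta>' * of_int (fst b)" "1 - \<theta> = \<alpha>' * of_int (snd a) + \<beta>' * of_int (snd b)"
    by (rule steps_balanced_between[OF steps_balanced, of \<theta>]) (use assms in auto)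
  obtain l hs where G: "settle a b [star_mix] near_game = (l, hs)" by (rule prod.exhaust)
  have hs: "hs = star_kinks" using step(1) unfolding G by (cases l) auto
  then have hs3: "hs = [star_kinks ! 0, star_kinks ! 1, star_kinks ! 2]" by (simp add: star_kinks_def)
  obtain w1 w2 w3 c where w: "w1 \<in> {0<..<1}" "w2 \<in> {0<..<1}" "w3 \<in> {0<..<1}"
    and const: "\<And>p. total_weight p = 1 \<Longrightarrow> form_value l \<theta> (1 - \<theta>) p + (w1 * form_value (star_kinks ! 0) \<theta> (1 - \<theta>) p
      + w2 * form_value (star_kinks ! 1) \<theta> (1 - \<theta>) p + w3 * form_value (star_kinks ! 2) \<theta> (1 - \<theta>) p) = c"
    using balanced_at_star_optimum[OF step(1)[unfolded G] step(2-5) \<theta>] by blast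
  have le: "worth core_game \<theta> (1 - \<theta>) p \<le> worth (l, hs) \<theta> (1 - \<theta>) p" for p
    using worth_le_worth_settle[of core_game \<theta> "1 - \<theta>" p "(9588, 28075)" "(55716, 72995)" "[star_mix]"]
      worth_le_worth_settle[of near_game \<theta> "1 - \<theta>" p a b "[star_mix]"] unfolding near_game_def[symmetric] G by linarith
  note opt = three_kinks_optimum[OF le[unfolded hs3], of w1 w2 w3 c, OF _ _ _ const]
  have zero: "form_value h \<theta> (1 - \<theta>) P = 0" if "h \<in> set hs" for h
    using star_kinks_zero_iff[of P \<theta>] \<theta> that by (auto simp: P_def total_weight_product_at hs simp del: form_value.simps)
  have P: "worth core_game \<theta> (1 - \<theta>) P = c"
  proof -
    have "worth core_game \<theta> (1 - \<theta>) P = worth near_game \<theta> (1 - \<theta>) P"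
      unfolding near_game_def P_def
      by (rule worth_settle[symmetric, OF star_in_span near(1,2)]) (use near in auto)
    also have "\<dots> = worth (l, hs) \<theta> (1 - \<theta>) P"
      unfolding G[symmetric] P_def by (rule worth_settle[symmetric, OF star_in_span step(2-5)])
    also have "\<dots> = c"
      using const[of P] zero unfolding hs3 by (simp add: P_def total_weight_product_at del: form_value.simps)
    finally show ?thesis .
  qed
  show thesis
  proof (rule that)
    show "(\<lambda>p. form_value l \<theta> (1 - \<theta>) p + (\<Sum>(w, h)\<leftarrow>zip [w1, w2, w3] hs. w * form_value h \<theta> (1 - \<theta>) p)) \<in> responses core_game \<theta> (1 - \<theta>)"
    proof (rule responses_settle[of _ "(9588, 28075)" "(55716, 72995)" "[star_mix]"], unfold near_game_def[symmetric],
        rule responses_settle[of _ a b "[star_mix]"], unfold G responses.simps)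
      show "(\<lambda>p. form_value l \<theta> (1 - \<theta>) p + (\<Sum>(w, h)\<leftarrow>zip [w1, w2, w3] hs. w * form_value h \<theta> (1 - \<theta>) p))
        \<in> {f. \<exists>ws. length ws = length hs \<and> set ws \<subseteq> {0..1} \<and> f = (\<lambda>p. form_value l \<theta> (1 - \<theta>) p + (\<Sum>(w, h)\<leftarrow>zip ws hs. w * form_value h \<theta> (1 - \<theta>) p))}"
        using w by (auto simp: hs3 simp del: form_value.simps intro!: exI[of _ "[w1, w2, w3]"])
    qed
    show "form_value l \<theta> (1 - \<theta>) p + (\<Sum>(w, h)\<leftarrow>zip [w1, w2, w3] hs. w * form_value h \<theta> (1 - \<theta>) p) = c" if "total_weight p = 1" for p
      using const[OF that] by (simp add: hs3 del: form_value.simps)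
    show "worth core_game \<theta> (1 - \<theta>) (product_at (9/11) (9/11)) = c" using P by (simp add: P_def)
    fix p assume p: "total_weight p = 1" "worth core_game \<theta> (1 - \<theta>) p = c"
    have "form_value (star_kinks ! 0) \<theta> (1 - \<theta>) p = 0 \<and> form_value (star_kinks ! 1) \<theta> (1 - \<theta>) p = 0 \<and> form_value (star_kinks ! 2) \<theta> (1 - \<theta>) p = 0"
      using opt(2)[OF _ _ _ _ p w] w by auto
    moreover have "set star_kinks = {star_kinks ! 0, star_kinks ! 1, star_kinks ! 2}"
      by (simp add: star_kinks_def)
    ultimately have "\<forall>h\<in>set star_kinks. form_value h \<theta> (1 - \<theta>) p = 0"
      by (simp del: form_value.simps)
    then show "p = product_at (9/11) (9/11)" using star_kinks_zero_iff[OF p(1) \<theta>] by blast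
  qed
qed

lemma plateau_coincide:
  assumes "9588 / 37663 \<le> \<theta>" "\<theta> \<le> 55716 / 128711"
  shows "equilibria_coincide \<theta>"
proof -
  obtain f c where f: "f \<in> responses core_game \<theta> (1 - \<theta>)" "\<And>p. total_weight p = 1 \<Longrightarrow> f p = c"
    "worth core_game \<theta> (1 - \<theta>) (product_at (9/11) (9/11)) = c" using plateau[OF assms] by metis
  have "worth core_game \<theta> (1 - \<theta>) (pmf p) \<le> c" for p
    using worth_le_response[OF f(1), of "pmf p"] f(2)[OF total_weight_pmf[of p]] by simp
  then show ?thesis
    by (intro coincide[of \<theta> "9/11" "9/11"]) (use assms in \<open>simp_all add: f(3)\<close>)
qed

lemma plateau_equilibria:
  assumes "9588 / 37663 \<le> \<theta>" "\<theta> \<le> 55716 / 128711"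
  shows "\<exists>p \<beta>. correlated_equilibrium \<theta> p \<beta>"
    and "correlated_equilibrium \<theta> p \<beta> \<Longrightarrow> pmf p = product_at (9/11) (9/11)"
proof -
  have \<theta>: "0 \<le> \<theta>" "\<theta> \<le> 1/2" using assms by simp_all
  obtain f c where f: "f \<in> responses core_game \<theta> (1 - \<theta>)" "\<And>p. total_weight p = 1 \<Longrightarrow> f p = c"
    "worth core_game \<theta> (1 - \<theta>) (product_at (9/11) (9/11)) = c"
    "\<And>p. total_weight p = 1 \<Longrightarrow> worth core_game \<theta> (1 - \<theta>) p = c \<Longrightarrow> p = product_at (9/11) (9/11)" using plateau[OF assms] by metis
  define P where "P = product_mixture (9/11) (9/11)"
  have P: "pmf P = product_at (9/11) (9/11)" by (simp add: P_def pmf_product_mixture)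
  have full: "worth full_game \<theta> (1 - \<theta>) (pmf q) = worth core_game \<theta> (1 - \<theta>) (pmf q)" for q
    by (rule worth_full_game[OF \<theta>]) simp
  have "f \<in> responses full_game \<theta> (1 - \<theta>)"
    using f(1) responses_settle unfolding settle_full_game[symmetric] by blast
  then show "\<exists>p \<beta>. correlated_equilibrium \<theta> p \<beta>"
    using equilibrium_exists[of f \<theta> c P] f(2)[OF total_weight_pmf] f(3) full[of P] P by auto
  assume "correlated_equilibrium \<theta> p \<beta>"
  then have "guaranteed \<theta> P \<le> guaranteed \<theta> p" by (rule correlated_equilibrium_maximizes)
  then have "c \<le> worth core_game \<theta> (1 - \<theta>) (pmf p)"
    unfolding guaranteed_eq full unfolding P f(3) by (simp add: divide_le_cancel)
  moreover have "worth core_game \<theta> (1 - \<theta>) (pmf p) \<le> c"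
    using worth_le_response[OF f(1)] f(2)[OF total_weight_pmf] by metis
  ultimately show "pmf p = product_at (9/11) (9/11)" using f(4)[OF total_weight_pmf, of p] by simp
qed

section \<open>The first exceptional value\<close>

text \<open>
  The mixture \<open>q\<close> is optimal at a single value of \<open>\<theta>\<close> if all undecided kinks vanish there and some response is
  the same for the four pairs of pure strategies.
\<close>

fun balanced_in :: "point \<Rightarrow> quad \<Rightarrow> int \<Rightarrow> int list \<Rightarrow> game \<Rightarrow> bool" where
  "balanced_in a q W ws (l, hs) \<longleftrightarrow> 0 < W \<and> length ws = length hs \<and> list_all (\<lambda>w. 0 \<le> w \<and> w \<le> W) ws \<and>
     list_all (\<lambda>h. dot (slice a h) q = 0) hs \<and>
     (case slice a (respond W ws (l, hs)) of (x, y, z, w) \<Rightarrow> x = y \<and> y = z \<and> z = w)"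

lemma balanced_in_optimum:
  assumes B: "balanced_in (s, t) q W ws (settle (s, t) (s, t) [q] G)" and m: "mass q > 0" and "nonneg_quad q" and "total_weight p = 1"
  shows "worth G (of_int s) (of_int t) p \<le> worth G (of_int s) (of_int t) (\<lambda>u. 1 / of_int (mass q) * mix q u)"
proof -
  obtain l hs where G: "settle (s, t) (s, t) [q] G = (l, hs)" by (rule prod.exhaust)
  obtain x where x: "slice (s, t) (respond W ws (l, hs)) = (x, x, x, x)"
    using B unfolding G by (cases "slice (s, t) (respond W ws (l, hs))") auto
  have W: "length ws = length hs" "set ws \<subseteq> {0..W}" "W > 0" and z: "\<And>h. h \<in> set hs \<Longrightarrow> dot (slice (s, t) h) q = 0"
    using B unfolding G by (auto simp: list_all_iff)
  define f where "f = (\<lambda>p. form_value (respond_list ws hs (scale_form W l)) (of_int s) (of_int t) p / of_int W)"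
  have f: "f \<in> responses (l, hs) (of_int s) (of_int t)" unfolding f_def by (rule respond_list[OF W])
  have fp: "f p = of_int x / of_int W" if "total_weight p = 1" for p
  proof -
    have "f p = weigh (x, x, x, x) p / of_int W" unfolding f_def x[symmetric] weigh_slice by simp
    also have "\<dots> = of_int x * total_weight p / of_int W" by (simp add: total_weight_def distrib_left)
    finally show ?thesis using that by simp
  qed
  define r where "r = (\<lambda>u. 1 / of_int (mass q) * mix q u)"
  have r: "total_weight r = 1"
    using m sum_mix[of q] unfolding total_weight_def r_def distrib_left[symmetric] by simp
  have zero: "form_value h (of_int s) (of_int t) r = 0" if "h \<in> set hs" for h
    unfolding r_def weigh_slice[symmetric] weigh_linear weigh_mix using z[OF that] by simp
  have "worth G (of_int s) (of_int t) p \<le> f p"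
    by (rule worth_le_response) (use f responses_settle G in metis)
  also have "f p = f r" using fp assms(4) r by simp
  also have "f r = form_value l (of_int s) (of_int t) r"
  proof -
    obtain ws' where ws': "length ws' = length hs" "f = (\<lambda>p. form_value l (of_int s) (of_int t) p + (\<Sum>(w, h)\<leftarrow>zip ws' hs. w * form_value h (of_int s) (of_int t) p))"
      using f by auto
    have "(\<Sum>(w, h)\<leftarrow>zip ws' hs. w * form_value h (of_int s) (of_int t) r) = 0"
      using ws'(1) zero by (induction ws' hs rule: list_induct2) (auto simp del: form_value.simps)
    then show ?thesis by (simp add: ws'(2))
  qed
  also have "\<dots> = worth (l, hs) (of_int s) (of_int t) r"
  proof -
    have "(\<Sum>h\<leftarrow>hs. min 0 (form_value h (of_int s) (of_int t) r)) = (\<Sum>h\<leftarrow>hs. 0)"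
      using zero by (intro arg_cong[where f=sum_list] map_cong refl) (simp del: form_value.simps)
    then show ?thesis by (simp del: form_value.simps)
  qed
  also have "\<dots> = worth G (of_int s) (of_int t) r"
    unfolding G[symmetric]
  proof (rule worth_settle[where \<alpha>=1 and \<beta>=0])
    have "(\<lambda>u. 1 / of_int (mass q) * mix q u + 1 * 0) \<in> conic_span [q]"
      using m by (intro cone_add cone_zero) auto
    then show "r \<in> conic_span [q]" by (simp add: r_def)
  qed auto
  finally show ?thesis unfolding r_def .
qed

lemma balanced_first: "balanced_in (5621, 28075) (1566, 7047, 3272, 14724) 105620381938458816000 [80376586704979452316, 15161492916736410816, 98248377674405644635]
   (settle (5621, 28075) (5621, 28075) [(1566, 7047, 3272, 14724)] core_game)"
  by code_simp

lemma coincide_first: "equilibria_coincide (5621 / 33696)"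
proof (rule coincide[of _ "1636 / 2419" "9 / 11"])
  have q: "(\<lambda>u. 1 / of_int (mass (1566, 7047, 3272, 14724)) * mix (1566, 7047, 3272, 14724) u) = product_at (1636 / 2419) (9 / 11)"
    by (auto simp: fun_eq_iff)
  fix p
  have "worth core_game (of_int 5621) (of_int 28075) (pmf p) \<le> worth core_game (of_int 5621) (of_int 28075) (product_at (1636 / 2419) (9 / 11))"
    using balanced_in_optimum[OF balanced_first _ _ total_weight_pmf[of p]] unfolding q by simp
  moreover have "worth core_game (of_int 5621) (of_int 28075) p' = 33696 * worth core_game (5621 / 33696) (1 - 5621 / 33696) p'" for p'
    by (simp flip: worth_scale(1))
  ultimately show "worth core_game (5621 / 33696) (1 - 5621 / 33696) (pmf p) \<le> worth core_game (5621 / 33696) (1 - 5621 / 33696) (product_at (1636 / 2419) (9 / 11))"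
    by simp
qed auto

section \<open>The second exceptional value\<close>

text \<open>The information sets \<open>(5, 0, 4)\<close>, \<open>(10, 6, 6)\<close> and \<open>(11, 10, 6)\<close>.\<close>

definition second_kinks :: "form list" where
  "second_kinks = [((64 * - 42809, 64 * - 50505, 64 * - 41385, 64 * - 48825), (64 * 22161, 64 * 9345, 64 * 26145, 64 * 11025)),
     ((3328 * 801, 3328 * 945, 3328 * - 178, 3328 * - 210), (3328 * - 159, 3328 * - 15, 3328 * - 106, 3328 * - 10)),
     ((0, 0, 0, 0), (1384448 * 9, 1384448 * - 2, 1384448 * 9, 1384448 * - 2))]"

definition second_form :: form where
  "second_form = ((- 38167152, - 37779568, - 26116608, - 26122240), (- 135411504, - 123181248, - 138110768, - 125421760))"

text \<open>
  Corners of a box that contains the optimal mixtures for \<open>0.2155 \<le> \<theta> \<le> 0.2158\<close>: \<open>p\<^sub>1\<^sub>0\<close> in \<open>[0.126, 0.135]\<close>,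
  \<open>p\<^sub>1\<^sub>1\<close> in \<open>[0.583, 0.59]\<close>, and \<open>p\<^sub>0\<^sub>1 + p\<^sub>1\<^sub>1 = 9/11\<close>. All other kinks have constant sign on it.
\<close>

definition second_box :: "quad list" where
  "second_box = [(614, 2587, 1386, 6413), (614, 2510, 1386, 6490), (515, 2587, 1485, 6413), (515, 2510, 1485, 6490)]"

lemma settle_second: "settle (431, 1569) (1079, 3921) second_box core_game = (second_form, second_kinks)"
  by code_simp

definition second_poly :: "real \<Rightarrow> real" where
  "second_poly \<theta> = 29851341 - 1952936938 * \<theta> + 8414116560 * \<theta>\<^sup>2"

text \<open>
  The last kink involves the second Player only, so the first two weights solve the pair of linear equations saying
  that the interaction and the increment in the first strategy vanish; \<open>N1\<close>, \<open>N2\<close> and \<open>\<Delta>\<close> are the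
  determinants of Cramer's rule. The last weight then cancels the increment in the second strategy.
\<close>

lemma second_weights:
  assumes \<theta>: "2155/10000 \<le> \<theta>" "\<theta> \<le> 2158/10000"
  shows "\<exists>w1\<in>{0<..<1}. \<exists>w2\<in>{0<..<1}. \<exists>w3\<in>{0<..<1}. \<exists>c. \<forall>p. total_weight p = 1 \<longrightarrow>
     form_value second_form \<theta> (1 - \<theta>) p + (w1 * form_value (second_kinks ! 0) \<theta> (1 - \<theta>) p
       + w2 * form_value (second_kinks ! 1) \<theta> (1 - \<theta>) p + w3 * form_value (second_kinks ! 2) \<theta> (1 - \<theta>) p) = c"
proof -
  define \<Delta> where "\<Delta> = 69120 + 2900480 * \<theta> - 2969600 * \<theta>\<^sup>2"
  define N1 where "N1 = 6578176 + 9756336 * \<theta> - 172950400 * \<theta>\<^sup>2"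
  define N2 where "N2 = - 274464768 + 2270314240 * \<theta> - 2223654400 * \<theta>\<^sup>2"
  have sq: "(2155/10000)\<^sup>2 \<le> \<theta>\<^sup>2" "\<theta>\<^sup>2 \<le> (2158/10000)\<^sup>2"
    using \<theta> by (auto intro!: power_mono)
  have D: "\<Delta> > 0" using \<theta> sq by (simp add: \<Delta>_def power2_eq_square)
  have N: "0 < N1" "N1 < 4 * \<Delta>" "0 < N2" "N2 < 208 * \<Delta>"
    using \<theta> sq by (simp_all add: \<Delta>_def N1_def N2_def power2_eq_square)
  define v1 v2 where "v1 = 16 * N1 / \<Delta>" and "v2 = 16 * N2 / \<Delta>"
  define v3 where "v3 = (387584 * \<theta> + 12230256 * (1 - \<theta>) + v1 * (- 7696 * \<theta> - 12816 * (1 - \<theta>)) + v2 * 144) / 11"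
  have v: "0 < v1" "v1 < 64" "0 < v2" "v2 < 3328"
    using D N by (simp_all add: v1_def v2_def divide_less_eq)
  define z where "z = v1 * (7696 * \<theta> + 12816 * (1 - \<theta>))"
  have z: "0 \<le> z" "z \<le> 64 * 12816"
    unfolding z_def by (rule mult_nonneg_nonneg mult_mono; use v \<theta> in simp)+
  have "v3 = (387584 * \<theta> + 12230256 * (1 - \<theta>) - z + v2 * 144) / 11"
    by (simp add: v3_def z_def algebra_simps)
  then have v3: "0 < v3" "v3 < 1384448 * (1 - \<theta>)"
    using v \<theta> z by simp_all
  have I: "(- 393216) * \<theta> + 458752 * (1 - \<theta>) + v1 * (256 * \<theta> + (- 2304) * (1 - \<theta>)) + v2 * ((- 176) * \<theta> + (- 48) * (1 - \<theta>)) = 0"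
    and X: "12050544 * \<theta> + (- 2699264) * (1 - \<theta>) + v1 * (1424 * \<theta> + 3984 * (1 - \<theta>)) + v2 * ((- 979) * \<theta> + 53 * (1 - \<theta>)) = 0"
    using D unfolding v1_def v2_def by (simp_all add: divide_simps) (simp_all add: \<Delta>_def N1_def N2_def power2_eq_square algebra_simps)
  have Y: "387584 * \<theta> + 12230256 * (1 - \<theta>) + v1 * (- 7696 * \<theta> - 12816 * (1 - \<theta>)) + v2 * 144 - 11 * v3 = 0"
    by (simp add: v3_def)
  define w1 w2 w3 where "w1 = v1 / 64" and "w2 = v2 / 3328" and "w3 = v3 / (1384448 * (1 - \<theta>))"
  have w: "w1 \<in> {0<..<1}" "w2 \<in> {0<..<1}" "w3 \<in> {0<..<1}"
    using v v3 \<theta> by (simp_all add: w1_def w2_def w3_def divide_less_eq)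
  have vw: "w1 * 64 = v1" "w2 * 3328 = v2" "w3 * (1384448 * (1 - \<theta>)) = v3"
    using \<theta> by (simp_all add: w1_def w2_def w3_def)
  define t where "t = 1 - \<theta>"
  define c where "c = - 38167152 * \<theta> - 135411504 * t + v1 * (- 42809 * \<theta> + 22161 * t) + v2 * (801 * \<theta> - 159 * t) + 9 * v3"
  have coeff: "- 37779568 * \<theta> - 123181248 * t + v1 * (- 50505 * \<theta> + 9345 * t) + v2 * (945 * \<theta> - 15 * t) - 2 * v3 = c"
    "- 26116608 * \<theta> - 138110768 * t + v1 * (- 41385 * \<theta> + 26145 * t) + v2 * (- 178 * \<theta> - 106 * t) + 9 * v3 = c"
    "- 26122240 * \<theta> - 125421760 * t + v1 * (- 48825 * \<theta> + 11025 * t) + v2 * (- 210 * \<theta> - 10 * t) - 2 * v3 = c"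
    using I X Y unfolding c_def t_def by (simp_all add: algebra_simps)
  have "form_value second_form \<theta> (1 - \<theta>) p + (w1 * form_value (second_kinks ! 0) \<theta> (1 - \<theta>) p
       + w2 * form_value (second_kinks ! 1) \<theta> (1 - \<theta>) p + w3 * form_value (second_kinks ! 2) \<theta> (1 - \<theta>) p) = c" if "total_weight p = 1" for p
  proof -
    have "form_value second_form \<theta> (1 - \<theta>) p + (w1 * form_value (second_kinks ! 0) \<theta> (1 - \<theta>) p
       + w2 * form_value (second_kinks ! 1) \<theta> (1 - \<theta>) p + w3 * form_value (second_kinks ! 2) \<theta> (1 - \<theta>) p)
     = (- 38167152 * \<theta> - 135411504 * t + (w1 * 64) * (- 42809 * \<theta> + 22161 * t) + (w2 * 3328) * (801 * \<theta> - 159 * t) + 9 * (w3 * (1384448 * t))) * p (False, False)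
     + (- 37779568 * \<theta> - 123181248 * t + (w1 * 64) * (- 50505 * \<theta> + 9345 * t) + (w2 * 3328) * (945 * \<theta> - 15 * t) - 2 * (w3 * (1384448 * t))) * p (False, True)
     + (- 26116608 * \<theta> - 138110768 * t + (w1 * 64) * (- 41385 * \<theta> + 26145 * t) + (w2 * 3328) * (- 178 * \<theta> - 106 * t) + 9 * (w3 * (1384448 * t))) * p (True, False)
     + (- 26122240 * \<theta> - 125421760 * t + (w1 * 64) * (- 48825 * \<theta> + 11025 * t) + (w2 * 3328) * (- 210 * \<theta> - 10 * t) - 2 * (w3 * (1384448 * t))) * p (True, True)"
      unfolding second_form_def second_kinks_def t_def[symmetric] by (simp add: algebra_simps)
    also have "\<dots> = c * total_weight p"
      unfolding vw[folded t_def] coeff c_def[symmetric] total_weight_def by (simp only: distrib_left)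
    finally show ?thesis using that by simp
  qed
  then show ?thesis using w by blast
qed

lemma second_box_span:
  assumes "126/1000 \<le> x" "x \<le> 135/1000" "583/1000 \<le> y" "y \<le> 590/1000"
    and p: "p (False, False) = 2/11 - x" "p (False, True) = 9/11 - y" "p (True, False) = x" "p (True, True) = y"
  shows "p \<in> conic_span second_box"
proof -
  define \<xi> \<eta> where "\<xi> = (x - 126/1000) / (9/1000)" and "\<eta> = (y - 583/1000) / (7/1000)"
  have xy: "x = 126/1000 + 9/1000 * \<xi>" "y = 583/1000 + 7/1000 * \<eta>" by (simp_all add: \<xi>_def \<eta>_def field_simps)
  have r: "0 \<le> \<xi>" "\<xi> \<le> 1" "0 \<le> \<eta>" "\<eta> \<le> 1" using assms(1-4) by (simp_all add: \<xi>_def \<eta>_def)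
  define k where "k = (\<lambda>x y u. mix (2000 - 11 * x, 9000 - 11 * y, 11 * x, 11 * y) u)"
  have "(\<lambda>u. (1 - \<xi>) * (1 - \<eta>) / 11000 * k 126 583 u + 1 * ((1 - \<xi>) * \<eta> / 11000 * k 126 590 u
      + 1 * (\<xi> * (1 - \<eta>) / 11000 * k 135 583 u + 1 * (\<xi> * \<eta> / 11000 * k 135 590 u + 1 * 0)))) \<in> conic_span second_box"
    unfolding k_def by (intro cone_add cone_zero) (use r in \<open>auto simp: second_box_def\<close>)
  also have "(\<lambda>u. (1 - \<xi>) * (1 - \<eta>) / 11000 * k 126 583 u + 1 * ((1 - \<xi>) * \<eta> / 11000 * k 126 590 u
      + 1 * (\<xi> * (1 - \<eta>) / 11000 * k 135 583 u + 1 * (\<xi> * \<eta> / 11000 * k 135 590 u + 1 * 0)))) = p"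
  proof
    fix u show "(1 - \<xi>) * (1 - \<eta>) / 11000 * k 126 583 u + 1 * ((1 - \<xi>) * \<eta> / 11000 * k 126 590 u
      + 1 * (\<xi> * (1 - \<eta>) / 11000 * k 135 583 u + 1 * (\<xi> * \<eta> / 11000 * k 135 590 u + 1 * 0))) = p u"
      by (cases u; cases "fst u"; cases "snd u") (auto simp: p k_def xy field_simps)
  qed
  finally show ?thesis .
qed

text \<open>
  The common zero of the three kinks. The last one gives \<open>p\<^sub>0\<^sub>1 + p\<^sub>1\<^sub>1 = 9/11\<close>, and the other two become a pair of linear
  equations for \<open>p\<^sub>1\<^sub>0\<close> and \<open>p\<^sub>1\<^sub>1\<close>, with the same determinant \<open>\<Delta>\<close> up to sign. The mixture is a product
  if and only if \<open>2 p\<^sub>1\<^sub>1 = 9 p\<^sub>1\<^sub>0\<close>, and \<open>11 \<Delta> (2 p\<^sub>1\<^sub>1 - 9 p\<^sub>1\<^sub>0)\<close> is the negative of \<open>second_poly \<theta>\<close>.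
\<close>

lemma second_point:
  assumes \<theta>: "2155/10000 \<le> \<theta>" "\<theta> \<le> 2158/10000"
  obtains p where "p \<in> conic_span second_box" "total_weight p = 1" "\<forall>h\<in>set second_kinks. form_value h \<theta> (1 - \<theta>) p = 0"
    "\<And>u. 0 \<le> p u" "second_poly \<theta> = 0 \<Longrightarrow> \<exists>x\<in>{0..1}. p = product_at x (9/11)"
proof -
  define \<Delta> where "\<Delta> = 69120 + 2900480 * \<theta> - 2969600 * \<theta>\<^sup>2"
  define x where "x = (1403175 - 170059070 * \<theta> + 775564400 * \<theta>\<^sup>2) / (11 * \<Delta>)"
  define y where "y = (- 8611383 + 211202654 * \<theta> - 717018480 * \<theta>\<^sup>2) / (11 * \<Delta>)"
  define \<delta> where "\<delta> = \<theta> - 2155/10000"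
  have \<delta>: "\<theta> = 2155/10000 + \<delta>" "0 \<le> \<delta>" "\<delta> \<le> 3/10000" using \<theta> by (simp_all add: \<delta>_def)
  \<comment> \<open>The box is tight, so \<open>\<theta>\<^sup>2\<close> is linearized at the left end instead of being bounded independently of \<open>\<theta>\<close>.\<close>
  define q where "q = \<delta>\<^sup>2"
  have q: "0 \<le> q" "q \<le> 3/10000 * \<delta>"
    using mult_right_mono[OF \<delta>(3,2)] by (simp_all only: q_def power2_eq_square zero_le_square)
  have sq: "\<theta>\<^sup>2 = 4644025/100000000 + 431/1000 * \<delta> + q"
    unfolding \<delta>(1) q_def by (simp add: power2_eq_square algebra_simps)
  have D: "\<Delta> > 0" using \<delta>(2,3) q unfolding \<Delta>_def sq unfolding \<delta>(1) by simp
  have box: "126/1000 \<le> x" "x \<le> 135/1000" "583/1000 \<le> y" "y \<le> 590/1000"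
  proof -
    have "11 * \<Delta> > 0" using D by simp
    note pos = pos_le_divide_eq[OF this] pos_divide_le_eq[OF this]
    show "126/1000 \<le> x" "x \<le> 135/1000" "583/1000 \<le> y" "y \<le> 590/1000"
      using \<delta>(2,3) q unfolding x_def y_def pos unfolding \<Delta>_def sq unfolding \<delta>(1) by simp_all
  qed
  have xy: "11 * \<Delta> * x = 1403175 - 170059070 * \<theta> + 775564400 * \<theta>\<^sup>2" "11 * \<Delta> * y = - 8611383 + 211202654 * \<theta> - 717018480 * \<theta>\<^sup>2"
    using D by (simp_all add: x_def y_def)
  define p where "p = (\<lambda>(u, v). if u then if v then y else x else if v then 9/11 - y else 2/11 - x)"
  have p: "p (False, False) = 2/11 - x" "p (False, True) = 9/11 - y" "p (True, False) = x" "p (True, True) = y"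
    by (simp_all add: p_def)
  show thesis
  proof (rule that)
    show "p \<in> conic_span second_box" by (rule second_box_span[OF box p])
    show "total_weight p = 1" by (simp add: total_weight_def p)
    show "0 \<le> p u" for u using box by (auto simp: p_def split: prod.split)
    have "11 * \<Delta> * ((- 42809 * \<theta> + 22161 * (1 - \<theta>)) * (2/11 - x) + (- 50505 * \<theta> + 9345 * (1 - \<theta>)) * (9/11 - y)
         + (- 41385 * \<theta> + 26145 * (1 - \<theta>)) * x + (- 48825 * \<theta> + 11025 * (1 - \<theta>)) * y)
      = (- 42809 * \<theta> + 22161 * (1 - \<theta>)) * (2 * \<Delta> - 11 * \<Delta> * x) + (- 50505 * \<theta> + 9345 * (1 - \<theta>)) * (9 * \<Delta> - 11 * \<Delta> * y)
         + (- 41385 * \<theta> + 26145 * (1 - \<theta>)) * (11 * \<Delta> * x) + (- 48825 * \<theta> + 11025 * (1 - \<theta>)) * (11 * \<Delta> * y)"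
      by (simp add: algebra_simps)
    also have "\<dots> = 0" unfolding xy by (simp add: \<Delta>_def power2_eq_square algebra_simps)
    finally have first: "(- 42809 * \<theta> + 22161 * (1 - \<theta>)) * (2/11 - x) + (- 50505 * \<theta> + 9345 * (1 - \<theta>)) * (9/11 - y)
         + (- 41385 * \<theta> + 26145 * (1 - \<theta>)) * x + (- 48825 * \<theta> + 11025 * (1 - \<theta>)) * y = 0" using D by simp
    have "11 * \<Delta> * ((801 * \<theta> - 159 * (1 - \<theta>)) * (2/11 - x) + (945 * \<theta> - 15 * (1 - \<theta>)) * (9/11 - y)
         + (- 178 * \<theta> - 106 * (1 - \<theta>)) * x + (- 210 * \<theta> - 10 * (1 - \<theta>)) * y)
      = (801 * \<theta> - 159 * (1 - \<theta>)) * (2 * \<Delta> - 11 * \<Delta> * x) + (945 * \<theta> - 15 * (1 - \<theta>)) * (9 * \<Delta> - 11 * \<Delta> * y)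
         + (- 178 * \<theta> - 106 * (1 - \<theta>)) * (11 * \<Delta> * x) + (- 210 * \<theta> - 10 * (1 - \<theta>)) * (11 * \<Delta> * y)"
      by (simp add: algebra_simps)
    also have "\<dots> = 0" unfolding xy by (simp add: \<Delta>_def power2_eq_square algebra_simps)
    finally have second: "(801 * \<theta> - 159 * (1 - \<theta>)) * (2/11 - x) + (945 * \<theta> - 15 * (1 - \<theta>)) * (9/11 - y)
         + (- 178 * \<theta> - 106 * (1 - \<theta>)) * x + (- 210 * \<theta> - 10 * (1 - \<theta>)) * y = 0" using D by simp
    have "form_value (second_kinks ! 0) \<theta> (1 - \<theta>) p = 64 * ((- 42809 * \<theta> + 22161 * (1 - \<theta>)) * (2/11 - x)
         + (- 50505 * \<theta> + 9345 * (1 - \<theta>)) * (9/11 - y) + (- 41385 * \<theta> + 26145 * (1 - \<theta>)) * x + (- 48825 * \<theta> + 11025 * (1 - \<theta>)) * y)"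
      "form_value (second_kinks ! 1) \<theta> (1 - \<theta>) p = 3328 * ((801 * \<theta> - 159 * (1 - \<theta>)) * (2/11 - x)
         + (945 * \<theta> - 15 * (1 - \<theta>)) * (9/11 - y) + (- 178 * \<theta> - 106 * (1 - \<theta>)) * x + (- 210 * \<theta> - 10 * (1 - \<theta>)) * y)"
      "form_value (second_kinks ! 2) \<theta> (1 - \<theta>) p = 0"
      by (simp_all add: second_kinks_def p field_simps)
    then have "form_value (second_kinks ! 0) \<theta> (1 - \<theta>) p = 0" "form_value (second_kinks ! 1) \<theta> (1 - \<theta>) p = 0"
      "form_value (second_kinks ! 2) \<theta> (1 - \<theta>) p = 0" unfolding first second by simp_all
    moreover have "set second_kinks = {second_kinks ! 0, second_kinks ! 1, second_kinks ! 2}" by (simp add: second_kinks_def)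
    ultimately show "\<forall>h\<in>set second_kinks. form_value h \<theta> (1 - \<theta>) p = 0" by (simp del: form_value.simps)
    assume "second_poly \<theta> = 0"
    moreover have "11 * \<Delta> * (2 * y - 9 * x) = 2 * (11 * \<Delta> * y) - 9 * (11 * \<Delta> * x)" by (simp add: algebra_simps)
    then have "11 * \<Delta> * (2 * y - 9 * x) = - second_poly \<theta>" unfolding xy second_poly_def by simp
    ultimately have yx: "y = 9/2 * x" using D by simp
    have "p = product_at (11/2 * x) (9/11)"
      by (auto simp: fun_eq_iff p_def yx field_simps)
    then show "\<exists>x\<in>{0..1}. p = product_at x (9/11)"
      using box by (intro bexI[of _ "11/2 * x"]) auto
  qed
qed

lemma second_kinks_product:
  assumes "\<theta> < 1" "\<forall>h\<in>set second_kinks. form_value h \<theta> (1 - \<theta>) (product_at x y) = 0"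
  shows "second_poly \<theta> = 0"
proof -
  have "(1 - \<theta>) * (9 - 11 * y) = 0"
    using assms(2) by (simp add: second_kinks_def algebra_simps)
  then have y: "y = 9/11" using assms(1) by simp
  define a b c d where "a = 2 * (1424 * \<theta> + 3984 * (1 - \<theta>)) + 9 * (1680 * \<theta> + 1680 * (1 - \<theta>))"
    and "b = 2 * (- 42809 * \<theta> + 22161 * (1 - \<theta>)) + 9 * (- 50505 * \<theta> + 9345 * (1 - \<theta>))"
    and "c = 2 * (- 979 * \<theta> + 53 * (1 - \<theta>)) + 9 * (- 1155 * \<theta> + 5 * (1 - \<theta>))"
    and "d = 2 * (801 * \<theta> - 159 * (1 - \<theta>)) + 9 * (945 * \<theta> - 15 * (1 - \<theta>))"
  have "form_value (second_kinks ! 0) \<theta> (1 - \<theta>) (product_at x (9/11)) = 64/11 * (a * x + b)"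
    "form_value (second_kinks ! 1) \<theta> (1 - \<theta>) (product_at x (9/11)) = 3328/11 * (c * x + d)"
    by (simp_all add: second_kinks_def a_def b_def c_def d_def field_simps)
  moreover have "second_kinks ! 0 \<in> set second_kinks" "second_kinks ! 1 \<in> set second_kinks"
    by (simp_all add: second_kinks_def)
  ultimately have "64/11 * (a * x + b) = 0" "3328/11 * (c * x + d) = 0"
    using assms(2) unfolding y by metis+
  then have "a * x + b = 0" "c * x + d = 0" by simp_all
  then have "a * d - c * b = 0" by algebra
  then show ?thesis
    unfolding a_def b_def c_def d_def second_poly_def by (simp add: power2_eq_square algebra_simps)
qed

lemma coincide_second_iff:
  assumes \<theta>: "2155/10000 \<le> \<theta>" "\<theta> \<le> 2158/10000"
  shows "equilibria_coincide \<theta> \<longleftrightarrow> second_poly \<theta> = 0"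
proof -
  have range: "0 \<le> \<theta>" "\<theta> \<le> 1/2" "\<theta> < 1" using \<theta> by simp_all
  have three: "second_kinks = [second_kinks ! 0, second_kinks ! 1, second_kinks ! 2]" by (simp add: second_kinks_def)
  obtain w1 w2 w3 c where w: "w1 \<in> {0<..<1}" "w2 \<in> {0<..<1}" "w3 \<in> {0<..<1}"
    and const: "\<And>p. total_weight p = 1 \<Longrightarrow> form_value second_form \<theta> (1 - \<theta>) p + (w1 * form_value (second_kinks ! 0) \<theta> (1 - \<theta>) p
       + w2 * form_value (second_kinks ! 1) \<theta> (1 - \<theta>) p + w3 * form_value (second_kinks ! 2) \<theta> (1 - \<theta>) p) = c"
    using second_weights[OF \<theta>] by blast
  obtain p where p: "p \<in> conic_span second_box" "total_weight p = 1" "\<forall>h\<in>set second_kinks. form_value h \<theta> (1 - \<theta>) p = 0"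
    "\<And>u. 0 \<le> p u" "second_poly \<theta> = 0 \<Longrightarrow> \<exists>x\<in>{0..1}. p = product_at x (9/11)"
    using second_point[OF \<theta>] by blast
  obtain \<alpha> \<beta> where ab: "0 \<le> \<alpha>" "0 \<le> \<beta>" "\<theta> = \<alpha> * of_int 431 + \<beta> * of_int 1079" "1 - \<theta> = \<alpha> * of_int 1569 + \<beta> * of_int 3921"
    by (rule between_combination[of 431 1569 1079 3921 \<theta>]) (use \<theta> in auto)
  have le: "worth core_game \<theta> (1 - \<theta>) q \<le> worth (second_form, [second_kinks ! 0, second_kinks ! 1, second_kinks ! 2]) \<theta> (1 - \<theta>) q" for q
    using worth_le_worth_settle[of core_game \<theta> "1 - \<theta>" q "(431, 1569)" "(1079, 3921)" second_box]
    unfolding settle_second three[symmetric] .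
  note opt = three_kinks_optimum[OF le, of w1 w2 w3 c, OF _ _ _ const]
  have top: "worth core_game \<theta> (1 - \<theta>) q \<le> c" if "total_weight q = 1" for q
    using opt(1)[OF _ _ _ _ that] w by auto
  have zero: "form_value (second_kinks ! 0) \<theta> (1 - \<theta>) p = 0" "form_value (second_kinks ! 1) \<theta> (1 - \<theta>) p = 0" "form_value (second_kinks ! 2) \<theta> (1 - \<theta>) p = 0"
    using p(3) by (simp_all add: second_kinks_def del: form_value.simps)
  have "worth core_game \<theta> (1 - \<theta>) p = worth (second_form, second_kinks) \<theta> (1 - \<theta>) p"
    unfolding settle_second[symmetric] by (rule worth_settle[symmetric, OF p(1) ab(1,2)]) (use ab in auto)
  also have "\<dots> = c"
    using const[OF p(2)] zero by (subst three) (simp del: form_value.simps)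
  finally have pc: "worth core_game \<theta> (1 - \<theta>) p = c" .
  show ?thesis
  proof
    assume "second_poly \<theta> = 0"
    then obtain x where x: "x \<in> {0..1}" "p = product_at x (9/11)" using p(5) by blast
    show "equilibria_coincide \<theta>"
      by (rule coincide[OF range(1,2) x(1), of "9/11"]) (use top[OF total_weight_pmf] pc x(2) in auto)
  next
    assume coin: "equilibria_coincide \<theta>"
    show "second_poly \<theta> = 0"
    proof (rule ccontr)
      assume ne: "second_poly \<theta> \<noteq> 0"
      have "\<not> equilibria_coincide \<theta>"
      proof (rule not_coincide[OF range(1,2) p(4)])
        show "p (False, False) + p (False, True) + p (True, False) + p (True, True) = 1" using p(2) by (simp add: total_weight_def)
        fix x y :: real
        have "worth core_game \<theta> (1 - \<theta>) (product_at x y) \<noteq> c"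
        proof
          assume "worth core_game \<theta> (1 - \<theta>) (product_at x y) = c"
          then have "form_value (second_kinks ! 0) \<theta> (1 - \<theta>) (product_at x y) = 0 \<and> form_value (second_kinks ! 1) \<theta> (1 - \<theta>) (product_at x y) = 0
              \<and> form_value (second_kinks ! 2) \<theta> (1 - \<theta>) (product_at x y) = 0"
            using opt(2)[OF _ _ _ _ total_weight_product_at _ w] w by auto
          moreover have "set second_kinks = {second_kinks ! 0, second_kinks ! 1, second_kinks ! 2}" by (simp add: second_kinks_def)
          ultimately have "\<forall>h\<in>set second_kinks. form_value h \<theta> (1 - \<theta>) (product_at x y) = 0" by (simp del: form_value.simps)
          with second_kinks_product[OF range(3)] ne show False by blast
        qed
        then show "worth core_game \<theta> (1 - \<theta>) (product_at x y) < worth core_game \<theta> (1 - \<theta>) p"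
          using top[OF total_weight_product_at, of x y] pc by simp
      qed
      with coin show False by simp
    qed
  qed
qed

section \<open>The coincidence set\<close>

lemma gaps:
  assumes \<theta>: "0 \<le> \<theta>" "\<theta> \<le> 1/2"
  shows "0 < \<theta> \<and> \<theta> \<le> 19 / 1000 \<Longrightarrow> \<not> equilibria_coincide \<theta>"
    and "19 / 1000 < \<theta> \<and> \<theta> \<le> 7 / 250 \<Longrightarrow> \<not> equilibria_coincide \<theta>"
    and "7 / 250 < \<theta> \<and> \<theta> \<le> 9 / 200 \<Longrightarrow> \<not> equilibria_coincide \<theta>"
    and "9 / 200 < \<theta> \<and> \<theta> \<le> 2 / 25 \<Longrightarrow> \<not> equilibria_coincide \<theta>"
    and "2 / 25 < \<theta> \<and> \<theta> \<le> 13 / 100 \<Longrightarrow> \<not> equilibria_coincide \<theta>"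
    and "13 / 100 < \<theta> \<and> \<theta> \<le> 31 / 200 \<Longrightarrow> \<not> equilibria_coincide \<theta>"
    and "31 / 200 < \<theta> \<and> \<theta> \<le> 4 / 25 \<Longrightarrow> \<not> equilibria_coincide \<theta>"
    and "4 / 25 \<le> \<theta> \<and> \<theta> < 5621 / 33696 \<Longrightarrow> \<not> equilibria_coincide \<theta>"
    and "5621 / 33696 < \<theta> \<and> \<theta> \<le> 1999 / 11232 \<Longrightarrow> \<not> equilibria_coincide \<theta>"
    and "7 / 40 < \<theta> \<and> \<theta> \<le> 1 / 5 \<Longrightarrow> \<not> equilibria_coincide \<theta>"
    and "1 / 5 < \<theta> \<and> \<theta> \<le> 431 / 2000 \<Longrightarrow> \<not> equilibria_coincide \<theta>"
    and "1079 / 5000 < \<theta> \<and> \<theta> \<le> 109 / 500 \<Longrightarrow> \<not> equilibria_coincide \<theta>"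
    and "109 / 500 < \<theta> \<and> \<theta> \<le> 57 / 250 \<Longrightarrow> \<not> equilibria_coincide \<theta>"
    and "57 / 250 < \<theta> \<and> \<theta> \<le> 47 / 200 \<Longrightarrow> \<not> equilibria_coincide \<theta>"
    and "47 / 200 \<le> \<theta> \<and> \<theta> < 9588 / 37663 \<Longrightarrow> \<not> equilibria_coincide \<theta>"
    and "55716 / 128711 < \<theta> \<and> \<theta> \<le> 55850 / 128711 \<Longrightarrow> \<not> equilibria_coincide \<theta>"
    and "433 / 1000 < \<theta> \<and> \<theta> \<le> 437 / 1000 \<Longrightarrow> \<not> equilibria_coincide \<theta>"
    and "437 / 1000 < \<theta> \<and> \<theta> \<le> 56 / 125 \<Longrightarrow> \<not> equilibria_coincide \<theta>"
    and "56 / 125 < \<theta> \<and> \<theta> \<le> 47 / 100 \<Longrightarrow> \<not> equilibria_coincide \<theta>"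
    and "47 / 100 < \<theta> \<and> \<theta> \<le> 1 / 2 \<Longrightarrow> \<not> equilibria_coincide \<theta>"
  subgoal by (rule separates_between[OF gap_1, of "0" "19 / 1000"]) (use \<theta> in auto)
  subgoal by (rule separates_between[OF gap_2, of "19 / 1000" "7 / 250"]) (use \<theta> in auto)
  subgoal by (rule separates_between[OF gap_3, of "7 / 250" "9 / 200"]) (use \<theta> in auto)
  subgoal by (rule separates_between[OF gap_4, of "9 / 200" "2 / 25"]) (use \<theta> in auto)
  subgoal by (rule separates_between[OF gap_5, of "2 / 25" "13 / 100"]) (use \<theta> in auto)
  subgoal by (rule separates_between[OF gap_6, of "13 / 100" "31 / 200"]) (use \<theta> in auto)
  subgoal by (rule separates_between[OF gap_7, of "31 / 200" "4 / 25"]) (use \<theta> in auto)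
  subgoal by (rule separates_between[OF gap_8, of "5621 / 33696" "4 / 25"]) (use \<theta> in auto)
  subgoal by (rule separates_between[OF gap_9, of "5621 / 33696" "1999 / 11232"]) (use \<theta> in auto)
  subgoal by (rule separates_between[OF gap_10, of "7 / 40" "1 / 5"]) (use \<theta> in auto)
  subgoal by (rule separates_between[OF gap_11, of "1 / 5" "431 / 2000"]) (use \<theta> in auto)
  subgoal by (rule separates_between[OF gap_12, of "1079 / 5000" "109 / 500"]) (use \<theta> in auto)
  subgoal by (rule separates_between[OF gap_13, of "109 / 500" "57 / 250"]) (use \<theta> in auto)
  subgoal by (rule separates_between[OF gap_14, of "57 / 250" "47 / 200"]) (use \<theta> in auto)
  subgoal by (rule separates_between[OF gap_15, of "9588 / 37663" "47 / 200"]) (use \<theta> in auto)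
  subgoal by (rule separates_between[OF gap_16, of "55716 / 128711" "55850 / 128711"]) (use \<theta> in auto)
  subgoal by (rule separates_between[OF gap_17, of "433 / 1000" "437 / 1000"]) (use \<theta> in auto)
  subgoal by (rule separates_between[OF gap_18, of "437 / 1000" "56 / 125"]) (use \<theta> in auto)
  subgoal by (rule separates_between[OF gap_19, of "56 / 125" "47 / 100"]) (use \<theta> in auto)
  subgoal by (rule separates_between[OF gap_20, of "47 / 100" "1 / 2"]) (use \<theta> in auto)
  done

lemma not_coincide_elsewhere:
  assumes \<theta>: "0 < \<theta>" "\<theta> \<le> 1/2" and "\<theta> \<noteq> 5621 / 33696" "\<theta> < 2155/10000 \<or> 2158/10000 < \<theta>"
    "\<theta> < 9588 / 37663 \<or> 55716 / 128711 < \<theta>"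
  shows "\<not> equilibria_coincide \<theta>"
proof -
  have "0 \<le> \<theta>" using \<theta> by simp
  note g = gaps[OF this \<theta>(2)]
  consider "\<theta> < 5621 / 33696" | "5621 / 33696 < \<theta>" "\<theta> < 2155/10000" | "2158/10000 < \<theta>" "\<theta> < 9588 / 37663"
    | "55716 / 128711 < \<theta>" using assms by linarith
  then show ?thesis
  proof cases
    case 1
    then show ?thesis using g(1,2,3,4,5,6,7,8) \<theta> by linarith
  next
    case 2
    then show ?thesis using g(9,10,11) \<theta> by linarith
  next
    case 3
    then show ?thesis using g(12,13,14,15) \<theta> by linarith
  next
    case 4
    then show ?thesis using g(16,17,18,19,20) \<theta> by linarith
  qed
qed

lemma second_root: "\<exists>\<theta>\<^sub>2. second_poly \<theta>\<^sub>2 = 0 \<and> \<bar>\<theta>\<^sub>2 - 0.215651\<bar> \<le> 0.0000005"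
proof -
  have "\<exists>x\<ge>0.2156505. x \<le> 0.2156515 \<and> second_poly x = 0"
    by (rule IVT') (auto simp: second_poly_def power2_eq_square intro!: continuous_intros)
  then obtain x where "0.2156505 \<le> x" "x \<le> 0.2156515" "second_poly x = 0" by blast
  moreover from this have "\<bar>x - 0.215651\<bar> \<le> 0.0000005" by (intro abs_leI) simp_all
  ultimately show ?thesis by blast
qed

lemma second_root_unique:
  assumes "second_poly x = 0" "second_poly y = 0" "2155/10000 \<le> x" "2155/10000 \<le> y"
  shows "x = y"
proof -
  have "(x - y) * (8414116560 * (x + y) - 1952936938) = 0"
    using assms(1,2) by (simp add: second_poly_def power2_eq_square algebra_simps)
  moreover have "8414116560 * (x + y) - 1952936938 > 0" using assms(3,4) by simp
  ultimately show ?thesis by simp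
qed

theorem mainTheorem5:
  shows "(\<forall>\<theta>::real. \<theta> \<in> {9588/37663 <..< 55716/128711} \<longrightarrow>
            equilibria_coincide \<theta> \<and>
            (\<exists>p \<beta>. correlated_equilibrium \<theta> p \<beta>) \<and>
            (\<forall>p \<beta>. correlated_equilibrium \<theta> p \<beta> \<longrightarrow>
               pmf p (False, False) = 4/121 \<and> pmf p (False, True) = 18/121 \<and>
               pmf p (True, False) = 18/121 \<and> pmf p (True, True) = 81/121 \<and>
               p = product_mixture (9/11) (9/11)))
       \<and> (\<exists>\<theta>\<^sub>2::real.
            29851341 - 1952936938 * \<theta>\<^sub>2 + 8414116560 * \<theta>\<^sub>2\<^sup>2 = 0 \<and>
            \<bar>\<theta>\<^sub>2 - 0.215651\<bar> \<le> 0.0000005 \<and>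
            (\<forall>\<theta>::real. 0 < \<theta> \<and> \<theta> \<le> 1/2 \<longrightarrow>
               (equilibria_coincide \<theta> \<longleftrightarrow>
                  \<theta> \<in> {9588/37663 <..< 55716/128711} \<or>
                  \<theta> = 9588/37663 \<or> \<theta> = 55716/128711 \<or>
                  \<theta> = 5621/33696 \<or> \<theta> = \<theta>\<^sub>2)))"
proof -
  have plateau_pmf: "pmf p (False, False) = 4/121 \<and> pmf p (False, True) = 18/121 \<and>
      pmf p (True, False) = 18/121 \<and> pmf p (True, True) = 81/121 \<and> p = product_mixture (9/11) (9/11)"
    if "correlated_equilibrium \<theta> p \<beta>" "\<theta> \<in> {9588/37663 <..< 55716/128711}" for \<theta> p \<beta>
  proof -
    have "pmf p = product_at (9/11) (9/11)"
      by (rule plateau_equilibria(2)[OF _ _ that(1)]) (use that(2) in auto)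
    moreover from this have "p = product_mixture (9/11) (9/11)"
      by (intro pmf_eqI) (simp add: pmf_product_mixture)
    ultimately show ?thesis by simp
  qed
  obtain \<theta>\<^sub>2 where root: "second_poly \<theta>\<^sub>2 = 0" "\<bar>\<theta>\<^sub>2 - 0.215651\<bar> \<le> 0.0000005" using second_root by blast
  have near: "2155/10000 \<le> \<theta>\<^sub>2" "\<theta>\<^sub>2 \<le> 2158/10000" using abs_le_D1[OF root(2)] abs_le_D2[OF root(2)] by simp_all
  have iff: "equilibria_coincide \<theta> \<longleftrightarrow> \<theta> \<in> {9588/37663 <..< 55716/128711} \<or> \<theta> = 9588/37663 \<or> \<theta> = 55716/128711 \<or>
      \<theta> = 5621/33696 \<or> \<theta> = \<theta>\<^sub>2" if "0 < \<theta>" "\<theta> \<le> 1/2" for \<theta>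
  proof -
    consider (plateau) "9588/37663 \<le> \<theta>" "\<theta> \<le> 55716/128711" | (first) "\<theta> = 5621/33696"
      | (second) "2155/10000 \<le> \<theta>" "\<theta> \<le> 2158/10000"
      | (else) "\<theta> \<noteq> 5621 / 33696" "\<theta> < 2155/10000 \<or> 2158/10000 < \<theta>" "\<theta> < 9588 / 37663 \<or> 55716 / 128711 < \<theta>"
      by linarith
    then show ?thesis
    proof cases
      case plateau
      then show ?thesis using plateau_coincide by auto
    next
      case first
      then show ?thesis using coincide_first by metis
    next
      case second
      have "second_poly \<theta> = 0 \<longleftrightarrow> \<theta> = \<theta>\<^sub>2" using second_root_unique[OF _ root(1) second(1) near(1)] root(1) by auto
      then show ?thesis using coincide_second_iff[OF second] second by auto
    next
      case else
      then show ?thesis using not_coincide_elsewhere[OF that else] near by auto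
    qed
  qed
  show ?thesis
    using plateau_coincide plateau_equilibria(1) plateau_pmf iff root
    by (auto simp: second_poly_def intro!: exI[of _ \<theta>\<^sub>2])
qed

end
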